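(* Let $d\ge 1$ and let $\mathcal{T}:\mathcal{M}_d\to\mathcal{M}_d$ be a quantum channel. Let $\mathbb{C}^d = H_0\oplus\bigoplus_{k=1}^K (H_{k,1}\otimes H_{k,2})$ be a decomposition such that the peripheral subspace of $\mathcal{T}$ satisfies $\chi_{\mathcal{T}} = 0\oplus\bigoplus_{k=1}^K \mathcal{M}_{d_k}\otimes\omega_k$, where $\mathcal{M}_{d_k}$ is the full matrix algebra on $H_{k,1}$, $d_k=\dim H_{k,1}$, and $\omega_k$ is a density operator on $H_{k,2}$. Then for every $\delta\in[0,1)$, $$C^\infty_\delta(\mathcal{T}) = \log\left(\left\lfloor \frac{\sum_{k=1}^K d_k}{1-\delta}\right\rfloor\right),$$ and $$\log\left(\left\lfloor \frac{\max_k d_k}{\sqrt{1-\delta}}\right\rfloor\right)\le Q^\infty_\delta(\mathcal{T})\le \log\left(\frac{\max_k d_k}{1-\delta}\right).$$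
   Context: A quantum channel is a completely positive trace-preserving linear map. For a channel $\mathcal{T}:\mathcal{M}_d\to\mathcal{M}_d$, a channel $\mathcal{E}:\mathcal{M}_D\to\mathcal{M}_d$ is a $(D,\delta)$ classical code for $\mathcal{T}$ if there is a channel $\mathcal{R}:\mathcal{M}_d\to\mathcal{M}_D$ with $\frac1D\sum_{i=1}^D\langle i|\mathcal{R}\circ\mathcal{T}\circ\mathcal{E}(|i\rangle\langle i|)|i\rangle\ge 1-\delta$ for a fixed orthonormal basis $\{|i\rangle\}$ of $\mathbb{C}^D$; it is a $(D,\delta)$ quantum code if there is a channel $\mathcal{R}$ with $\langle\Phi^+|(\mathcal{I}\otimes(\mathcal{R}\circ\mathcal{T}\circ\mathcal{E}))(|\Phi^+\rangle\langle\Phi^+|)|\Phi^+\rangle\ge1-\delta$, where $|\Phi^+\rangle=\frac{1}{\sqrt D}\sum_{i=1}^D|i\rangle\otimes|i\rangle$ and $\mathcal{I}$ is the identity channel on $\mathcal{M}_D$. The one-shot capacities are $C_\delta(\mathcal{T})=\sup\log D$ over $(D,\delta)$ classical codes and $Q_\delta(\mathcal{T})=\sup\log D$ over $(D,\delta)$ quantum codes. The infinite-time capacities are $C^\infty_\delta(\mathcal{T})=\lim_{t\to\infty}C_\delta(\mathcal{T}^t)$ and $Q^\infty_\delta(\mathcal{T})=\lim_{t\to\infty}Q_\delta(\mathcal{T}^t)$, where $\mathcal{T}^t$ is the $t$-fold composition. The peripheral subspace is $\chi_{\mathcal{T}}=\mathrm{span}\{X\in\mathcal{M}_d:\mathcal{T}(X)=\lambda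 X,\ \lambda\in\mathbb{C},\ |\lambda|=1\}$; it is known that for every channel a decomposition of $\chi_{\mathcal{T}}$ of the stated form exists. *)

theory Defs
  imports "HOL-Analysis.Analysis" "Jordan_Normal_Form.Matrix"
begin

(* Matrices M_n are complex n x n matrices, i.e. elements of carrier_mat n n.
   Linear maps M_n -> M_m are functions complex mat => complex mat, only
   their behaviour on carrier_mat n n matters. *)

definition mtrace :: "complex mat \<Rightarrow> complex" where
  "mtrace A = (\<Sum>i<dim_row A. A $$ (i, i))"

definition madj :: "complex mat \<Rightarrow> complex mat" where
  "madj A = mat (dim_col A) (dim_row A) (\<lambda>(i, j). cnj (A $$ (j, i)))"

definition unitary_mat :: "nat \<Rightarrow> complex mat \<Rightarrow> bool" where
  "unitary_mat n U \<longleftrightarrow> U \<in> carrier_mat n n \<and> U * madj U = 1\<^sub>m n \<and> madj U * U = 1\<^sub>m n"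

definition psd :: "nat \<Rightarrow> complex mat \<Rightarrow> bool" where
  "psd n A \<longleftrightarrow> A \<in> carrier_mat n n \<and> A = madj A \<and>
     (\<forall>v :: nat \<Rightarrow> complex. 0 \<le> Re (\<Sum>i<n. \<Sum>j<n. cnj (v i) * A $$ (i, j) * v j))"

definition density_op :: "nat \<Rightarrow> complex mat \<Rightarrow> bool" where
  "density_op n A \<longleftrightarrow> psd n A \<and> mtrace A = 1"

definition kron :: "complex mat \<Rightarrow> complex mat \<Rightarrow> complex mat" where
  "kron A B = mat (dim_row A * dim_row B) (dim_col A * dim_col B)
     (\<lambda>(i, j). A $$ (i div dim_row B, j div dim_col B) * B $$ (i mod dim_row B, j mod dim_col B))"

(* (id_{M_k} \<otimes> \<Phi>) applied to X \<in> M_k \<otimes> M_n = M_{k n}, where \<Phi> : M_n -> M_m *)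
definition ampl :: "nat \<Rightarrow> nat \<Rightarrow> nat \<Rightarrow> (complex mat \<Rightarrow> complex mat) \<Rightarrow> complex mat \<Rightarrow> complex mat" where
  "ampl k n m \<Phi> X = mat (k * m) (k * m)
     (\<lambda>(i, j). \<Phi> (mat n n (\<lambda>(a, b). X $$ ((i div m) * n + a, (j div m) * n + b))) $$ (i mod m, j mod m))"

definition linear_on :: "nat \<Rightarrow> (complex mat \<Rightarrow> complex mat) \<Rightarrow> bool" where
  "linear_on n \<Phi> \<longleftrightarrow> (\<forall>A \<in> carrier_mat n n. \<forall>B \<in> carrier_mat n n. \<forall>c :: complex.
      \<Phi> (A + B) = \<Phi> A + \<Phi> B \<and> \<Phi> (c \<cdot>\<^sub>m A) = c \<cdot>\<^sub>m \<Phi> A)"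

definition completely_positive :: "nat \<Rightarrow> nat \<Rightarrow> (complex mat \<Rightarrow> complex mat) \<Rightarrow> bool" where
  "completely_positive n m \<Phi> \<longleftrightarrow> (\<forall>k X. psd (k * n) X \<longrightarrow> psd (k * m) (ampl k n m \<Phi> X))"

definition trace_preserving :: "nat \<Rightarrow> (complex mat \<Rightarrow> complex mat) \<Rightarrow> bool" where
  "trace_preserving n \<Phi> \<longleftrightarrow> (\<forall>X \<in> carrier_mat n n. mtrace (\<Phi> X) = mtrace X)"

definition channel :: "nat \<Rightarrow> nat \<Rightarrow> (complex mat \<Rightarrow> complex mat) \<Rightarrow> bool" where
  "channel n m \<Phi> \<longleftrightarrow> (\<forall>X \<in> carrier_mat n n. \<Phi> X \<in> carrier_mat m m) \<and> linear_on n \<Phi> \<and>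
     completely_positive n m \<Phi> \<and> trace_preserving n \<Phi>"

definition basis_proj :: "nat \<Rightarrow> nat \<Rightarrow> complex mat" where
  "basis_proj D i = mat D D (\<lambda>(a, b). if a = i \<and> b = i then 1 else 0)"

(* |Phi+><Phi+| in M_D \<otimes> M_D, |Phi+> = D^{-1/2} \<Sum>_i |i>\<otimes>|i>, |i>\<otimes>|j> ~ index i*D+j *)
definition max_ent :: "nat \<Rightarrow> complex mat" where
  "max_ent D = mat (D * D) (D * D)
     (\<lambda>(p, q). if p mod (D + 1) = 0 \<and> q mod (D + 1) = 0 then 1 / of_nat D else 0)"

definition classical_code ::
  "nat \<Rightarrow> (complex mat \<Rightarrow> complex mat) \<Rightarrow> nat \<Rightarrow> real \<Rightarrow> (complex mat \<Rightarrow> complex mat) \<Rightarrow> bool" where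
  "classical_code d T D \<delta> E \<longleftrightarrow> channel D d E \<and>
     (\<exists>R. channel d D R \<and>
        (1 / real D) * (\<Sum>i<D. Re ((R (T (E (basis_proj D i)))) $$ (i, i))) \<ge> 1 - \<delta>)"

definition quantum_code ::
  "nat \<Rightarrow> (complex mat \<Rightarrow> complex mat) \<Rightarrow> nat \<Rightarrow> real \<Rightarrow> (complex mat \<Rightarrow> complex mat) \<Rightarrow> bool" where
  "quantum_code d T D \<delta> E \<longleftrightarrow> channel D d E \<and>
     (\<exists>R. channel d D R \<and>
        (let Y = ampl D D D (R \<circ> T \<circ> E) (max_ent D) in
          Re ((1 / of_nat D) * (\<Sum>i<D. \<Sum>j<D. Y $$ (i * D + i, j * D + j)))) \<ge> 1 - \<delta>)"

definition C_cap :: "nat \<Rightarrow> real \<Rightarrow> (complex mat \<Rightarrow> complex mat) \<Rightarrow> ereal" where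
  "C_cap d \<delta> T = Sup {ereal (log 2 (real D)) | D. D \<ge> 1 \<and> (\<exists>E. classical_code d T D \<delta> E)}"

definition Q_cap :: "nat \<Rightarrow> real \<Rightarrow> (complex mat \<Rightarrow> complex mat) \<Rightarrow> ereal" where
  "Q_cap d \<delta> T = Sup {ereal (log 2 (real D)) | D. D \<ge> 1 \<and> (\<exists>E. quantum_code d T D \<delta> E)}"

definition C_inf :: "nat \<Rightarrow> real \<Rightarrow> (complex mat \<Rightarrow> complex mat) \<Rightarrow> ereal" where
  "C_inf d \<delta> T = lim (\<lambda>t. C_cap d \<delta> (T ^^ t))"

definition Q_inf :: "nat \<Rightarrow> real \<Rightarrow> (complex mat \<Rightarrow> complex mat) \<Rightarrow> ereal" where
  "Q_inf d \<delta> T = lim (\<lambda>t. Q_cap d \<delta> (T ^^ t))"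

definition peripheral_space :: "nat \<Rightarrow> (complex mat \<Rightarrow> complex mat) \<Rightarrow> complex mat set" where
  "peripheral_space d T = {X. X \<in> carrier_mat d d \<and>
     (\<exists>(n::nat) (c :: nat \<Rightarrow> complex) (A :: nat \<Rightarrow> complex mat).
        (\<forall>l<n. A l \<in> carrier_mat d d \<and> (\<exists>z::complex. cmod z = 1 \<and> T (A l) = z \<cdot>\<^sub>m A l)) \<and>
        (\<forall>i<d. \<forall>j<d. X $$ (i, j) = (\<Sum>l<n. c l * A l $$ (i, j))))}"

end

theory Submission
  imports Defs "Jordan_Normal_Form.Schur_Decomposition"
begin

text \<open>
  Powers of a channel stay bounded, so \<open>T\<^bsup>r k\<^esup> \<longrightarrow> L\<close> along a subsequence, and along a further subsequence of
  the gaps \<open>r (2 i) - r i\<close> the powers converge to a channel \<open>P\<close> with \<open>P L = L\<close>. Then \<open>P\<close> is the identity on the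
  peripheral space, and triangularising \<open>T\<close> shows that \<open>L\<close> maps into the peripheral space. Limits of
  \<open>T\<^bsup>m - t\<^esup>\<close> along the gaps \<open>m\<close> invert \<open>T\<^bsup>t\<^esup>\<close> on the peripheral space, so codes for the block algebra
  \<open>\<Oplus>\<^sub>k M\<^bsub>d k\<^esub> \<otimes> \<omega>\<^sub>k\<close> are codes for every \<open>T\<^bsup>t\<^esup>\<close>: use the \<open>\<Sum>d\<^sub>k\<close> diagonal states, respectively the largest block.

  Conversely \<open>T\<^bsup>t\<^esup>\<close> is, for suitable \<open>t\<close>, as close to \<open>L\<close> as desired, with an error in the success probability that
  does not depend on the code size. A state in the block algebra is dominated by \<open>\<Oplus>\<^sub>k 1 \<otimes> \<omega>\<^sub>k\<close>, of trace \<open>\<Sum>d\<^sub>k\<close>,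
  which bounds the classical success probability. The entanglement fidelity of a map through the block algebra is
  \<open>D\<^sup>-\<^sup>2 \<Sum>\<^sub>k \<langle>X\<^sub>k, J\<^sub>k\<rangle>\<close> with positive semidefinite Choi matrices of the two halves, where \<open>\<Sum>tr X\<^sub>k = D\<close> and
  \<open>tr J\<^sub>k = d\<^sub>k\<close>; and \<open>\<langle>X, J\<rangle> \<le> tr X \<cdot> tr J\<close>.
\<close>

section \<open>Positive semidefinite kernels\<close>

text \<open>A capacity is a supremum over codes of arbitrary size, so no estimate may depend on
  \<open>D\<close>. What makes this possible is that the entries of a channel applied to a matrix
  unit have modulus at most 1 in all dimensions: expanding the encoder's output and the decoder's
  argument in matrix units of M_d costs a factor depending on \<open>d\<close> alone. The D
  (classical) or D^2 (quantum) terms of the success sum carry as many errors, which the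
  normalisation absorbs, and since \<open>D\<close> is an integer a small enough error disappears
  altogether. One good exponent suffices, because a decoder may start by applying T once more, so
  that capacities decrease with t. No spectral projection onto the peripheral space is constructed.
  The limit L need not be idempotent; what counts is that its range is peripheral and that some
  sequence of powers tends to the identity on the peripheral space. Positivity is handled by Gram
  factorisations throughout, so that Kraus operators, tensor products and compressions become
  rearrangements of finite sums.\<close>

definition psd_on :: "'a set \<Rightarrow> ('a \<Rightarrow> 'a \<Rightarrow> complex) \<Rightarrow> bool" where
  "psd_on S A \<longleftrightarrow> (\<forall>i\<in>S. \<forall>j\<in>S. A j i = cnj (A i j)) \<and>
     (\<forall>v. 0 \<le> Re (\<Sum>i\<in>S. \<Sum>j\<in>S. cnj (v i) * A i j * v j))"

text \<open>Kernels live on arbitrary index sets, so that pairs and block labels can serve as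
  indices without being flattened to numbers; this is the bridge back to \<open>psd\<close>.\<close>

lemma psd_iff_psd_on:
  "psd n A \<longleftrightarrow> A \<in> carrier_mat n n \<and> psd_on {..<n} (\<lambda>i j. A $$ (i, j))"
proof -
  have "A = madj A \<longleftrightarrow> (\<forall>i\<in>{..<n}. \<forall>j\<in>{..<n}. A $$ (j, i) = cnj (A $$ (i, j)))"
    if "A \<in> carrier_mat n n"
  proof
    assume h: "A = madj A"
    show "\<forall>i\<in>{..<n}. \<forall>j\<in>{..<n}. A $$ (j, i) = cnj (A $$ (i, j))"
    proof (intro ballI)
      fix i j assume ij: "i \<in> {..<n}" "j \<in> {..<n}"
      have "A $$ (j, i) = madj A $$ (j, i)" using h by simp
      also have "\<dots> = cnj (A $$ (i, j))" using ij that by (simp add: madj_def)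
      finally show "A $$ (j, i) = cnj (A $$ (i, j))" .
    qed
  next
    assume h: "\<forall>i\<in>{..<n}. \<forall>j\<in>{..<n}. A $$ (j, i) = cnj (A $$ (i, j))"
    show "A = madj A"
    proof (rule eq_matI)
      fix i j assume "i < dim_row (madj A)" "j < dim_col (madj A)"
      then have ij: "i < n" "j < n" using that by (auto simp: madj_def)
      then have "madj A $$ (i, j) = cnj (A $$ (j, i))" using that by (simp add: madj_def)
      also have "\<dots> = A $$ (i, j)" using bspec[OF bspec[OF h, of j], of i] ij by simp
      finally show "A $$ (i, j) = madj A $$ (i, j)" by simp
    qed (use that in \<open>auto simp: madj_def\<close>)
  qed
  then show ?thesis unfolding psd_def psd_on_def by blast
qed

lemma psd_on_cong:
  assumes "\<And>i j. i \<in> S \<Longrightarrow> j \<in> S \<Longrightarrow> A i j = B i j"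
  shows "psd_on S A \<longleftrightarrow> psd_on S B"
  unfolding psd_on_def using assms by (simp cong: sum.cong)

lemma sum_rotate3:
  "(\<Sum>i\<in>A. \<Sum>j\<in>B. \<Sum>l\<in>C. f i j l) = (\<Sum>l\<in>C. \<Sum>i\<in>A. \<Sum>j\<in>B. f i j l)"
proof -
  have "(\<Sum>i\<in>A. \<Sum>j\<in>B. \<Sum>l\<in>C. f i j l) = (\<Sum>i\<in>A. \<Sum>l\<in>C. \<Sum>j\<in>B. f i j l)"
    by (intro sum.cong refl sum.swap)
  also have "\<dots> = (\<Sum>l\<in>C. \<Sum>i\<in>A. \<Sum>j\<in>B. f i j l)"
    by (rule sum.swap)
  finally show ?thesis .
qed

text \<open>The form of a Gram kernel is a sum of squared moduli. Exhibiting \<open>W\<close> is the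
  usual way to prove positivity below; \<open>psd_on_gram_exists\<close> is the converse.\<close>

lemma psd_on_gram:
  assumes "\<And>i j. i \<in> S \<Longrightarrow> j \<in> S \<Longrightarrow> A i j = (\<Sum>l\<in>I. W i l * cnj (W j l))"
  shows "psd_on S A"
  unfolding psd_on_def
proof (intro conjI ballI allI)
  fix i j assume "i \<in> S" "j \<in> S"
  then show "A j i = cnj (A i j)" by (simp add: assms mult.commute)
next
  fix v
  have "(\<Sum>i\<in>S. \<Sum>j\<in>S. cnj (v i) * A i j * v j)
      = (\<Sum>i\<in>S. \<Sum>j\<in>S. \<Sum>l\<in>I. (cnj (v i) * W i l) * cnj (cnj (v j) * W j l))"
    by (intro sum.cong refl) (simp add: assms sum_distrib_left sum_distrib_right algebra_simps)
  also have "\<dots> = (\<Sum>l\<in>I. \<Sum>i\<in>S. \<Sum>j\<in>S. (cnj (v i) * W i l) * cnj (cnj (v j) * W j l))"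
    by (rule sum_rotate3)
  also have "\<dots> = (\<Sum>l\<in>I. of_real ((cmod (\<Sum>i\<in>S. cnj (v i) * W i l))\<^sup>2))"
    by (intro sum.cong refl)
      (simp add: complex_norm_square sum_product flip: of_real_power)
  finally show "0 \<le> Re (\<Sum>i\<in>S. \<Sum>j\<in>S. cnj (v i) * A i j * v j)"
    by (auto intro!: sum_nonneg)
qed

lemma form_insert:
  fixes A :: "'a \<Rightarrow> 'a \<Rightarrow> complex"
  assumes "finite S" "x \<notin> S"
  shows "(\<Sum>i\<in>insert x S. \<Sum>j\<in>insert x S. cnj (v i) * A i j * v j)
     = (\<Sum>i\<in>S. \<Sum>j\<in>S. cnj (v i) * A i j * v j) + cnj (v x) * (\<Sum>j\<in>S. A x j * v j)
       + (\<Sum>i\<in>S. cnj (v i) * A i x) * v x + cnj (v x) * A x x * v x"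
  using assms by (simp add: sum.distrib sum_distrib_left sum_distrib_right algebra_simps)

lemma psd_on_subset:
  assumes "psd_on S A" "R \<subseteq> S" "finite S"
  shows "psd_on R A"
  unfolding psd_on_def
proof (intro conjI ballI allI)
  fix i j assume "i \<in> R" "j \<in> R"
  then show "A j i = cnj (A i j)" using assms unfolding psd_on_def by blast
next
  fix v
  define w where "w = (\<lambda>i. if i \<in> R then v i else (0::complex))"
  have in1: "(\<Sum>j\<in>S. cnj (w i) * A i j * w j) = (\<Sum>j\<in>R. cnj (w i) * A i j * v j)" for i
    using assms(2,3) by (intro sum.mono_neutral_cong_right) (auto simp: w_def)
  have "(\<Sum>i\<in>S. \<Sum>j\<in>S. cnj (w i) * A i j * w j) = (\<Sum>i\<in>R. \<Sum>j\<in>R. cnj (v i) * A i j * v j)"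
    unfolding in1 using assms(2,3) finite_subset[OF assms(2,3)] by (intro sum.mono_neutral_cong_right) (auto simp: w_def)
  moreover have "0 \<le> Re (\<Sum>i\<in>S. \<Sum>j\<in>S. cnj (w i) * A i j * w j)"
    using assms(1) unfolding psd_on_def by blast
  ultimately show "0 \<le> Re (\<Sum>i\<in>R. \<Sum>j\<in>R. cnj (v i) * A i j * v j)" by simp
qed

lemma psd_on_diag:
  assumes "psd_on S A" "x \<in> S" "finite S"
  shows "A x x = of_real (Re (A x x))" "0 \<le> Re (A x x)"
proof -
  have s: "psd_on {x} A" using psd_on_subset[OF assms(1) _ assms(3)] assms(2) by simp
  then have "A x x = cnj (A x x)" unfolding psd_on_def by blast
  then show "A x x = of_real (Re (A x x))" by (metis Reals_cnj_iff of_real_Re)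
  have "0 \<le> Re (\<Sum>i\<in>{x}. \<Sum>j\<in>{x}. cnj (1::complex) * A i j * 1)"
    using s unfolding psd_on_def by (elim conjE allE[of _ "\<lambda>_. 1"])
  then show "0 \<le> Re (A x x)" by simp
qed

text \<open>Otherwise the form on the two indices would be affine with nonzero slope along a line of
  test vectors, and so take negative values.\<close>

lemma psd_on_zero_diag:
  assumes "psd_on S A" "x \<in> S" "i \<in> S" "finite S" "A x x = 0"
  shows "A x i = 0"
proof (rule ccontr)
  assume nz: "A x i \<noteq> 0"
  then have xi: "x \<noteq> i" using assms(5) by auto
  have s: "psd_on {x, i} A" using psd_on_subset[OF assms(1) _ assms(4)] assms(2,3) by simp
  have herm: "A i x = cnj (A x i)" using s unfolding psd_on_def by blast
  define a where "a = (cmod (A x i))\<^sup>2"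
  have apos: "a > 0" using nz by (simp add: a_def)
  have aeq: "cnj (A x i) * A x i = of_real a"
    by (simp add: a_def complex_norm_square mult.commute flip: of_real_power)
  \<comment> \<open>Chosen so that the form takes the value -1 at \<open>v\<close>.\<close>
  define t where "t = (Re (A i i) + 1) / (2 * a)"
  define v where "v = (\<lambda>j. if j = x then - of_real t * A x i else (1::complex))"
  have "0 \<le> Re (\<Sum>k\<in>{x,i}. \<Sum>j\<in>{x,i}. cnj (v k) * A k j * v j)"
    using s unfolding psd_on_def by blast
  also have "(\<Sum>k\<in>{x,i}. \<Sum>j\<in>{x,i}. cnj (v k) * A k j * v j)
     = A i i - 2 * of_real t * (cnj (A x i) * A x i)"
    using xi assms(5) herm by (simp add: v_def algebra_simps)
  finally have "0 \<le> Re (A i i) - 2 * t * a" unfolding aeq by simp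
  moreover have "2 * t * a = Re (A i i) + 1" using apos by (simp add: t_def)
  ultimately show False by simp
qed

text \<open>Cholesky factorisation: split off the row of \<open>x\<close> and pass to the Schur complement.\<close>

lemma psd_on_gram_exists:
  fixes A :: "'a \<Rightarrow> 'a \<Rightarrow> complex"
  assumes "finite S" "psd_on S A"
  shows "\<exists>W. \<forall>i\<in>S. \<forall>j\<in>S. A i j = (\<Sum>l\<in>S. W i l * cnj (W j l))"
  using assms
proof (induction S arbitrary: A rule: finite_induct)
  case (insert x S)
  define c where "c = Re (A x x)"
  have Axx: "A x x = of_real c" and c0: "0 \<le> c"
    using psd_on_diag[OF insert.prems, of x] insert.hyps by (auto simp: c_def)
  have herm: "A j i = cnj (A i j)" if "i \<in> insert x S" "j \<in> insert x S" for i j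
    using insert.prems that unfolding psd_on_def by blast
  show ?case
  proof (cases "c = 0")
    case True
    have z: "A x i = 0" "A i x = 0" if "i \<in> S" for i
      using psd_on_zero_diag[OF insert.prems, of x i] that True Axx insert.hyps
        herm[of x i] by auto
    have "psd_on S A" using psd_on_subset[OF insert.prems, of S] insert.hyps by auto
    from insert.IH[OF this] obtain W where
      W: "\<forall>i\<in>S. \<forall>j\<in>S. A i j = (\<Sum>l\<in>S. W i l * cnj (W j l))" by blast
    \<comment> \<open>With a zero pivot, row and column \<open>x\<close> of \<open>A\<close> vanish,
      so the new column of the factor is zero.\<close>
    define V where "V = (\<lambda>i l. if i = x \<or> l = x then 0 else W i l)"
    have "A i j = (\<Sum>l\<in>insert x S. V i l * cnj (V j l))" if "i \<in> insert x S" "j \<in> insert x S" for i j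
    proof (cases "i = x \<or> j = x")
      case True
      then show ?thesis using that z \<open>c = 0\<close> Axx by (auto simp: V_def)
    next
      case False
      then have "A i j = (\<Sum>l\<in>S. W i l * cnj (W j l))" using W that by blast
      also have "\<dots> = (\<Sum>l\<in>S. V i l * cnj (V j l))"
        using False insert.hyps by (intro sum.cong) (auto simp: V_def)
      finally show ?thesis using insert.hyps by (simp add: V_def)
    qed
    then show ?thesis by blast
  next
    case False
    then have cpos: "c > 0" using c0 by simp
    define B where "B = (\<lambda>i j. A i j - A i x * cnj (A j x) / of_real c)"
    have "psd_on S B"
      unfolding psd_on_def
    proof (intro conjI ballI allI)
      fix i j assume "i \<in> S" "j \<in> S"
      then show "B j i = cnj (B i j)" using herm[of i j] by (simp add: B_def mult.commute)
    next
      fix v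
      define b where "b = (\<Sum>j\<in>S. A x j * v j)"
      \<comment> \<open>The coordinate at \<open>x\<close> completes the square: the form of
        \<open>A\<close> at \<open>w\<close> is then the form of the Schur complement at
        \<open>v\<close>.\<close>
      define w where "w = (\<lambda>i. if i = x then - b / of_real c else v i)"
      have wS: "w i = v i" if "i \<in> S" for i using that insert.hyps by (auto simp: w_def)
      have b': "(\<Sum>i\<in>S. cnj (v i) * A i x) = cnj b"
        unfolding b_def cnj_sum
      proof (intro sum.cong refl)
        fix i assume "i \<in> S"
        then show "cnj (v i) * A i x = cnj (A x i * v i)" using herm[of x i] by (simp add: mult.commute)
      qed
      have "(\<Sum>i\<in>insert x S. \<Sum>j\<in>insert x S. cnj (w i) * A i j * w j)
        = (\<Sum>i\<in>S. \<Sum>j\<in>S. cnj (v i) * A i j * v j) + cnj (w x) * b + cnj b * w x + cnj (w x) * A x x * w x"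
        unfolding form_insert[OF insert.hyps] b'[symmetric] unfolding b_def
        by (simp add: wS cong: sum.cong)
      also have "\<dots> = (\<Sum>i\<in>S. \<Sum>j\<in>S. cnj (v i) * A i j * v j) - cnj b * b / of_real c"
        using cpos by (simp add: w_def Axx field_simps)
      also have "cnj b * b / of_real c = (\<Sum>i\<in>S. \<Sum>j\<in>S. cnj (v i) * (A i x * cnj (A j x) / of_real c) * v j)"
      proof -
        have "cnj b * b = (\<Sum>i\<in>S. \<Sum>j\<in>S. (cnj (v i) * A i x) * (A x j * v j))"
          unfolding b'[symmetric] unfolding b_def by (rule sum_product)
        also have "\<dots> = (\<Sum>i\<in>S. \<Sum>j\<in>S. (cnj (v i) * A i x) * (cnj (A j x) * v j))"
        proof (intro sum.cong refl)
          fix i j assume "j \<in> S"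
          then show "(cnj (v i) * A i x) * (A x j * v j) = (cnj (v i) * A i x) * (cnj (A j x) * v j)"
            using herm[of j x] by simp
        qed
        finally show ?thesis by (simp add: sum_divide_distrib mult.assoc)
      qed
      also have "(\<Sum>i\<in>S. \<Sum>j\<in>S. cnj (v i) * A i j * v j) - \<dots> = (\<Sum>i\<in>S. \<Sum>j\<in>S. cnj (v i) * B i j * v j)"
        by (simp add: B_def algebra_simps sum_subtractf)
      finally have eq: "(\<Sum>i\<in>insert x S. \<Sum>j\<in>insert x S. cnj (w i) * A i j * w j)
        = (\<Sum>i\<in>S. \<Sum>j\<in>S. cnj (v i) * B i j * v j)" .
      have "0 \<le> Re (\<Sum>i\<in>insert x S. \<Sum>j\<in>insert x S. cnj (w i) * A i j * w j)"
        using insert.prems unfolding psd_on_def by blast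
      then show "0 \<le> Re (\<Sum>i\<in>S. \<Sum>j\<in>S. cnj (v i) * B i j * v j)" unfolding eq .
    qed
    from insert.IH[OF this] obtain W where
      W: "\<forall>i\<in>S. \<forall>j\<in>S. B i j = (\<Sum>l\<in>S. W i l * cnj (W j l))" by blast
    \<comment> \<open>Column \<open>x\<close> restores what the Schur complement subtracted; row
      \<open>x\<close> has no other nonzero entry.\<close>
    define V where "V = (\<lambda>i l. if l = x then A i x / of_real (sqrt c) else if i = x then 0 else W i l)"
    have sq: "complex_of_real (sqrt c) * of_real (sqrt c) = of_real c"
      using c0 by (simp flip: of_real_mult)
    have "A i j = (\<Sum>l\<in>insert x S. V i l * cnj (V j l))" if ij: "i \<in> insert x S" "j \<in> insert x S" for i j
    proof -
      have s1: "(\<Sum>l\<in>insert x S. V i l * cnj (V j l))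
          = A i x * cnj (A j x) / of_real c + (\<Sum>l\<in>S. V i l * cnj (V j l))"
        using insert.hyps sq by (simp add: V_def)
      show ?thesis
      proof (cases "i = x \<or> j = x")
        case True
        then have "(\<Sum>l\<in>S. V i l * cnj (V j l)) = 0"
          using insert.hyps by (intro sum.neutral) (auto simp: V_def)
        moreover have "A i x * cnj (A j x) / of_real c = A i j"
        proof (cases "j = x")
          case True
          then show ?thesis using cpos Axx by simp
        next
          case False
          then have "i = x" using \<open>i = x \<or> j = x\<close> by simp
          moreover have "cnj (A j x) = A x j" using herm[of j x] ij by simp
          ultimately show ?thesis using cpos Axx by simp
        qed
        ultimately show ?thesis using s1 by simp
      next
        case False
        then have "(\<Sum>l\<in>S. V i l * cnj (V j l)) = (\<Sum>l\<in>S. W i l * cnj (W j l))"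
          using insert.hyps by (intro sum.cong) (auto simp: V_def)
        also have "\<dots> = B i j" using W False ij by simp
        finally show ?thesis using s1 by (simp add: B_def)
      qed
    qed
    then show ?thesis by blast
  qed
qed simp

section \<open>Pairing of positive kernels and domination by the trace\<close>

lemma norm_sum_mult_square_le:
  fixes a b :: "'a \<Rightarrow> complex"
  shows "(cmod (\<Sum>i\<in>S. a i * b i))\<^sup>2 \<le> (\<Sum>i\<in>S. (cmod (a i))\<^sup>2) * (\<Sum>i\<in>S. (cmod (b i))\<^sup>2)"
proof -
  have "cmod (\<Sum>i\<in>S. a i * b i) \<le> (\<Sum>i\<in>S. cmod (a i) * cmod (b i))"
    using norm_sum[of "\<lambda>i. a i * b i" S] by (simp add: norm_mult)
  then have "(cmod (\<Sum>i\<in>S. a i * b i))\<^sup>2 \<le> (\<Sum>i\<in>S. cmod (a i) * cmod (b i))\<^sup>2"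
    by (rule power_mono) simp
  also have "\<dots> \<le> (\<Sum>i\<in>S. (cmod (a i))\<^sup>2) * (\<Sum>i\<in>S. (cmod (b i))\<^sup>2)"
    by (rule Cauchy_Schwarz_ineq_sum)
  finally show ?thesis .
qed

text \<open>In Gram factors the pairing is the sum over pairs of columns of |sum_i W i l * V i m|^2,
  and Cauchy-Schwarz bounds each term. \<open>B\<close> is not conjugated, so this is the trace of A
  times the transpose of B, the form in which two Choi matrices meet in a composition.\<close>

lemma psd_on_pairing_le:
  assumes "finite S" "psd_on S A" "psd_on S B"
  shows "Re (\<Sum>i\<in>S. \<Sum>j\<in>S. A i j * B i j) \<le> Re (\<Sum>i\<in>S. A i i) * Re (\<Sum>i\<in>S. B i i)"
proof -
  obtain W where W: "\<And>i j. i \<in> S \<Longrightarrow> j \<in> S \<Longrightarrow> A i j = (\<Sum>l\<in>S. W i l * cnj (W j l))"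
    using psd_on_gram_exists[OF assms(1,2)] by blast
  obtain V where V: "\<And>i j. i \<in> S \<Longrightarrow> j \<in> S \<Longrightarrow> B i j = (\<Sum>l\<in>S. V i l * cnj (V j l))"
    using psd_on_gram_exists[OF assms(1,3)] by blast
  have tr: "Re (\<Sum>i\<in>S. A i i) = (\<Sum>l\<in>S. \<Sum>i\<in>S. (cmod (W i l))\<^sup>2)"
    "Re (\<Sum>i\<in>S. B i i) = (\<Sum>l\<in>S. \<Sum>i\<in>S. (cmod (V i l))\<^sup>2)"
    by (subst sum.swap, simp add: W V cmod_power2 flip: power2_eq_square)+
  have "(\<Sum>i\<in>S. \<Sum>j\<in>S. A i j * B i j)
     = (\<Sum>i\<in>S. \<Sum>j\<in>S. \<Sum>l\<in>S. \<Sum>m\<in>S. (W i l * V i m) * cnj (W j l * V j m))"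
    by (intro sum.cong refl) (simp add: W V sum_product algebra_simps, rule sum.swap)
  also have "\<dots> = (\<Sum>l\<in>S. \<Sum>i\<in>S. \<Sum>j\<in>S. \<Sum>m\<in>S. (W i l * V i m) * cnj (W j l * V j m))"
    by (rule sum_rotate3)
  also have "\<dots> = (\<Sum>l\<in>S. \<Sum>m\<in>S. \<Sum>i\<in>S. \<Sum>j\<in>S. (W i l * V i m) * cnj (W j l * V j m))"
    by (intro sum.cong refl sum_rotate3)
  also have "\<dots> = (\<Sum>l\<in>S. \<Sum>m\<in>S. of_real ((cmod (\<Sum>i\<in>S. W i l * V i m))\<^sup>2))"
    by (intro sum.cong refl) (simp add: complex_norm_square sum_product flip: of_real_power)
  finally have "Re (\<Sum>i\<in>S. \<Sum>j\<in>S. A i j * B i j) = (\<Sum>l\<in>S. \<Sum>m\<in>S. (cmod (\<Sum>i\<in>S. W i l * V i m))\<^sup>2)"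
    by simp
  also have "\<dots> \<le> (\<Sum>l\<in>S. \<Sum>m\<in>S. (\<Sum>i\<in>S. (cmod (W i l))\<^sup>2) * (\<Sum>i\<in>S. (cmod (V i m))\<^sup>2))"
    by (intro sum_mono norm_sum_mult_square_le)
  also have "\<dots> = Re (\<Sum>i\<in>S. A i i) * Re (\<Sum>i\<in>S. B i i)"
    unfolding tr by (simp add: sum_product)
  finally show ?thesis .
qed

text \<open>Pairing \<open>A\<close> with the rank-one kernel of \<open>v\<close> bounds the form at
  \<open>v\<close> by the trace of \<open>A\<close> times |v|^2.\<close>

lemma psd_on_scalar_minus:
  assumes "finite S" "psd_on S A" and t: "Re (\<Sum>i\<in>S. A i i) \<le> t"
  shows "psd_on S (\<lambda>i j. (if i = j then of_real t else 0) - A i j)"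
  unfolding psd_on_def
proof (intro conjI ballI allI)
  fix i j assume "i \<in> S" "j \<in> S"
  then have "cnj (A i j) = A j i" using assms(2) unfolding psd_on_def by metis
  then show "(if j = i then of_real t else 0) - A j i = cnj ((if i = j then of_real t else 0) - A i j)"
    by simp
next
  fix v :: "'a \<Rightarrow> complex"
  have "psd_on S (\<lambda>i j. cnj (v i) * v j)"
    by (rule psd_on_gram[where I = "{()}" and W = "\<lambda>i _. cnj (v i)"]) simp
  from psd_on_pairing_le[OF assms(1,2) this]
  have "Re (\<Sum>i\<in>S. \<Sum>j\<in>S. cnj (v i) * A i j * v j) \<le> Re (\<Sum>i\<in>S. A i i) * Re (\<Sum>i\<in>S. cnj (v i) * v i)"
    by (simp add: algebra_simps)
  also have "\<dots> \<le> t * Re (\<Sum>i\<in>S. cnj (v i) * v i)"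
    using t by (intro mult_right_mono) (auto intro!: add_nonneg_nonneg sum_nonneg)
  finally have le: "Re (\<Sum>i\<in>S. \<Sum>j\<in>S. cnj (v i) * A i j * v j) \<le> t * Re (\<Sum>i\<in>S. cnj (v i) * v i)" .
  have "(\<Sum>i\<in>S. \<Sum>j\<in>S. cnj (v i) * ((if i = j then of_real t else 0) - A i j) * v j)
     = (\<Sum>i\<in>S. \<Sum>j\<in>S. (if i = j then cnj (v i) * of_real t * v j else 0) - cnj (v i) * A i j * v j)"
    by (intro sum.cong refl) (simp add: algebra_simps)
  also have "\<dots> = (\<Sum>i\<in>S. cnj (v i) * of_real t * v i) - (\<Sum>i\<in>S. \<Sum>j\<in>S. cnj (v i) * A i j * v j)"
    using assms(1) by (simp add: sum_subtractf sum.delta)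
  also have "(\<Sum>i\<in>S. cnj (v i) * of_real t * v i) = of_real t * (\<Sum>i\<in>S. cnj (v i) * v i)"
    by (simp add: sum_distrib_left algebra_simps)
  finally show "0 \<le> Re (\<Sum>i\<in>S. \<Sum>j\<in>S. cnj (v i) * ((if i = j then of_real t else 0) - A i j) * v j)"
    using le by simp
qed

section \<open>Channels\<close>

lemma psd_on_lim:
  assumes "\<And>k :: nat. psd_on S (A k)"
    and lim: "\<And>i j. i \<in> S \<Longrightarrow> j \<in> S \<Longrightarrow> (\<lambda>k. A k i j) \<longlonglongrightarrow> B i j"
  shows "psd_on S B"
  unfolding psd_on_def
proof (intro conjI ballI allI)
  fix i j assume ij: "i \<in> S" "j \<in> S"
  have "(\<lambda>k. cnj (A k i j)) \<longlonglongrightarrow> cnj (B i j)"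
    by (intro tendsto_cnj lim ij)
  moreover have "cnj (A k i j) = A k j i" for k
    using assms(1)[of k] ij unfolding psd_on_def by metis
  ultimately have "(\<lambda>k. A k j i) \<longlonglongrightarrow> cnj (B i j)" by simp
  then show "B j i = cnj (B i j)" using lim[OF ij(2,1)] LIMSEQ_unique by blast
next
  fix v
  have "(\<lambda>k. Re (\<Sum>i\<in>S. \<Sum>j\<in>S. cnj (v i) * A k i j * v j))
     \<longlonglongrightarrow> Re (\<Sum>i\<in>S. \<Sum>j\<in>S. cnj (v i) * B i j * v j)"
    by (intro tendsto_Re tendsto_sum tendsto_mult tendsto_const lim)
  moreover have "0 \<le> Re (\<Sum>i\<in>S. \<Sum>j\<in>S. cnj (v i) * A k i j * v j)" for k
    using assms(1)[of k] unfolding psd_on_def by blast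
  ultimately show "0 \<le> Re (\<Sum>i\<in>S. \<Sum>j\<in>S. cnj (v i) * B i j * v j)"
    by (intro LIMSEQ_le_const) auto
qed

lemma block_index_less:
  fixes a i m n :: nat
  assumes "a < n" "i < m"
  shows "a * m + i < n * m"
proof -
  have "a * m + i < Suc a * m" using assms(2) by simp
  also have "\<dots> \<le> n * m" using assms(1) by (intro mult_le_mono1) simp
  finally show ?thesis .
qed

definition munit :: "nat \<Rightarrow> nat \<Rightarrow> nat \<Rightarrow> complex mat" where
  "munit n a b = mat n n (\<lambda>(i, j). if i = a \<and> j = b then 1 else 0)"

lemma munit_carrier [simp]: "munit n a b \<in> carrier_mat n n"
  by (simp add: munit_def)

lemma basis_proj_eq_munit: "basis_proj D i = munit D i i"
  by (simp add: basis_proj_def munit_def)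

lemma mtrace_munit: "a < n \<Longrightarrow> mtrace (munit n a b) = (if a = b then 1 else 0)"
proof -
  assume "a < n"
  have "mtrace (munit n a b) = (\<Sum>i<n. if i = a then if a = b then 1 else 0 else 0)"
    unfolding mtrace_def munit_def by (auto intro!: sum.cong)
  also have "\<dots> = (if a = b then 1 else 0)" using \<open>a < n\<close> by simp
  finally show ?thesis .
qed

lemma channel_carrier: "channel n m \<Phi> \<Longrightarrow> X \<in> carrier_mat n n \<Longrightarrow> \<Phi> X \<in> carrier_mat m m"
  by (simp add: channel_def)

lemma channel_add:
  "channel n m \<Phi> \<Longrightarrow> X \<in> carrier_mat n n \<Longrightarrow> Y \<in> carrier_mat n n \<Longrightarrow> \<Phi> (X + Y) = \<Phi> X + \<Phi> Y"
  by (simp add: channel_def linear_on_def)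

lemma channel_smult:
  "channel n m \<Phi> \<Longrightarrow> X \<in> carrier_mat n n \<Longrightarrow> \<Phi> (c \<cdot>\<^sub>m X) = c \<cdot>\<^sub>m \<Phi> X"
  unfolding channel_def linear_on_def by blast

lemma channel_zero:
  assumes "channel n m \<Phi>"
  shows "\<Phi> (0\<^sub>m n n) = 0\<^sub>m m m"
proof -
  have "\<Phi> (0 \<cdot>\<^sub>m 0\<^sub>m n n) = 0 \<cdot>\<^sub>m \<Phi> (0\<^sub>m n n)" by (rule channel_smult[OF assms]) simp
  moreover have "0 \<cdot>\<^sub>m 0\<^sub>m n n = (0\<^sub>m n n :: complex mat)" by (intro eq_matI) auto
  moreover have "0 \<cdot>\<^sub>m \<Phi> (0\<^sub>m n n) = 0\<^sub>m m m"
    using channel_carrier[OF assms, of "0\<^sub>m n n"] by (intro eq_matI) auto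
  ultimately show ?thesis by simp
qed

lemma channel_trace: "channel n m \<Phi> \<Longrightarrow> X \<in> carrier_mat n n \<Longrightarrow> mtrace (\<Phi> X) = mtrace X"
  by (simp add: channel_def trace_preserving_def)

lemma channel_expand:
  assumes ch: "channel n m \<Phi>" and X: "X \<in> carrier_mat n n" and ij: "i < m" "j < m"
  shows "\<Phi> X $$ (i, j) = (\<Sum>a<n. \<Sum>b<n. X $$ (a, b) * \<Phi> (munit n a b) $$ (i, j))"
proof -
  \<comment> \<open>\<open>M S\<close> keeps the entries of \<open>X\<close> at the positions in
    \<open>S\<close>. As \<open>linear_on\<close> speaks of two summands only, the expansion is
    built one position at a time.\<close>
  define M where "M = (\<lambda>S. mat n n (\<lambda>p. if p \<in> S then X $$ p else 0))"
  have Mc: "M S \<in> carrier_mat n n" for S by (simp add: M_def)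
  have "\<Phi> (M S) $$ (i, j) = (\<Sum>q\<in>S. X $$ q * \<Phi> (munit n (fst q) (snd q)) $$ (i, j))"
    if "finite S" for S
    using that
  proof (induction S rule: finite_induct)
    case empty
    have "M {} = 0 \<cdot>\<^sub>m M {}" by (intro eq_matI) (auto simp: M_def)
    then have "\<Phi> (M {}) = 0 \<cdot>\<^sub>m \<Phi> (M {})" using channel_smult[OF ch Mc[of "{}"], of 0] by simp
    then have "\<Phi> (M {}) $$ (i, j) = (0 \<cdot>\<^sub>m \<Phi> (M {})) $$ (i, j)" by simp
    then show ?case using channel_carrier[OF ch Mc[of "{}"]] ij by simp
  next
    case (insert q S)
    have "M (insert q S) = M S + X $$ q \<cdot>\<^sub>m munit n (fst q) (snd q)"
      using insert.hyps by (intro eq_matI) (auto simp: M_def munit_def)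
    then have "\<Phi> (M (insert q S)) = \<Phi> (M S) + X $$ q \<cdot>\<^sub>m \<Phi> (munit n (fst q) (snd q))"
      using ch Mc[of S] by (simp add: channel_add channel_smult)
    then show ?case
      using insert channel_carrier[OF ch Mc[of S]]
        channel_carrier[OF ch, of "munit n (fst q) (snd q)"] ij by simp
  qed
  from this[of "{..<n} \<times> {..<n}"]
  have "\<Phi> (M ({..<n} \<times> {..<n})) $$ (i, j)
     = (\<Sum>a<n. \<Sum>b<n. X $$ (a, b) * \<Phi> (munit n a b) $$ (i, j))"
    by (simp add: sum.cartesian_product case_prod_beta)
  moreover have "M ({..<n} \<times> {..<n}) = X"
    using X by (intro eq_matI) (auto simp: M_def)
  ultimately show ?thesis by simp
qed

section \<open>Choi matrices and Kraus operators\<close>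

lemma choi_psd:
  assumes ch: "channel n m \<Phi>"
  shows "psd_on {..<n * m} (\<lambda>p q. \<Phi> (munit n (p div m) (q div m)) $$ (p mod m, q mod m))"
proof -
  \<comment> \<open>The unnormalised maximally entangled state, the sum of E_ab \<otimes> E_ab. Its
    block (a, b) is E_ab, so amplification puts the image of E_ab there.\<close>
  define Z where "Z = mat (n * n) (n * n)
    (\<lambda>(p, q). if p div n = p mod n \<and> q div n = q mod n then 1 else (0::complex))"
  have "psd_on {..<n * n} (\<lambda>p q. Z $$ (p, q))"
    by (rule psd_on_gram[where I = "{()}" and W = "\<lambda>p _. if p div n = p mod n then 1 else 0"])
      (auto simp: Z_def)
  then have "psd (n * n) Z" by (simp add: psd_iff_psd_on Z_def)
  then have "psd (n * m) (ampl n n m \<Phi> Z)"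
    using ch unfolding channel_def completely_positive_def by blast
  then have "psd_on {..<n * m} (\<lambda>p q. ampl n n m \<Phi> Z $$ (p, q))"
    by (simp add: psd_iff_psd_on)
  moreover have "ampl n n m \<Phi> Z $$ (p, q) = \<Phi> (munit n (p div m) (q div m)) $$ (p mod m, q mod m)"
    if "p < n * m" "q < n * m" for p q
  proof -
    have "p div m < n" "q div m < n" using that by (auto simp: less_mult_imp_div_less)
    then have "mat n n (\<lambda>(a, b). Z $$ ((p div m) * n + a, (q div m) * n + b)) = munit n (p div m) (q div m)"
      by (intro eq_matI) (auto simp: Z_def munit_def block_index_less)
    then show ?thesis using that by (simp add: ampl_def)
  qed
  ultimately show ?thesis by (subst psd_on_cong[symmetric]) auto
qed

text \<open>Each column of a Gram factor of the Choi matrix, reshaped, is a Kraus operator. The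
  second relation is trace preservation read on matrix units.\<close>

lemma channel_kraus:
  assumes ch: "channel n m \<Phi>"
  obtains K :: "nat \<Rightarrow> nat \<Rightarrow> nat \<Rightarrow> complex" where
    "\<And>a b i j. a < n \<Longrightarrow> b < n \<Longrightarrow> i < m \<Longrightarrow> j < m \<Longrightarrow>
       \<Phi> (munit n a b) $$ (i, j) = (\<Sum>l<n * m. K l i a * cnj (K l j b))"
    "\<And>a b. a < n \<Longrightarrow> b < n \<Longrightarrow>
       (\<Sum>l<n * m. \<Sum>i<m. K l i a * cnj (K l i b)) = (if a = b then 1 else 0)"
proof -
  obtain W where W: "\<And>p q. p < n * m \<Longrightarrow> q < n * m \<Longrightarrow>
      \<Phi> (munit n (p div m) (q div m)) $$ (p mod m, q mod m) = (\<Sum>l<n * m. W p l * cnj (W q l))"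
    using psd_on_gram_exists[OF _ choi_psd[OF ch]] by auto
  define K where "K = (\<lambda>l i a. W (a * m + i) l)"
  have 1: "\<Phi> (munit n a b) $$ (i, j) = (\<Sum>l<n * m. K l i a * cnj (K l j b))"
    if "a < n" "b < n" "i < m" "j < m" for a b i j
    using W[of "a * m + i" "b * m + j"] that by (simp add: K_def block_index_less)
  have 2: "(\<Sum>l<n * m. \<Sum>i<m. K l i a * cnj (K l i b)) = (if a = b then 1 else 0)"
    if "a < n" "b < n" for a b
  proof -
    have "(\<Sum>l<n * m. \<Sum>i<m. K l i a * cnj (K l i b)) = (\<Sum>i<m. \<Phi> (munit n a b) $$ (i, i))"
      by (subst sum.swap) (simp add: 1 that)
    also have "\<dots> = mtrace (\<Phi> (munit n a b))"
      using channel_carrier[OF ch, of "munit n a b"] by (simp add: mtrace_def)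
    also have "\<dots> = (if a = b then 1 else 0)"
      using channel_trace[OF ch, of "munit n a b"] that by (simp add: mtrace_munit)
    finally show ?thesis .
  qed
  from that[OF 1 2] show ?thesis by blast
qed

text \<open>Trace preservation bounds the squared norm of \<open>K l i a\<close> over
  \<open>l\<close> by 1, and Cauchy-Schwarz does the rest. The bound is free of \<open>n\<close> and
  \<open>m\<close>; it yields both the compactness of the set of powers and errors that ignore the
  code size.\<close>

lemma channel_unit_bound:
  assumes ch: "channel n m \<Phi>" and "a < n" "b < n" "i < m" "j < m"
  shows "cmod (\<Phi> (munit n a b) $$ (i, j)) \<le> 1"
proof -
  obtain K :: "nat \<Rightarrow> nat \<Rightarrow> nat \<Rightarrow> complex" where
    K: "\<And>a b i j. a < n \<Longrightarrow> b < n \<Longrightarrow> i < m \<Longrightarrow> j < m \<Longrightarrow>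
       \<Phi> (munit n a b) $$ (i, j) = (\<Sum>l<n * m. K l i a * cnj (K l j b))"
    and tp: "\<And>a b. a < n \<Longrightarrow> b < n \<Longrightarrow>
       (\<Sum>l<n * m. \<Sum>i<m. K l i a * cnj (K l i b)) = (if a = b then 1 else 0)"
    using channel_kraus[OF ch] by blast
  have s1: "(\<Sum>l<n * m. (cmod (K l i a))\<^sup>2) \<le> 1" if "i < m" "a < n" for i a
  proof -
    have "(\<Sum>l<n * m. (cmod (K l i a))\<^sup>2) \<le> (\<Sum>l<n * m. \<Sum>i<m. (cmod (K l i a))\<^sup>2)"
      using that by (intro sum_mono member_le_sum[of i "{..<m}" "\<lambda>i. (cmod (K _ i a))\<^sup>2"]) auto
    also have "\<dots> = Re (\<Sum>l<n * m. \<Sum>i<m. K l i a * cnj (K l i a))"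
      by (simp add: cmod_power2 flip: power2_eq_square)
    also have "\<dots> = 1" using tp[OF that(2,2)] by simp
    finally show ?thesis .
  qed
  have "(cmod (\<Phi> (munit n a b) $$ (i, j)))\<^sup>2
     \<le> (\<Sum>l<n * m. (cmod (K l i a))\<^sup>2) * (\<Sum>l<n * m. (cmod (cnj (K l j b)))\<^sup>2)"
    unfolding K[OF assms(2-5)] by (rule norm_sum_mult_square_le)
  also have "\<dots> \<le> 1 * 1"
    using s1[of i a] s1[of j b] assms by (intro mult_mono) (auto intro: sum_nonneg)
  finally show ?thesis by (simp add: power_le_one_iff)
qed

text \<open>The converse of \<open>channel_kraus\<close>, by which encoders and decoders are
  recognised as channels. Any finite index set is allowed, so that block data can label Kraus
  operators.\<close>

lemma kraus_channel:
  assumes "finite I"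
    and \<Phi>: "\<And>X. X \<in> carrier_mat n n \<Longrightarrow>
      \<Phi> X = mat m m (\<lambda>(i, j). \<Sum>l\<in>I. \<Sum>a<n. \<Sum>b<n. K l i a * X $$ (a, b) * cnj (K l j b))"
    and tp: "\<And>a b. a < n \<Longrightarrow> b < n \<Longrightarrow>
       (\<Sum>l\<in>I. \<Sum>i<m. K l i a * cnj (K l i b)) = (if a = b then 1 else 0)"
  shows "channel n m \<Phi>"
  unfolding channel_def
proof (intro conjI ballI)
  fix X :: "complex mat" assume "X \<in> carrier_mat n n"
  then show "\<Phi> X \<in> carrier_mat m m" by (simp add: \<Phi>)
next
  show "linear_on n \<Phi>"
    unfolding linear_on_def
  proof (intro ballI allI conjI)
    fix A B :: "complex mat" and c
    assume AB: "A \<in> carrier_mat n n" "B \<in> carrier_mat n n"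
    show "\<Phi> (A + B) = \<Phi> A + \<Phi> B"
      using AB by (intro eq_matI) (auto simp: \<Phi> algebra_simps sum.distrib)
    show "\<Phi> (c \<cdot>\<^sub>m A) = c \<cdot>\<^sub>m \<Phi> A"
      using AB by (intro eq_matI) (auto simp: \<Phi> algebra_simps sum_distrib_left)
  qed
next
  show "completely_positive n m \<Phi>"
    unfolding completely_positive_def
  proof (intro allI impI)
    fix k X assume psd: "psd (k * n) X"
    then obtain W where W: "\<And>p q. p < k * n \<Longrightarrow> q < k * n \<Longrightarrow>
        X $$ (p, q) = (\<Sum>s<k * n. W p s * cnj (W q s))"
      using psd_on_gram_exists[of "{..<k * n}" "\<lambda>p q. X $$ (p, q)"] unfolding psd_iff_psd_on by auto
    \<comment> \<open>Kraus operator \<open>fst ls\<close> applied to the second tensor factor of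
      the Gram vector \<open>snd ls\<close> of \<open>X\<close>.\<close>
    define V where "V = (\<lambda>i ls. \<Sum>a<n. K (fst ls) (i mod m) a * W ((i div m) * n + a) (snd ls))"
    have "psd_on {..<k * m} (\<lambda>i j. ampl k n m \<Phi> X $$ (i, j))"
    proof (rule psd_on_gram[where I = "I \<times> {..<k * n}" and W = V])
      fix i j assume ij: "i \<in> {..<k * m}" "j \<in> {..<k * m}"
      then have dv: "i div m < k" "j div m < k" "i mod m < m" "j mod m < m"
        by (auto simp: less_mult_imp_div_less intro!: mod_less_divisor gr0I)
      have "ampl k n m \<Phi> X $$ (i, j) = (\<Sum>l\<in>I. \<Sum>a<n. \<Sum>b<n. K l (i mod m) a *
          X $$ ((i div m) * n + a, (j div m) * n + b) * cnj (K l (j mod m) b))"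
        using ij dv by (simp add: ampl_def \<Phi>)
      also have "\<dots> = (\<Sum>l\<in>I. \<Sum>a<n. \<Sum>b<n. \<Sum>s<k * n. (K l (i mod m) a * W ((i div m) * n + a) s) *
          cnj (K l (j mod m) b * W ((j div m) * n + b) s))"
      proof (intro sum.cong refl)
        fix l a b assume "a \<in> {..<n}" "b \<in> {..<n}"
        then have X: "X $$ ((i div m) * n + a, (j div m) * n + b)
            = (\<Sum>s<k * n. W ((i div m) * n + a) s * cnj (W ((j div m) * n + b) s))"
          using dv by (intro W block_index_less) auto
        show "K l (i mod m) a * X $$ ((i div m) * n + a, (j div m) * n + b) * cnj (K l (j mod m) b)
          = (\<Sum>s<k * n. (K l (i mod m) a * W ((i div m) * n + a) s) *
              cnj (K l (j mod m) b * W ((j div m) * n + b) s))"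
          unfolding X by (simp add: sum_distrib_left sum_distrib_right algebra_simps)
      qed
      also have "\<dots> = (\<Sum>l\<in>I. \<Sum>s<k * n. V i (l, s) * cnj (V j (l, s)))"
      proof (rule sum.cong[OF refl])
        fix l
        have "(\<Sum>a<n. \<Sum>b<n. \<Sum>s<k * n. (K l (i mod m) a * W ((i div m) * n + a) s) *
            cnj (K l (j mod m) b * W ((j div m) * n + b) s))
          = (\<Sum>s<k * n. \<Sum>a<n. \<Sum>b<n. (K l (i mod m) a * W ((i div m) * n + a) s) *
            cnj (K l (j mod m) b * W ((j div m) * n + b) s))" by (rule sum_rotate3)
        then show "(\<Sum>a<n. \<Sum>b<n. \<Sum>s<k * n. (K l (i mod m) a * W ((i div m) * n + a) s) *
            cnj (K l (j mod m) b * W ((j div m) * n + b) s)) = (\<Sum>s<k * n. V i (l, s) * cnj (V j (l, s)))"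
          by (simp add: V_def sum_product)
      qed
      finally show "ampl k n m \<Phi> X $$ (i, j) = (\<Sum>l\<in>I \<times> {..<k * n}. V i l * cnj (V j l))"
        by (simp add: sum.cartesian_product case_prod_beta)
    qed
    then show "psd (k * m) (ampl k n m \<Phi> X)" by (simp add: psd_iff_psd_on ampl_def)
  qed
next
  show "trace_preserving n \<Phi>"
    unfolding trace_preserving_def
  proof
    fix X :: "complex mat" assume X: "X \<in> carrier_mat n n"
    have "mtrace (\<Phi> X) = (\<Sum>i<m. \<Sum>l\<in>I. \<Sum>a<n. \<Sum>b<n. K l i a * X $$ (a, b) * cnj (K l i b))"
      using X by (simp add: \<Phi> mtrace_def)
    also have "\<dots> = (\<Sum>a<n. \<Sum>i<m. \<Sum>l\<in>I. \<Sum>b<n. K l i a * X $$ (a, b) * cnj (K l i b))"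
      by (rule sum_rotate3)
    also have "\<dots> = (\<Sum>a<n. \<Sum>b<n. \<Sum>i<m. \<Sum>l\<in>I. K l i a * X $$ (a, b) * cnj (K l i b))"
      by (intro sum.cong refl sum_rotate3)
    also have "\<dots> = (\<Sum>a<n. \<Sum>b<n. \<Sum>l\<in>I. \<Sum>i<m. K l i a * X $$ (a, b) * cnj (K l i b))"
      by (intro sum.cong refl sum.swap)
    also have "\<dots> = (\<Sum>a<n. \<Sum>b<n. X $$ (a, b) * (\<Sum>l\<in>I. \<Sum>i<m. K l i a * cnj (K l i b)))"
      by (simp add: sum_distrib_left algebra_simps)
    also have "\<dots> = (\<Sum>a<n. \<Sum>b<n. if a = b then X $$ (a, b) else 0)"
      by (intro sum.cong refl) (simp add: tp)
    also have "\<dots> = mtrace X" using X by (simp add: mtrace_def)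
    finally show "mtrace (\<Phi> X) = mtrace X" .
  qed
qed

section \<open>Positivity, composition, powers and limits of channels\<close>

lemma channel_psd:
  assumes ch: "channel n m \<Phi>" and X: "psd n X"
  shows "psd m (\<Phi> X)"
proof -
  have Xc: "X \<in> carrier_mat n n" using X by (simp add: psd_def)
  have "psd (1 * m) (ampl 1 n m \<Phi> X)"
    using ch X unfolding channel_def completely_positive_def by (metis mult_1)
  moreover have "ampl 1 n m \<Phi> X = \<Phi> X"
  proof (rule eq_matI)
    have "mat n n (\<lambda>(a, b). X $$ (a, b)) = X" using Xc by (intro eq_matI) auto
    then show "ampl 1 n m \<Phi> X $$ (i, j) = \<Phi> X $$ (i, j)"
      if "i < dim_row (\<Phi> X)" "j < dim_col (\<Phi> X)" for i j
      using that channel_carrier[OF ch Xc] by (simp add: ampl_def)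
  qed (use channel_carrier[OF ch Xc] in \<open>auto simp: ampl_def\<close>)
  ultimately show ?thesis by simp
qed

lemma channel_comp:
  assumes "channel n m \<Phi>" "channel m p \<Psi>"
  shows "channel n p (\<Psi> \<circ> \<Phi>)"
  unfolding channel_def
proof (intro conjI ballI)
  show "(\<Psi> \<circ> \<Phi>) X \<in> carrier_mat p p" if "X \<in> carrier_mat n n" for X
    using that assms by (simp add: channel_def)
  show "linear_on n (\<Psi> \<circ> \<Phi>)"
    unfolding linear_on_def
    by (simp add: channel_add[OF assms(1)] channel_add[OF assms(2)] channel_smult[OF assms(1)]
        channel_smult[OF assms(2)] channel_carrier[OF assms(1)])
  show "trace_preserving n (\<Psi> \<circ> \<Phi>)"
    using assms unfolding channel_def trace_preserving_def by simp
  show "completely_positive n p (\<Psi> \<circ> \<Phi>)"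
    unfolding completely_positive_def
  proof (intro allI impI)
    fix k X assume "psd (k * n) X"
    then have "psd (k * p) (ampl k m p \<Psi> (ampl k n m \<Phi> X))"
      using assms unfolding channel_def completely_positive_def by blast
    moreover have "ampl k m p \<Psi> (ampl k n m \<Phi> X) = ampl k n p (\<Psi> \<circ> \<Phi>) X"
    proof (rule eq_matI)
      fix i j assume "i < dim_row (ampl k n p (\<Psi> \<circ> \<Phi>) X)" "j < dim_col (ampl k n p (\<Psi> \<circ> \<Phi>) X)"
      then have ij: "i < k * p" "j < k * p" by (auto simp: ampl_def)
      then have dv: "i div p < k" "j div p < k" by (auto simp: less_mult_imp_div_less)
      let ?B = "mat n n (\<lambda>(a, b). X $$ ((i div p) * n + a, (j div p) * n + b))"
      have "\<Phi> ?B \<in> carrier_mat m m" by (rule channel_carrier[OF assms(1)]) simp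
      then have "mat m m (\<lambda>(a, b). ampl k n m \<Phi> X $$ ((i div p) * m + a, (j div p) * m + b)) = \<Phi> ?B"
        using dv by (intro eq_matI) (auto simp: ampl_def block_index_less)
      then show "ampl k m p \<Psi> (ampl k n m \<Phi> X) $$ (i, j) = ampl k n p (\<Psi> \<circ> \<Phi>) X $$ (i, j)"
        using ij by (simp add: ampl_def[of k m p] ampl_def[of k n p])
    qed (auto simp: ampl_def)
    ultimately show "psd (k * p) (ampl k n p (\<Psi> \<circ> \<Phi>) X)" by simp
  qed
qed

lemma channel_id: "channel n n id"
proof -
  have "ampl k n n id X = X" if "X \<in> carrier_mat (k * n) (k * n)" for k X
  proof (rule eq_matI)
    fix i j assume "i < dim_row X" "j < dim_col X"
    then have ij: "i < k * n" "j < k * n" using that by auto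
    then have "i mod n < n" "j mod n < n" by (auto intro!: mod_less_divisor gr0I)
    then show "ampl k n n id X $$ (i, j) = X $$ (i, j)" using ij by (simp add: ampl_def)
  qed (use that in \<open>auto simp: ampl_def\<close>)
  then show ?thesis
    unfolding channel_def completely_positive_def linear_on_def trace_preserving_def
    by (auto simp: psd_def)
qed

lemma channel_funpow: "channel n n T \<Longrightarrow> channel n n (T ^^ t)"
  by (induction t) (auto simp: channel_id intro: channel_comp)

lemma channel_lim:
  assumes ch: "\<And>k :: nat. channel n m (F k)"
    and car: "\<And>X. X \<in> carrier_mat n n \<Longrightarrow> \<Phi> X \<in> carrier_mat m m"
    and lim: "\<And>X i j. X \<in> carrier_mat n n \<Longrightarrow> i < m \<Longrightarrow> j < m \<Longrightarrow> (\<lambda>k. F k X $$ (i, j)) \<longlonglongrightarrow> \<Phi> X $$ (i, j)"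
  shows "channel n m \<Phi>"
  unfolding channel_def
proof (intro conjI ballI)
  show "\<Phi> X \<in> carrier_mat m m" if "X \<in> carrier_mat n n" for X using car that .
  show "linear_on n \<Phi>"
    unfolding linear_on_def
  proof (intro ballI allI conjI)
    fix A B :: "complex mat" and c
    assume AB: "A \<in> carrier_mat n n" "B \<in> carrier_mat n n"
    show "\<Phi> (A + B) = \<Phi> A + \<Phi> B"
    proof (rule eq_matI)
      fix i j assume "i < dim_row (\<Phi> A + \<Phi> B)" "j < dim_col (\<Phi> A + \<Phi> B)"
      then have ij: "i < m" "j < m" using car AB by auto
      have "F k (A + B) $$ (i, j) = F k A $$ (i, j) + F k B $$ (i, j)" for k
        using channel_carrier[OF ch[of k] AB(1)] channel_carrier[OF ch[of k] AB(2)] ij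
        by (simp add: channel_add[OF ch AB])
      then have "(\<lambda>k. F k (A + B) $$ (i, j)) \<longlonglongrightarrow> \<Phi> A $$ (i, j) + \<Phi> B $$ (i, j)"
        using tendsto_add[OF lim[OF AB(1) ij] lim[OF AB(2) ij]] by simp
      then have "\<Phi> (A + B) $$ (i, j) = \<Phi> A $$ (i, j) + \<Phi> B $$ (i, j)"
        using lim[of "A + B" i j] AB ij LIMSEQ_unique by fastforce
      then show "\<Phi> (A + B) $$ (i, j) = (\<Phi> A + \<Phi> B) $$ (i, j)" using ij car[OF AB(1)] car[OF AB(2)] by simp
    qed (use car[of "A + B"] car[of A] car[of B] AB in auto)
    show "\<Phi> (c \<cdot>\<^sub>m A) = c \<cdot>\<^sub>m \<Phi> A"
    proof (rule eq_matI)
      fix i j assume "i < dim_row (c \<cdot>\<^sub>m \<Phi> A)" "j < dim_col (c \<cdot>\<^sub>m \<Phi> A)"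
      then have ij: "i < m" "j < m" using car AB by auto
      have "F k (c \<cdot>\<^sub>m A) $$ (i, j) = c * F k A $$ (i, j)" for k
        using channel_carrier[OF ch[of k] AB(1)] ij by (simp add: channel_smult[OF ch AB(1)])
      then have "(\<lambda>k. F k (c \<cdot>\<^sub>m A) $$ (i, j)) \<longlonglongrightarrow> c * \<Phi> A $$ (i, j)"
        using tendsto_mult_left[OF lim[OF AB(1) ij], of c] by simp
      then have "\<Phi> (c \<cdot>\<^sub>m A) $$ (i, j) = c * \<Phi> A $$ (i, j)"
        using lim[of "c \<cdot>\<^sub>m A" i j] AB ij LIMSEQ_unique by fastforce
      then show "\<Phi> (c \<cdot>\<^sub>m A) $$ (i, j) = (c \<cdot>\<^sub>m \<Phi> A) $$ (i, j)" using ij car[OF AB(1)] by simp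
    qed (use car[of "c \<cdot>\<^sub>m A"] car[of A] AB in auto)
  qed
  show "completely_positive n m \<Phi>"
    unfolding completely_positive_def
  proof (intro allI impI)
    fix k X assume X: "psd (k * n) X"
    have "psd_on {..<k * m} (\<lambda>i j. ampl k n m \<Phi> X $$ (i, j))"
    proof (rule psd_on_lim)
      show "psd_on {..<k * m} (\<lambda>i j. ampl k n m (F l) X $$ (i, j))" for l
        using ch[of l] X unfolding channel_def completely_positive_def psd_iff_psd_on by blast
      fix i j assume ij: "i \<in> {..<k * m}" "j \<in> {..<k * m}"
      then have "i mod m < m" "j mod m < m" by (auto intro!: mod_less_divisor gr0I)
      then show "(\<lambda>l. ampl k n m (F l) X $$ (i, j)) \<longlonglongrightarrow> ampl k n m \<Phi> X $$ (i, j)"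
        using ij by (simp add: ampl_def lim)
    qed
    then show "psd (k * m) (ampl k n m \<Phi> X)" by (simp add: psd_iff_psd_on ampl_def)
  qed
  show "trace_preserving n \<Phi>"
    unfolding trace_preserving_def
  proof
    fix X :: "complex mat" assume X: "X \<in> carrier_mat n n"
    have tr: "mtrace (F k X) = (\<Sum>i<m. F k X $$ (i, i))" for k
      using channel_carrier[OF ch[of k] X] by (simp add: mtrace_def)
    have "(\<lambda>k. \<Sum>i<m. F k X $$ (i, i)) \<longlonglongrightarrow> (\<Sum>i<m. \<Phi> X $$ (i, i))"
      by (intro tendsto_sum lim X) auto
    moreover have "(\<Sum>i<m. F k X $$ (i, i)) = mtrace X" for k
      using tr[of k] channel_trace[OF ch[of k] X] by simp
    ultimately have "(\<Sum>i<m. \<Phi> X $$ (i, i)) = mtrace X"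
      by (simp add: LIMSEQ_const_iff)
    then show "mtrace (\<Phi> X) = mtrace X" using car[OF X] by (simp add: mtrace_def)
  qed
qed

section \<open>Recurrence and the peripheral space\<close>

lemma finite_common_subseq:
  fixes f :: "'a \<Rightarrow> nat \<Rightarrow> complex"
  assumes "finite I" "\<And>q k. q \<in> I \<Longrightarrow> cmod (f q k) \<le> B"
  shows "\<exists>s. strict_mono s \<and> (\<forall>q\<in>I. convergent (\<lambda>k. f q (s k)))"
  using assms
proof (induction I rule: finite_induct)
  case empty
  show ?case by (rule exI[of _ id]) (simp add: strict_mono_def)
next
  case (insert q I)
  then obtain s where s: "strict_mono s" "\<forall>q\<in>I. convergent (\<lambda>k. f q (s k))" by blast
  have "bounded (range (\<lambda>k. f q (s k)))"
    using insert.prems[of q] by (auto simp: bounded_iff)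
  then obtain l r where r: "strict_mono r" "((\<lambda>k. f q (s k)) \<circ> r) \<longlonglongrightarrow> l"
    using bounded_imp_convergent_subsequence by blast
  have "convergent (\<lambda>k. f q' ((s \<circ> r) k))" if "q' \<in> insert q I" for q'
  proof (cases "q' = q")
    case True
    then show ?thesis using r(2) by (auto simp: o_def convergent_def)
  next
    case False
    then have "convergent (\<lambda>k. f q' (s k))" using that s by blast
    from convergent_subseq_convergent[OF this r(1)] show ?thesis by (simp add: o_def)
  qed
  then show ?case using strict_mono_o[OF s(1) r(1)] by blast
qed

text \<open>\<open>f\<close> is any sequence of exponents, not necessarily increasing: it also
  stands for gaps of a subsequence and for truncated differences \<open>f k - t\<close>. That the
  limit is a channel is built in, because its expansion in matrix units is used throughout.\<close>

definition pow_lim :: "nat \<Rightarrow> (complex mat \<Rightarrow> complex mat) \<Rightarrow> (nat \<Rightarrow> nat) \<Rightarrow> (complex mat \<Rightarrow> complex mat) \<Rightarrow> bool" where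
  "pow_lim d T f L \<longleftrightarrow> channel d d L \<and>
     (\<forall>X\<in>carrier_mat d d. \<forall>i<d. \<forall>j<d. (\<lambda>k. (T ^^ f k) X $$ (i, j)) \<longlonglongrightarrow> L X $$ (i, j))"

lemma pow_limD:
  assumes "pow_lim d T f L"
  shows "channel d d L"
    "X \<in> carrier_mat d d \<Longrightarrow> i < d \<Longrightarrow> j < d \<Longrightarrow> (\<lambda>k. (T ^^ f k) X $$ (i, j)) \<longlonglongrightarrow> L X $$ (i, j)"
  using assms by (auto simp: pow_lim_def)

lemma pow_lim_subseq:
  assumes "pow_lim d T f L" "strict_mono s"
  shows "pow_lim d T (\<lambda>k. f (s k)) L"
  unfolding pow_lim_def
proof (intro conjI ballI allI impI)
  fix X :: "complex mat" and i j assume "X \<in> carrier_mat d d" "i < d" "j < d"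
  from LIMSEQ_subseq_LIMSEQ[OF pow_limD(2)[OF assms(1) this] assms(2)]
  show "(\<lambda>k. (T ^^ f (s k)) X $$ (i, j)) \<longlonglongrightarrow> L X $$ (i, j)" by (simp add: o_def)
qed (rule pow_limD(1)[OF assms(1)])

context
  fixes d :: nat and T :: "complex mat \<Rightarrow> complex mat"
  assumes ch: "channel d d T"
begin

text \<open>The d^4 entries on matrix units are bounded by 1, so one subsequence makes all of them
  converge; linearity extends this to every matrix.\<close>

lemma pow_lim_exists:
  fixes f :: "nat \<Rightarrow> nat"
  shows "\<exists>s L. strict_mono s \<and> pow_lim d T (\<lambda>k. f (s k)) L"
proof -
  let ?I = "{..<d} \<times> {..<d} \<times> {..<d} \<times> {..<d}"
  define g where "g = (\<lambda>(a, b, i, j) k. (T ^^ f k) (munit d a b) $$ (i, j))"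
  have "cmod (g q k) \<le> 1" if "q \<in> ?I" for q k
    using that channel_unit_bound[OF channel_funpow[OF ch, of "f k"]] by (auto simp: g_def)
  then obtain s where s: "strict_mono s" "\<forall>q\<in>?I. convergent (\<lambda>k. g q (s k))"
    using finite_common_subseq[of ?I g 1] by blast
  have conv: "convergent (\<lambda>k. (T ^^ f (s k)) (munit d a b) $$ (i, j))"
    if "a < d" "b < d" "i < d" "j < d" for a b i j
    using bspec[OF s(2), of "(a, b, i, j)"] that by (simp add: g_def)
  have conv': "convergent (\<lambda>k. (T ^^ f (s k)) X $$ (i, j))"
    if "X \<in> carrier_mat d d" "i < d" "j < d" for X i j
    unfolding channel_expand[OF channel_funpow[OF ch] that]
    using that(2,3) by (intro convergent_sum convergent_mult convergent_const conv) auto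
  define L where "L = (\<lambda>X. mat d d (\<lambda>(i, j). lim (\<lambda>k. (T ^^ f (s k)) X $$ (i, j))))"
  have lim: "(\<lambda>k. (T ^^ f (s k)) X $$ (i, j)) \<longlonglongrightarrow> L X $$ (i, j)"
    if "X \<in> carrier_mat d d" "i < d" "j < d" for X i j
    using conv'[OF that] that by (simp add: L_def convergent_LIMSEQ_iff)
  have "channel d d L"
    by (rule channel_lim[OF channel_funpow[OF ch] _ lim]) (auto simp: L_def)
  then have "pow_lim d T (\<lambda>k. f (s k)) L" using lim by (simp add: pow_lim_def)
  then show ?thesis using s(1) by blast
qed

text \<open>Expanding in matrix units turns the composition into a fixed finite sum of products of
  convergent scalars.\<close>

lemma pow_lim_compose:
  assumes f: "pow_lim d T f L" and g: "pow_lim d T g P"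
    and X: "X \<in> carrier_mat d d" and ij: "i < d" "j < d"
  shows "(\<lambda>k. (T ^^ (f k + g k)) X $$ (i, j)) \<longlonglongrightarrow> L (P X) $$ (i, j)"
proof -
  have c: "(T ^^ g k) X \<in> carrier_mat d d" for k by (rule channel_carrier[OF channel_funpow[OF ch] X])
  have c2: "P X \<in> carrier_mat d d" by (rule channel_carrier[OF pow_limD(1)[OF g] X])
  have "(T ^^ (f k + g k)) X $$ (i, j)
     = (\<Sum>a<d. \<Sum>b<d. (T ^^ g k) X $$ (a, b) * (T ^^ f k) (munit d a b) $$ (i, j))" for k
    using channel_expand[OF channel_funpow[OF ch] c[of k] ij, of "f k"] by (simp add: funpow_add)
  then show ?thesis
    unfolding channel_expand[OF pow_limD(1)[OF f] c2 ij]
    using ij by (simp, intro tendsto_sum tendsto_mult pow_limD(2)[OF f] pow_limD(2)[OF g] X) auto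
qed

lemma funpow_entry_bound:
  assumes X: "X \<in> carrier_mat d d" and ij: "i < d" "j < d"
  shows "cmod ((T ^^ n) X $$ (i, j)) \<le> (\<Sum>a<d. \<Sum>b<d. cmod (X $$ (a, b)))"
  unfolding channel_expand[OF channel_funpow[OF ch] X ij]
proof (intro sum_norm_le)
  fix a b assume "a \<in> {..<d}" "b \<in> {..<d}"
  then have "cmod ((T ^^ n) (munit d a b) $$ (i, j)) \<le> 1"
    using channel_unit_bound[OF channel_funpow[OF ch]] ij by simp
  then show "cmod (X $$ (a, b) * (T ^^ n) (munit d a b) $$ (i, j)) \<le> cmod (X $$ (a, b))"
    by (simp add: norm_mult mult_left_le)
qed

lemma funpow_eigen:
  assumes "A \<in> carrier_mat d d" "T A = z \<cdot>\<^sub>m A"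
  shows "(T ^^ n) A = z ^ n \<cdot>\<^sub>m A"
proof (induction n)
  case 0
  show ?case using assms by (intro eq_matI) auto
next
  case (Suc n)
  have "(T ^^ Suc n) A = T (z ^ n \<cdot>\<^sub>m A)" using Suc by simp
  also have "\<dots> = z ^ n \<cdot>\<^sub>m (z \<cdot>\<^sub>m A)" using channel_smult[OF ch assms(1)] assms(2) by simp
  also have "\<dots> = z ^ Suc n \<cdot>\<^sub>m A" by (intro eq_matI) auto
  finally show ?case .
qed

section \<open>The span of the peripheral eigenvectors\<close>

abbreviation (input) per where "per \<equiv> peripheral_space d T"

lemma peripheral_carrier: "X \<in> per \<Longrightarrow> X \<in> carrier_mat d d"
  by (simp add: peripheral_space_def)

lemma peripheral_spaceI:
  fixes n :: nat
  assumes "X \<in> carrier_mat d d"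
    "\<forall>l<n. F l \<in> carrier_mat d d \<and> (\<exists>z. cmod z = 1 \<and> T (F l) = z \<cdot>\<^sub>m F l)"
    "\<forall>i<d. \<forall>j<d. X $$ (i, j) = (\<Sum>l<n. c l * F l $$ (i, j))"
  shows "X \<in> per"
  unfolding peripheral_space_def mem_Collect_eq by (intro conjI exI) (fact assms)+

lemma peripheral_spaceE:
  assumes "X \<in> per"
  obtains n :: nat and c :: "nat \<Rightarrow> complex" and F where "\<forall>l<n. F l \<in> carrier_mat d d \<and> (\<exists>z. cmod z = 1 \<and> T (F l) = z \<cdot>\<^sub>m F l)"
    "\<forall>i<d. \<forall>j<d. X $$ (i, j) = (\<Sum>l<n. c l * F l $$ (i, j))"
  using conjunct2[OF assms[unfolded peripheral_space_def mem_Collect_eq]]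
  by (elim exE conjE) (rule that)

lemma peripheral_zero: "0\<^sub>m d d \<in> per"
  unfolding peripheral_space_def by (auto intro!: exI[of _ 0])

lemma peripheral_add_eigen:
  assumes "X \<in> per" "A \<in> carrier_mat d d" "cmod z = 1" "T A = z \<cdot>\<^sub>m A"
  shows "X + A \<in> per"
proof -
  have X: "X \<in> carrier_mat d d" by (rule peripheral_carrier[OF assms(1)])
  obtain n :: nat and c F where F: "\<forall>l<n. F l \<in> carrier_mat d d \<and> (\<exists>z. cmod z = 1 \<and> T (F l) = z \<cdot>\<^sub>m F l)"
    and e: "\<forall>i<d. \<forall>j<d. X $$ (i, j) = (\<Sum>l<n. c l * F l $$ (i, j))"
    by (rule peripheral_spaceE[OF assms(1)])
  define c' where "c' = c(n := 1)"
  define F' where "F' = F(n := A)"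
  have "\<forall>l<Suc n. F' l \<in> carrier_mat d d \<and> (\<exists>z. cmod z = 1 \<and> T (F' l) = z \<cdot>\<^sub>m F' l)"
    using F assms(2-4) by (auto simp: F'_def less_Suc_eq)
  moreover have "\<forall>i<d. \<forall>j<d. (X + A) $$ (i, j) = (\<Sum>l<Suc n. c' l * F' l $$ (i, j))"
    using X assms(2) e by (simp add: c'_def F'_def)
  ultimately show ?thesis using X assms(2) by (intro peripheral_spaceI[of _ "Suc n" F' c']) auto
qed

text \<open>The span is consumed one eigenvector at a time. Coefficients are absorbed into the
  eigenvectors, whose eigenvalues they do not change.\<close>

lemma peripheral_induct [consumes 1, case_names zero add]:
  assumes X: "X \<in> per"
    and zero: "Q (0\<^sub>m d d)"
    and add: "\<And>X A z. X \<in> per \<Longrightarrow> Q X \<Longrightarrow> A \<in> carrier_mat d d \<Longrightarrow> cmod z = 1 \<Longrightarrow> T A = z \<cdot>\<^sub>m A \<Longrightarrow> Q (X + A)"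
  shows "Q X"
proof -
  have Xc: "X \<in> carrier_mat d d" by (rule peripheral_carrier[OF X])
  obtain n :: nat and c F where F: "\<forall>l<n. F l \<in> carrier_mat d d \<and> (\<exists>z. cmod z = 1 \<and> T (F l) = z \<cdot>\<^sub>m F l)"
    and e: "\<forall>i<d. \<forall>j<d. X $$ (i, j) = (\<Sum>l<n. c l * F l $$ (i, j))"
    by (rule peripheral_spaceE[OF X])
  define Y where "Y = (\<lambda>n. mat d d (\<lambda>p. \<Sum>l<n. c l * F l $$ p))"
  have "Y m \<in> per \<and> Q (Y m)" if "m \<le> n" for m
    using that
  proof (induction m)
    case 0
    have "Y 0 = 0\<^sub>m d d" by (intro eq_matI) (auto simp: Y_def)
    then show ?case using zero peripheral_zero by simp
  next
    case (Suc m)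
    obtain z where z: "F m \<in> carrier_mat d d" "cmod z = 1" "T (F m) = z \<cdot>\<^sub>m F m"
      using F[rule_format, of m] Suc.prems by auto
    have YS: "Y (Suc m) = Y m + c m \<cdot>\<^sub>m F m"
      using z(1) by (intro eq_matI) (auto simp: Y_def)
    have ev: "T (c m \<cdot>\<^sub>m F m) = z \<cdot>\<^sub>m (c m \<cdot>\<^sub>m F m)"
      unfolding channel_smult[OF ch z(1)] z(3) by (intro eq_matI) auto
    show ?case
      unfolding YS using Suc z ev add[OF _ _ _ z(2) ev] peripheral_add_eigen[OF _ _ z(2) ev] by simp
  qed
  moreover have "Y n = X" using Xc e by (intro eq_matI) (auto simp: Y_def)
  ultimately show ?thesis by auto
qed

lemma peripheral_add:
  assumes "X \<in> per" "Y \<in> per"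
  shows "X + Y \<in> per"
  using assms(2)
proof (induction Y rule: peripheral_induct)
  case zero
  then show ?case using assms(1) peripheral_carrier by simp
next
  case (add Y A z)
  have "X + (Y + A) = (X + Y) + A"
    using assoc_add_mat[of X d d Y A] peripheral_carrier[OF assms(1)] peripheral_carrier[OF add(1)] add(2)
    by simp
  then show ?case using peripheral_add_eigen[OF add(5) add(2-4)] by simp
qed

lemma peripheral_eigen:
  assumes "A \<in> carrier_mat d d" "cmod z = 1" "T A = z \<cdot>\<^sub>m A"
  shows "A \<in> per"
  using peripheral_add_eigen[OF peripheral_zero assms] assms(1) by simp

lemma peripheral_smult:
  assumes "X \<in> per"
  shows "c \<cdot>\<^sub>m X \<in> per"
  using assms
proof (induction X rule: peripheral_induct)
  case zero
  have "c \<cdot>\<^sub>m 0\<^sub>m d d = 0\<^sub>m d d" by (intro eq_matI) auto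
  then show ?case using peripheral_zero by simp
next
  case (add X A z)
  have "c \<cdot>\<^sub>m (X + A) = c \<cdot>\<^sub>m X + c \<cdot>\<^sub>m A"
    using add_smult_distrib_left_mat[of X d d A c] peripheral_carrier[OF add(1)] add(2) by simp
  moreover have "T (c \<cdot>\<^sub>m A) = z \<cdot>\<^sub>m (c \<cdot>\<^sub>m A)"
    unfolding channel_smult[OF ch add(2)] add(4) by (intro eq_matI) auto
  ultimately show ?case using peripheral_add_eigen[OF add(5) _ add(3)] add(2) by simp
qed

text \<open>At a nonzero entry of \<open>A\<close> the phases z^(f k) must converge, and their limit
  has modulus 1. For A = 0 any unimodular number serves.\<close>

lemma pow_lim_eigen:
  assumes lim: "pow_lim d T f L" and A: "A \<in> carrier_mat d d" and z: "cmod z = 1" "T A = z \<cdot>\<^sub>m A"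
  shows "\<exists>w. cmod w = 1 \<and> L A = w \<cdot>\<^sub>m A"
proof -
  have Lc: "L A \<in> carrier_mat d d" by (rule channel_carrier[OF pow_limD(1)[OF lim] A])
  have lm: "(\<lambda>k. z ^ f k * A $$ (i, j)) \<longlonglongrightarrow> L A $$ (i, j)" if "i < d" "j < d" for i j
    using pow_limD(2)[OF lim A that] that A by (simp add: funpow_eigen[OF A z(2)])
  show ?thesis
  proof (cases "\<exists>i<d. \<exists>j<d. A $$ (i, j) \<noteq> 0")
    case False
    then have "L A $$ (i, j) = 0" if "i < d" "j < d" for i j
      using lm[OF that] that by (simp add: LIMSEQ_const_iff)
    then have "L A = 1 \<cdot>\<^sub>m A" using False A Lc by (intro eq_matI) auto
    then show ?thesis by (intro exI[of _ 1]) simp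
  next
    case True
    then obtain i j where ij: "i < d" "j < d" "A $$ (i, j) \<noteq> 0" by blast
    define w where "w = L A $$ (i, j) / A $$ (i, j)"
    have w: "(\<lambda>k. z ^ f k) \<longlonglongrightarrow> w"
      using tendsto_divide[OF lm[OF ij(1,2)] tendsto_const ij(3)] ij(3) by (simp add: w_def)
    then have "(\<lambda>k. cmod (z ^ f k)) \<longlonglongrightarrow> cmod w" by (rule tendsto_norm)
    then have "cmod w = 1" by (simp add: norm_power z(1) LIMSEQ_const_iff)
    moreover have "L A = w \<cdot>\<^sub>m A"
    proof (rule eq_matI)
      fix i j assume "i < dim_row (w \<cdot>\<^sub>m A)" "j < dim_col (w \<cdot>\<^sub>m A)"
      then have ij: "i < d" "j < d" using A by auto
      have "L A $$ (i, j) = w * A $$ (i, j)"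
        using LIMSEQ_unique[OF lm[OF ij] tendsto_mult_right[OF w]] .
      then show "L A $$ (i, j) = (w \<cdot>\<^sub>m A) $$ (i, j)" using ij A by simp
    qed (use A Lc in auto)
    ultimately show ?thesis by blast
  qed
qed

lemma pow_lim_commute:
  assumes lim: "pow_lim d T f L" and X: "X \<in> carrier_mat d d"
  shows "T (L X) = L (T X)"
proof (rule eq_matI)
  have LX: "L X \<in> carrier_mat d d" by (rule channel_carrier[OF pow_limD(1)[OF lim] X])
  have TX: "T X \<in> carrier_mat d d" by (rule channel_carrier[OF ch X])
  have LTX: "L (T X) \<in> carrier_mat d d" by (rule channel_carrier[OF pow_limD(1)[OF lim] TX])
  show "dim_row (T (L X)) = dim_row (L (T X))" "dim_col (T (L X)) = dim_col (L (T X))"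
    using LTX channel_carrier[OF ch LX] by auto
  fix i j assume "i < dim_row (L (T X))" "j < dim_col (L (T X))"
  then have ij: "i < d" "j < d" using LTX by auto
  have "(T ^^ f k) (T X) $$ (i, j)
     = (\<Sum>a<d. \<Sum>b<d. (T ^^ f k) X $$ (a, b) * T (munit d a b) $$ (i, j))" for k
    using channel_expand[OF ch channel_carrier[OF channel_funpow[OF ch] X] ij, of "f k"]
    by (simp add: funpow_swap1)
  moreover have "(\<lambda>k. \<Sum>a<d. \<Sum>b<d. (T ^^ f k) X $$ (a, b) * T (munit d a b) $$ (i, j)) \<longlonglongrightarrow>
      (\<Sum>a<d. \<Sum>b<d. L X $$ (a, b) * T (munit d a b) $$ (i, j))"
    by (intro tendsto_sum tendsto_mult tendsto_const pow_limD(2)[OF lim X]) auto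
  ultimately have "(\<lambda>k. (T ^^ f k) (T X) $$ (i, j)) \<longlonglongrightarrow> T (L X) $$ (i, j)"
    unfolding channel_expand[OF ch LX ij] by simp
  then show "T (L X) $$ (i, j) = L (T X) $$ (i, j)"
    using pow_limD(2)[OF lim TX ij] LIMSEQ_unique by blast
qed

text \<open>Schur triangularisation of \<open>T\<close> on the d^2-dimensional space of matrices. A
  flag of invariant subspaces suffices for the induction in \<open>peripheral_limit\<close>;
  possible Jordan blocks are dealt with there through recurrence.\<close>

lemma triangular_basis:
  "\<exists>F B. (\<forall>j<d * d. F j \<in> carrier_mat d d) \<and>
     (\<forall>j<d * d. \<forall>p<d. \<forall>q<d. T (F j) $$ (p, q) = (\<Sum>k<Suc j. B k j * F k $$ (p, q))) \<and>
     (\<forall>X\<in>carrier_mat d d. \<exists>c. \<forall>p<d. \<forall>q<d. X $$ (p, q) = (\<Sum>j<d * d. c j * F j $$ (p, q)))"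
proof -
  let ?N = "d * d"
  \<comment> \<open>The matrix of \<open>T\<close> for row-major vectorisation, with E_ab at index
    \<open>a * d + b\<close>.\<close>
  define A where "A = mat ?N ?N (\<lambda>(p, q). T (munit d (q div d) (q mod d)) $$ (p div d, p mod d))"
  have A: "A \<in> carrier_mat ?N ?N" by (simp add: A_def)
  obtain es where "char_poly A = (\<Prod>a\<leftarrow>es. [:- a, 1:])"
    using char_poly_factorized[OF A] by blast
  then obtain B where B: "B \<in> carrier_mat ?N ?N" "upper_triangular B" "similar_mat A B"
    using schur_decomposition_exists[OF A] by blast
  obtain P Q where PQ: "similar_mat_wit A B P Q" using B(3) unfolding similar_mat_def by blast
  have P: "P \<in> carrier_mat ?N ?N" and Q: "Q \<in> carrier_mat ?N ?N"
    and PQ1: "P * Q = 1\<^sub>m ?N" and QP1: "Q * P = 1\<^sub>m ?N" and Aeq: "A = P * B * Q"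
    using PQ A unfolding similar_mat_wit_def Let_def by auto
  have "A * P = P * B * (Q * P)" unfolding Aeq using P Q B(1) by (intro assoc_mult_mat) auto
  then have AP: "A * P = P * B" using QP1 P B(1) by simp
  define F where "F = (\<lambda>j. mat d d (\<lambda>(a, b). P $$ (a * d + b, j)))"
  have F: "F j \<in> carrier_mat d d" for j by (simp add: F_def)
  have tri: "T (F j) $$ (p, q) = (\<Sum>k<Suc j. B $$ (k, j) * F k $$ (p, q))"
    if "j < ?N" "p < d" "q < d" for j p q
  proof -
    have pq: "p * d + q < ?N" by (rule block_index_less[OF that(2,3)])
    have "T (F j) $$ (p, q) = (\<Sum>a<d. \<Sum>b<d. A $$ (p * d + q, a * d + b) * P $$ (a * d + b, j))"
      unfolding channel_expand[OF ch F that(2,3)]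
      using that pq by (intro sum.cong refl) (simp add: F_def A_def block_index_less mult.commute)
    also have "\<dots> = (\<Sum>r<?N. A $$ (p * d + q, r) * P $$ (r, j))"
      by (simp add: sum_mult_product add.commute)
    also have "\<dots> = (A * P) $$ (p * d + q, j)"
      using A P pq that(1) by (simp add: scalar_prod_def atLeast0LessThan)
    also have "\<dots> = (\<Sum>k<?N. P $$ (p * d + q, k) * B $$ (k, j))"
      unfolding AP using B(1) P pq that(1) by (simp add: scalar_prod_def atLeast0LessThan)
    \<comment> \<open>Upper triangularity removes the indices above \<open>j\<close>;
      \<open>Suc j\<close> keeps the diagonal coefficient, which plays the role of the
      eigenvalue.\<close>
    also have "\<dots> = (\<Sum>k<Suc j. P $$ (p * d + q, k) * B $$ (k, j))"
      using that(1) B(1,2) by (intro sum.mono_neutral_right) (auto simp: upper_triangular_def)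
    also have "\<dots> = (\<Sum>k<Suc j. B $$ (k, j) * F k $$ (p, q))"
      using that by (simp add: F_def mult.commute)
    finally show ?thesis .
  qed
  have span: "\<exists>c. \<forall>p<d. \<forall>q<d. X $$ (p, q) = (\<Sum>j<?N. c j * F j $$ (p, q))"
    if "X \<in> carrier_mat d d" for X
  proof (intro exI allI impI)
    fix p q assume pq: "p < d" "q < d"
    define x where "x = vec ?N (\<lambda>r. X $$ (r div d, r mod d))"
    have r: "p * d + q < ?N" by (rule block_index_less[OF pq])
    have "X $$ (p, q) = x $ (p * d + q)" using r pq by (simp add: x_def)
    also have "x = P *\<^sub>v (Q *\<^sub>v x)"
      using P Q PQ1 by (simp add: x_def flip: assoc_mult_mat_vec)
    also have "\<dots> $ (p * d + q) = (\<Sum>j<?N. P $$ (p * d + q, j) * (Q *\<^sub>v x) $ j)"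
      using P Q r by (simp add: scalar_prod_def atLeast0LessThan)
    finally show "X $$ (p, q) = (\<Sum>j<?N. (Q *\<^sub>v vec ?N (\<lambda>r. X $$ (r div d, r mod d))) $ j * F j $$ (p, q))"
      using pq by (simp add: F_def mult.commute x_def)
  qed
  show ?thesis
    by (rule exI[of _ F], rule exI[of _ "\<lambda>k j. B $$ (k, j)"]) (use F tri span in blast)
qed


text \<open>\<open>L\<close> multiplies a peripheral eigenvector by a unimodular scalar, so the
  eigenvector lies in the range of \<open>L\<close>, where \<open>P\<close> is the identity.\<close>

lemma pow_lim_fixes_peripheral:
  assumes L: "pow_lim d T f L" and P: "channel d d P"
    and PL: "\<And>X. X \<in> carrier_mat d d \<Longrightarrow> P (L X) = L X"
    and X: "X \<in> per"
  shows "P X = X"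
  using X
proof (induction X rule: peripheral_induct)
  case zero
  show ?case by (rule channel_zero[OF P])
next
  case (add X A z)
  obtain w where w: "cmod w = 1" "L A = w \<cdot>\<^sub>m A" using pow_lim_eigen[OF L add(2-4)] by blast
  then have "w \<cdot>\<^sub>m P A = w \<cdot>\<^sub>m A" using PL[OF add(2)] channel_smult[OF P add(2)] by simp
  then have "(1 / w) \<cdot>\<^sub>m (w \<cdot>\<^sub>m P A) = (1 / w) \<cdot>\<^sub>m (w \<cdot>\<^sub>m A)" by simp
  moreover have "(1 / w) \<cdot>\<^sub>m (w \<cdot>\<^sub>m Y) = Y" for Y :: "complex mat"
    using w(1) by (intro eq_matI) auto
  ultimately have "P A = A" by metis
  then show ?case
    using channel_add[OF P peripheral_carrier[OF add(1)] add(2)] add(5) by simp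
qed

text \<open>The linear growth in \<open>n\<close> is what will contradict boundedness of the powers
  when |z| = 1. At n = 0 the truncated exponent is harmless, its coefficient being 0.\<close>

lemma jordan_chain_entry:
  assumes w: "w \<in> carrier_mat d d" and y: "y \<in> carrier_mat d d"
    and Tw: "T w = z \<cdot>\<^sub>m w + y" and Ty: "T y = z \<cdot>\<^sub>m y" and ij: "i < d" "j < d"
  shows "(T ^^ n) w $$ (i, j) = z ^ n * w $$ (i, j) + of_nat n * z ^ (n - 1) * y $$ (i, j)"
proof -
  have "(T ^^ n) w = z ^ n \<cdot>\<^sub>m w + (of_nat n * z ^ (n - 1)) \<cdot>\<^sub>m y"
  proof (induction n)
    case 0
    show ?case using w y by (intro eq_matI) auto
  next
    case (Suc n)
    have "(T ^^ Suc n) w = z ^ n \<cdot>\<^sub>m (z \<cdot>\<^sub>m w + y) + (of_nat n * z ^ (n - 1)) \<cdot>\<^sub>m (z \<cdot>\<^sub>m y)"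
      using Suc w y by (simp add: channel_add[OF ch] channel_smult[OF ch] Tw Ty)
    also have "\<dots> = z ^ Suc n \<cdot>\<^sub>m w + (of_nat (Suc n) * z ^ (Suc n - 1)) \<cdot>\<^sub>m y"
      using w y by (intro eq_matI) (cases n; auto simp: algebra_simps)+
    finally show ?case .
  qed
  then show ?thesis using w y ij by simp
qed

text \<open>A vector that is only triangular over \<open>per\<close> lies in \<open>per\<close> if it is recurrent: power boundedness
  rules out Jordan blocks on the unit circle, recurrence rules out eigenvalues off it.\<close>

lemma recurrent_mem_peripheral:
  assumes P: "pow_lim d T f P" and f: "\<And>k. k \<le> f k"
    and Pfix: "\<And>X. X \<in> per \<Longrightarrow> P X = X"
    and x: "x \<in> per" and w: "w \<in> carrier_mat d d" "P w = w"
    and Tw: "T w = z \<cdot>\<^sub>m w + y + x"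
    and y: "y \<in> carrier_mat d d" "T y = z \<cdot>\<^sub>m y" "cmod z = 1 \<or> y = 0\<^sub>m d d"
  shows "w \<in> per"
  using x w Tw y
\<comment> \<open>The slot \<open>y\<close> collects the eigenvectors for \<open>z\<close> itself
  that are met on the way, all others are removed by shifting \<open>w\<close>; hence both vary in
  the induction.\<close>
proof (induction x arbitrary: w y rule: peripheral_induct)
  case zero
  note wc = zero(1) and Pw = zero(2) and yc = zero(4) and Ty = zero(5)
  have Tw: "T w = z \<cdot>\<^sub>m w + y" using zero(3) wc yc by simp
  note ent = jordan_chain_entry[OF wc yc Tw Ty]
  define B where "B = (\<Sum>a<d. \<Sum>b<d. cmod (w $$ (a, b)))"
  have B: "cmod ((T ^^ n) w $$ (i, j)) \<le> B" if "i < d" "j < d" for n i j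
    unfolding B_def by (rule funpow_entry_bound[OF wc that])
  show ?case
  proof (cases "cmod z = 1")
    case True
    have "y $$ (i, j) = 0" if ij: "i < d" "j < d" for i j
    proof (rule ccontr)
      assume nz: "y $$ (i, j) \<noteq> 0"
      \<comment> \<open>Twice \<open>B\<close>, because the linear term is the difference of T^n w
        and z^n w, each bounded by \<open>B\<close>.\<close>
      obtain n :: nat where n: "2 * B < real n * cmod (y $$ (i, j))"
        using reals_Archimedean3[of "cmod (y $$ (i, j))"] nz by auto
      have "of_nat n * z ^ (n - 1) * y $$ (i, j) = (T ^^ n) w $$ (i, j) - z ^ n * w $$ (i, j)"
        using ent[OF ij, of n] by simp
      then have "cmod (of_nat n * z ^ (n - 1) * y $$ (i, j)) \<le> cmod ((T ^^ n) w $$ (i, j)) + cmod (z ^ n * w $$ (i, j))"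
        by (metis norm_triangle_ineq4)
      also have "\<dots> \<le> B + B"
        using B[OF ij, of n] B[OF ij, of 0] True by (simp add: norm_mult norm_power)
      finally show False using n True by (simp add: norm_mult norm_power)
    qed
    then have "T w = z \<cdot>\<^sub>m w" unfolding Tw using wc yc by (intro eq_matI) auto
    then show ?thesis using peripheral_eigen[OF wc True] by simp
  next
    case False
    then have y0: "y = 0\<^sub>m d d" using zero(6) by simp
    \<comment> \<open>With y = 0 the entry of T^n w is a pure power: for |z| < 1 it tends to 0 along
      \<open>f\<close>, against P w = w, and for |z| > 1 it eventually exceeds
      \<open>B\<close>.\<close>
    have "w $$ (i, j) = 0" if ij: "i < d" "j < d" for i j
    proof (rule ccontr)
      assume nz: "w $$ (i, j) \<noteq> 0"
      have pw: "(T ^^ n) w $$ (i, j) = z ^ n * w $$ (i, j)" for n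
        using ent[OF ij, of n] y0 ij by simp
      show False
      proof (cases "cmod z < 1")
        case True
        have "(\<lambda>k. z ^ f k) \<longlonglongrightarrow> 0"
        proof (rule Lim_null_comparison)
          show "\<forall>\<^sub>F k in sequentially. cmod (z ^ f k) \<le> cmod z ^ k"
            using f True by (intro always_eventually allI) (simp add: norm_power power_decreasing)
          show "(\<lambda>k. cmod z ^ k) \<longlonglongrightarrow> 0" using True by (intro LIMSEQ_realpow_zero) auto
        qed
        then have "(\<lambda>k. (T ^^ f k) w $$ (i, j)) \<longlonglongrightarrow> 0 * w $$ (i, j)"
          unfolding pw by (rule tendsto_mult_right)
        then have "P w $$ (i, j) = 0" using pow_limD(2)[OF P wc ij] LIMSEQ_unique by force
        then show False using Pw nz by simp
      next
        case False
        then have "1 < cmod z" using \<open>cmod z \<noteq> 1\<close> by simp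
        then obtain n where "B / cmod (w $$ (i, j)) < cmod z ^ n" using real_arch_pow by blast
        then have "B < cmod (z ^ n * w $$ (i, j))"
          using nz by (simp add: norm_mult norm_power field_simps)
        then show False using B[OF ij, of n] unfolding pw by simp
      qed
    qed
    then have "w = 0\<^sub>m d d" using wc by (intro eq_matI) auto
    then show ?thesis using peripheral_zero by simp
  qed
next
  case (add x A \<mu>)
  note wc = add(6) and xc = peripheral_carrier[OF add(1)] and yc = add(9)
  show ?case
  proof (cases "\<mu> = z")
    case True
    \<comment> \<open>An eigenvector for the same eigenvalue joins \<open>y\<close>; its eigenvalue
      is unimodular, so the side condition on \<open>y\<close> persists.\<close>
    have yA: "T (y + A) = z \<cdot>\<^sub>m (y + A)"
      using channel_add[OF ch yc add(2)] add(10) add(4) True yc add(2)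
      by (simp add: add_smult_distrib_left_mat)
    have "z \<cdot>\<^sub>m w + y + (x + A) = z \<cdot>\<^sub>m w + (y + A) + x"
      using wc xc yc add(2) by (intro eq_matI) auto
    then show ?thesis
      using add(5)[OF add(6,7) _ _ yA] add(8,3) True yc add(2) by auto
  next
    case False
    \<comment> \<open>Solves c * (z - \<mu>) = 1, so that adding \<open>c\<close> times
      \<open>A\<close> to \<open>w\<close> cancels \<open>A\<close> on the right-hand side.\<close>
    define c where "c = 1 / (z - \<mu>)"
    have c: "1 + c * \<mu> = z * c" using False by (simp add: c_def field_simps)
    let ?w = "w + c \<cdot>\<^sub>m A"
    have cA: "c \<cdot>\<^sub>m A \<in> per" by (intro peripheral_smult peripheral_eigen[OF add(2-4)])
    have "P ?w = ?w"
      using channel_add[OF pow_limD(1)[OF P] wc, of "c \<cdot>\<^sub>m A"] add(7) add(2) Pfix[OF cA] by simp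
    moreover have "T ?w = z \<cdot>\<^sub>m ?w + y + x"
    proof -
      have "T ?w = z \<cdot>\<^sub>m w + y + (x + A) + c \<cdot>\<^sub>m (\<mu> \<cdot>\<^sub>m A)"
        using channel_add[OF ch wc, of "c \<cdot>\<^sub>m A"] channel_smult[OF ch add(2)] add(2,4,8) by simp
      also have "\<dots> = z \<cdot>\<^sub>m ?w + y + x"
      proof (rule eq_matI)
        fix i j assume "i < dim_row (z \<cdot>\<^sub>m ?w + y + x)" "j < dim_col (z \<cdot>\<^sub>m ?w + y + x)"
        then have ij: "i < d" "j < d" using wc xc yc add(2) by auto
        have "A $$ (i, j) + c * (\<mu> * A $$ (i, j)) = (1 + c * \<mu>) * A $$ (i, j)" by (simp add: algebra_simps)
        also have "\<dots> = z * (c * A $$ (i, j))" unfolding c by simp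
        finally show "(z \<cdot>\<^sub>m w + y + (x + A) + c \<cdot>\<^sub>m (\<mu> \<cdot>\<^sub>m A)) $$ (i, j) = (z \<cdot>\<^sub>m ?w + y + x) $$ (i, j)"
          using ij wc xc yc add(2) by (simp add: algebra_simps)
      qed (use wc xc yc add(2) in auto)
      finally show ?thesis .
    qed
    ultimately have wp: "?w \<in> per" using add(5)[of ?w y] wc add(2,9-11) by simp
    have "?w + (- c) \<cdot>\<^sub>m A = w" using wc add(2) by (intro eq_matI) auto
    moreover have "(- c) \<cdot>\<^sub>m A \<in> per" by (intro peripheral_smult peripheral_eigen[OF add(2-4)])
    ultimately show ?thesis using peripheral_add[OF wp, of "(- c) \<cdot>\<^sub>m A"] by simp
  qed
qed

lemma channel_sum_mem_peripheral:
  fixes n :: nat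
  assumes L: "channel d d L" and F: "\<And>k. k < n \<Longrightarrow> F k \<in> carrier_mat d d \<and> L (F k) \<in> per"
  shows "L (mat d d (\<lambda>p. \<Sum>k<n. c k * F k $$ p)) \<in> per"
  using F
proof (induction n)
  case 0
  have "mat d d (\<lambda>p. \<Sum>k<(0::nat). c k * F k $$ p) = 0\<^sub>m d d" by (intro eq_matI) auto
  then show ?case using channel_zero[OF L] peripheral_zero by simp
next
  case (Suc n)
  have F: "F n \<in> carrier_mat d d" "L (F n) \<in> per" using Suc.prems[of n] by auto
  have "mat d d (\<lambda>p. \<Sum>k<Suc n. c k * F k $$ p) = mat d d (\<lambda>p. \<Sum>k<n. c k * F k $$ p) + c n \<cdot>\<^sub>m F n"
    using F by (intro eq_matI) auto
  then have "L (mat d d (\<lambda>p. \<Sum>k<Suc n. c k * F k $$ p))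
      = L (mat d d (\<lambda>p. \<Sum>k<n. c k * F k $$ p)) + c n \<cdot>\<^sub>m L (F n)"
    using F by (simp add: channel_add[OF L] channel_smult[OF L])
  then show ?case using peripheral_add peripheral_smult F Suc by simp
qed

text \<open>A gap power carries T^(r i) to T^(r (2 i)), and both of these approach \<open>L\<close>;
  so a limit of gap powers fixes the range of \<open>L\<close>. The bound \<open>k \<le> f k\<close>
  sends the exponents to infinity, which kills eigenvalues inside the disc and leaves room to
  subtract a fixed t.\<close>

lemma recurrent_pow_lims:
  "\<exists>r L f P. strict_mono r \<and> pow_lim d T r L \<and> pow_lim d T f P \<and> (\<forall>k. k \<le> f k) \<and>
     (\<forall>X\<in>carrier_mat d d. P (L X) = L X)"
proof -
  obtain r L where r: "strict_mono r" and L: "pow_lim d T r L"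
    using pow_lim_exists[of id] by (auto simp: id_def)
  have mono: "r i + n \<le> r (i + n)" for i n
  proof (induction n)
    case (Suc n)
    have "r (i + n) < r (i + Suc n)" using r by (simp add: strict_mono_Suc_iff)
    then show ?case using Suc by simp
  qed simp
  define m where "m = (\<lambda>i. r (i + i) - r i)"
  have m: "m i + r i = r (i + i)" "i \<le> m i" for i using mono[of i i] by (auto simp: m_def)
  obtain s P where s: "strict_mono s" and P: "pow_lim d T (\<lambda>k. m (s k)) P"
    using pow_lim_exists[of m] by blast
  have "P (L X) = L X" if X: "X \<in> carrier_mat d d" for X
  proof (rule eq_matI)
    have LX: "L X \<in> carrier_mat d d" by (rule channel_carrier[OF pow_limD(1)[OF L] X])
    then show "dim_row (P (L X)) = dim_row (L X)" "dim_col (P (L X)) = dim_col (L X)"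
      using channel_carrier[OF pow_limD(1)[OF P] LX] by auto
    fix i j assume "i < dim_row (L X)" "j < dim_col (L X)"
    then have ij: "i < d" "j < d" using LX by auto
    have "(\<lambda>k. (T ^^ (m (s k) + r (s k))) X $$ (i, j)) \<longlonglongrightarrow> P (L X) $$ (i, j)"
      by (rule pow_lim_compose[OF P pow_lim_subseq[OF L s] X ij])
    moreover have "strict_mono (\<lambda>k. s k + s k)" using s by (simp add: strict_mono_def add_strict_mono)
    then have "(\<lambda>k. (T ^^ (r (s k + s k))) X $$ (i, j)) \<longlonglongrightarrow> L X $$ (i, j)"
      using pow_limD(2)[OF pow_lim_subseq[OF L] X ij] by blast
    ultimately show "P (L X) $$ (i, j) = L X $$ (i, j)" unfolding m(1) using LIMSEQ_unique by blast
  qed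
  moreover have "k \<le> m (s k)" for k using m(2)[of "s k"] seq_suble[OF s, of k] by simp
  ultimately show ?thesis using r L P by blast
qed

text \<open>Induction along the triangular basis. As \<open>L\<close> commutes with
  \<open>T\<close>, \<open>L (F j)\<close> is an eigenvector up to \<open>L Y\<close>, which is
  peripheral by induction; and it is recurrent because \<open>P\<close> fixes the range of
  \<open>L\<close>.\<close>

lemma peripheral_limit:
  "\<exists>r L. strict_mono r \<and> pow_lim d T r L \<and> (\<forall>X\<in>carrier_mat d d. L X \<in> per)"
proof -
  obtain r L f P where r: "strict_mono r" and L: "pow_lim d T r L" and P: "pow_lim d T f P"
    and f: "\<And>k. k \<le> f k" and PL: "\<And>X. X \<in> carrier_mat d d \<Longrightarrow> P (L X) = L X"
    using recurrent_pow_lims by blast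
  note Lch = pow_limD(1)[OF L]
  have Pfix: "P X = X" if "X \<in> per" for X
    by (rule pow_lim_fixes_peripheral[OF L pow_limD(1)[OF P] PL that])
  obtain F B where FB: "(\<forall>j<d * d. F j \<in> carrier_mat d d) \<and>
     (\<forall>j<d * d. \<forall>p<d. \<forall>q<d. T (F j) $$ (p, q) = (\<Sum>k<Suc j. B k j * F k $$ (p, q))) \<and>
     (\<forall>X\<in>carrier_mat d d. \<exists>c. \<forall>p<d. \<forall>q<d. X $$ (p, q) = (\<Sum>j<d * d. c j * F j $$ (p, q)))"
    using triangular_basis by (elim exE)
  note F = conjunct1[OF FB, rule_format] and tri = conjunct1[OF conjunct2[OF FB], rule_format]
    and span = conjunct2[OF conjunct2[OF FB], rule_format]
  have LF: "L (F j) \<in> per" if "j < d * d" for j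
    using that
  proof (induction j rule: less_induct)
    case (less j)
    define Y where "Y = mat d d (\<lambda>p. \<Sum>k<j. B k j * F k $$ p)"
    have LY: "L Y \<in> per"
      unfolding Y_def by (rule channel_sum_mem_peripheral[OF Lch]) (use less F in auto)
    have Yc: "Y \<in> carrier_mat d d" by (simp add: Y_def)
    note Fc = F[OF less.prems]
    have TF: "T (F j) = B j j \<cdot>\<^sub>m F j + Y"
      using channel_carrier[OF ch Fc] Fc Yc tri[OF less.prems]
      by (intro eq_matI) (auto simp: Y_def)
    have LFc: "L (F j) \<in> carrier_mat d d" by (rule channel_carrier[OF Lch Fc])
    have LYc: "L Y \<in> carrier_mat d d" by (rule channel_carrier[OF Lch Yc])
    have "T (L (F j)) = B j j \<cdot>\<^sub>m L (F j) + L Y"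
      unfolding pow_lim_commute[OF L Fc] TF
      using Fc Yc by (simp add: channel_add[OF Lch] channel_smult[OF Lch])
    \<comment> \<open>The zero matrix is the initial content of the slot \<open>y\<close> of
      \<open>recurrent_mem_peripheral\<close>.\<close>
    then have TL: "T (L (F j)) = B j j \<cdot>\<^sub>m L (F j) + 0\<^sub>m d d + L Y" using LFc by simp
    have z: "(0\<^sub>m d d :: complex mat) \<in> carrier_mat d d" by simp
    have T0: "T (0\<^sub>m d d) = B j j \<cdot>\<^sub>m 0\<^sub>m d d"
      unfolding channel_zero[OF ch] by (intro eq_matI) auto
    show ?case
      by (rule recurrent_mem_peripheral[OF P f Pfix LY LFc PL[OF Fc] TL z T0 disjI2[OF refl]])
  qed
  have "L X \<in> per" if X: "X \<in> carrier_mat d d" for X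
  proof -
    obtain c where "\<forall>p<d. \<forall>q<d. X $$ (p, q) = (\<Sum>j<d * d. c j * F j $$ (p, q))" using span[OF X] by blast
    then have "X = mat d d (\<lambda>p. \<Sum>j<d * d. c j * F j $$ p)" using X by (intro eq_matI) auto
    then show ?thesis using channel_sum_mem_peripheral[OF Lch, of "d * d" F c] F LF by simp
  qed
  then show ?thesis using r L by blast
qed

text \<open>On the peripheral space T^(n - t) nearly undoes T^t for those \<open>n\<close> at which
  T^n is nearly the identity there; a compactness limit turns this into one exact channel.\<close>

lemma peripheral_recovery:
  "\<exists>S. channel d d S \<and> (\<forall>X\<in>per. S ((T ^^ t) X) = X)"
proof -
  obtain r L f P where L: "pow_lim d T r L" and P: "pow_lim d T f P"
    and f: "\<And>k. k \<le> f k" and PL: "\<And>X. X \<in> carrier_mat d d \<Longrightarrow> P (L X) = L X"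
    using recurrent_pow_lims by blast
  obtain s S where s: "strict_mono s" and S: "pow_lim d T (\<lambda>k. f (s k) - t) S"
    using pow_lim_exists[of "\<lambda>k. f k - t"] by blast
  have "S ((T ^^ t) X) = X" if X: "X \<in> per" for X
  proof (rule eq_matI)
    have Xc: "X \<in> carrier_mat d d" by (rule peripheral_carrier[OF X])
    have TXc: "(T ^^ t) X \<in> carrier_mat d d" by (rule channel_carrier[OF channel_funpow[OF ch] Xc])
    show "dim_row (S ((T ^^ t) X)) = dim_row X" "dim_col (S ((T ^^ t) X)) = dim_col X"
      using Xc channel_carrier[OF pow_limD(1)[OF S] TXc] by auto
    fix i j assume "i < dim_row X" "j < dim_col X"
    then have ij: "i < d" "j < d" using Xc by auto
    have "P X = X" by (rule pow_lim_fixes_peripheral[OF L pow_limD(1)[OF P] PL X])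
    then have "(\<lambda>k. (T ^^ f (s k)) X $$ (i, j)) \<longlonglongrightarrow> X $$ (i, j)"
      using pow_limD(2)[OF pow_lim_subseq[OF P s] Xc ij] by simp
    \<comment> \<open>For finitely many \<open>k\<close> the subtraction may be truncated, hence
      only eventual equality.\<close>
    moreover have "\<forall>\<^sub>F k in sequentially. (T ^^ f (s k)) X $$ (i, j) = (T ^^ (f (s k) - t)) ((T ^^ t) X) $$ (i, j)"
    proof (rule eventually_sequentiallyI[of t])
      fix k assume "t \<le> k"
      then have "t \<le> f (s k)" using f[of "s k"] seq_suble[OF s, of k] by simp
      then have "T ^^ f (s k) = T ^^ (f (s k) - t) \<circ> T ^^ t" by (simp flip: funpow_add)
      then show "(T ^^ f (s k)) X $$ (i, j) = (T ^^ (f (s k) - t)) ((T ^^ t) X) $$ (i, j)" by simp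
    qed
    ultimately have "(\<lambda>k. (T ^^ (f (s k) - t)) ((T ^^ t) X) $$ (i, j)) \<longlonglongrightarrow> X $$ (i, j)"
      by (rule Lim_transform_eventually)
    then show "S ((T ^^ t) X) $$ (i, j) = X $$ (i, j)"
      using pow_limD(2)[OF S TXc ij] LIMSEQ_unique by blast
  qed
  then show ?thesis using pow_limD(1)[OF S] by blast
qed

end

section \<open>Block coordinates\<close>

definition block_off :: "nat \<Rightarrow> (nat \<Rightarrow> nat) \<Rightarrow> (nat \<Rightarrow> nat) \<Rightarrow> nat \<Rightarrow> nat" where
  "block_off d0 dk mk k = d0 + (\<Sum>l\<in>{1..<k}. dk l * mk l)"

text \<open>The row of |a> \<otimes> |b> of block \<open>k\<close> in the ordering that
  \<open>diag_block_mat\<close> and \<open>kron\<close> produce. Blocks are numbered from 1; the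
  first \<open>d0\<close> rows belong to H_0.\<close>

definition block_pos :: "nat \<Rightarrow> (nat \<Rightarrow> nat) \<Rightarrow> (nat \<Rightarrow> nat) \<Rightarrow> nat \<Rightarrow> nat \<Rightarrow> nat \<Rightarrow> nat" where
  "block_pos d0 dk mk k a b = block_off d0 dk mk k + (a * mk k + b)"

lemma block_off_Suc: "1 \<le> k \<Longrightarrow> block_off d0 dk mk (Suc k) = block_off d0 dk mk k + dk k * mk k"
  by (simp add: block_off_def)

lemma block_off_one: "block_off d0 dk mk (Suc 0) = d0"
  by (simp add: block_off_def)

lemma block_off_mono: "k \<le> k' \<Longrightarrow> block_off d0 dk mk k \<le> block_off d0 dk mk k'"
  unfolding block_off_def by (intro add_left_mono sum_mono2) auto

lemma block_pos_less:
  assumes "1 \<le> k" "k < k'" "a < dk k" "b < mk k"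
  shows "block_pos d0 dk mk k a b < block_off d0 dk mk k'"
proof -
  have "block_pos d0 dk mk k a b < block_off d0 dk mk (Suc k)"
    unfolding block_pos_def block_off_Suc[OF assms(1)] using block_index_less[OF assms(3,4)] by simp
  also have "\<dots> \<le> block_off d0 dk mk k'" using assms(2) by (intro block_off_mono) simp
  finally show ?thesis .
qed

lemma block_pos_ge: "block_off d0 dk mk k \<le> block_pos d0 dk mk k a b"
  by (simp add: block_pos_def)

lemma block_pos_inj:
  assumes "1 \<le> k" "a < dk k" "b < mk k" "1 \<le> k'" "a' < dk k'" "b' < mk k'"
    and eq: "block_pos d0 dk mk k a b = block_pos d0 dk mk k' a' b'"
  shows "k = k' \<and> a = a' \<and> b = b'"
proof -
  have "\<not> k < k'" using block_pos_less[of k k' a dk b mk d0] block_pos_ge[of d0 dk mk k' a' b'] eq assms(1-3)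
    by linarith
  moreover have "\<not> k' < k" using block_pos_less[of k' k a' dk b' mk d0] block_pos_ge[of d0 dk mk k a b] eq assms(4-6)
    by linarith
  ultimately have k: "k = k'" by simp
  then have e: "a * mk k + b = a' * mk k + b'" using eq by (simp add: block_pos_def)
  have "(a * mk k + b) div mk k = a" "(a * mk k + b) mod mk k = b" using assms(3) by auto
  moreover have "(a' * mk k + b') div mk k = a'" "(a' * mk k + b') mod mk k = b'" using assms(6) k by auto
  ultimately show ?thesis using e k by metis
qed

lemma sum_lessThan_add:
  fixes f :: "nat \<Rightarrow> 'a :: comm_monoid_add"
  shows "(\<Sum>p<m + n. f p) = (\<Sum>p<m. f p) + (\<Sum>p<n. f (m + p))"
  by (induction n) (simp_all add: add_ac)

lemma sum_lessThan_mult: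
  fixes f :: "nat \<Rightarrow> 'a :: comm_monoid_add"
  shows "(\<Sum>p<n * m. f p) = (\<Sum>a<n. \<Sum>b<m. f (a * m + b))"
proof (induction n)
  case (Suc n)
  have "(\<Sum>p<Suc n * m. f p) = (\<Sum>p<n * m + m. f p)" by (simp add: add.commute)
  then show ?case using Suc by (simp add: sum_lessThan_add)
qed simp

lemma sum_block_pos:
  "(\<Sum>p<block_off d0 dk mk (Suc K). f p)
     = (\<Sum>p<d0. f p) + (\<Sum>k\<in>{1..K}. \<Sum>a<dk k. \<Sum>b<mk k. f (block_pos d0 dk mk k a b))"
proof (induction K)
  case 0
  show ?case by (simp add: block_off_def)
next
  case (Suc K)
  let ?o = "block_off d0 dk mk (Suc K)" and ?n = "dk (Suc K) * mk (Suc K)"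
  have "(\<Sum>p<block_off d0 dk mk (Suc (Suc K)). f p) = (\<Sum>p<?o + ?n. f p)"
    by (simp add: block_off_Suc)
  also have "\<dots> = (\<Sum>p<?o. f p) + (\<Sum>p<?n. f (?o + p))"
    by (rule sum_lessThan_add)
  also have "(\<Sum>p<?n. f (?o + p)) = (\<Sum>a<dk (Suc K). \<Sum>b<mk (Suc K). f (block_pos d0 dk mk (Suc K) a b))"
    by (simp add: block_pos_def sum_lessThan_mult)
  finally show ?case using Suc by (simp add: add.assoc)
qed

context
  fixes d0 :: nat and dk mk :: "nat \<Rightarrow> nat" and X W :: "nat \<Rightarrow> complex mat"
begin

abbreviation (input) bdiag where
  "bdiag K \<equiv> diag_block_mat (0\<^sub>m d0 d0 # map (\<lambda>k. kron (X k) (W k)) [1..<K+1])"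

text \<open>\<open>diag_block_mat\<close> recurses on the head of its list, whereas an offset
  depends on the preceding blocks. Peeling off the last block lets an induction on \<open>K\<close>
  leave the offsets unchanged.\<close>

lemma bdiag_Suc:
  "bdiag (Suc K) = four_block_mat (bdiag K) (0\<^sub>m (dim_row (bdiag K)) (dim_col (kron (X (Suc K)) (W (Suc K)))))
     (0\<^sub>m (dim_row (kron (X (Suc K)) (W (Suc K)))) (dim_col (bdiag K))) (kron (X (Suc K)) (W (Suc K)))"
proof -
  have "0\<^sub>m d0 d0 # map (\<lambda>k. kron (X k) (W k)) [1..<Suc K+1]
     = (0\<^sub>m d0 d0 # map (\<lambda>k. kron (X k) (W k)) [1..<K+1]) @ [kron (X (Suc K)) (W (Suc K))]" by simp
  then show ?thesis unfolding diag_block_mat_last Let_def by (simp only: diag_block_mat_last Let_def)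
qed

lemma bdiag_carrier:
  assumes "\<And>k. k \<in> {1..K} \<Longrightarrow> X k \<in> carrier_mat (dk k) (dk k)"
    and "\<And>k. k \<in> {1..K} \<Longrightarrow> W k \<in> carrier_mat (mk k) (mk k)"
  shows "bdiag K \<in> carrier_mat (block_off d0 dk mk (Suc K)) (block_off d0 dk mk (Suc K))"
  using assms
proof (induction K)
  case 0
  show ?case by (simp add: block_off_def)
next
  case (Suc K)
  have "kron (X (Suc K)) (W (Suc K)) \<in> carrier_mat (dk (Suc K) * mk (Suc K)) (dk (Suc K) * mk (Suc K))"
    using Suc.prems(1)[of "Suc K"] Suc.prems(2)[of "Suc K"] by (auto simp: kron_def)
  moreover have "bdiag K \<in> carrier_mat (block_off d0 dk mk (Suc K)) (block_off d0 dk mk (Suc K))"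
    using Suc by simp
  ultimately show ?case unfolding bdiag_Suc block_off_Suc[of "Suc K", simplified]
    by (intro four_block_carrier_mat) auto
qed

lemma bdiag_entry:
  assumes "\<And>k. k \<in> {1..K} \<Longrightarrow> X k \<in> carrier_mat (dk k) (dk k)"
    and "\<And>k. k \<in> {1..K} \<Longrightarrow> W k \<in> carrier_mat (mk k) (mk k)"
  shows "\<And>k k' a a' b b'. k \<in> {1..K} \<Longrightarrow> k' \<in> {1..K} \<Longrightarrow> a < dk k \<Longrightarrow> a' < dk k' \<Longrightarrow> b < mk k \<Longrightarrow> b' < mk k' \<Longrightarrow>
      bdiag K $$ (block_pos d0 dk mk k a b, block_pos d0 dk mk k' a' b')
        = (if k = k' then X k $$ (a, a') * W k $$ (b, b') else 0)"
    and "\<And>p q. p < block_off d0 dk mk (Suc K) \<Longrightarrow> q < block_off d0 dk mk (Suc K) \<Longrightarrow> p < d0 \<or> q < d0 \<Longrightarrow>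
      bdiag K $$ (p, q) = 0"
proof -
  let ?o = "block_off d0 dk mk" and ?pos = "block_pos d0 dk mk"
  have "(\<forall>k\<in>{1..K}. \<forall>k'\<in>{1..K}. \<forall>a<dk k. \<forall>a'<dk k'. \<forall>b<mk k. \<forall>b'<mk k'.
      bdiag K $$ (?pos k a b, ?pos k' a' b')
        = (if k = k' then X k $$ (a, a') * W k $$ (b, b') else 0)) \<and>
      (\<forall>p<?o (Suc K). \<forall>q<?o (Suc K). p < d0 \<or> q < d0 \<longrightarrow> bdiag K $$ (p, q) = 0)"
    using assms
  proof (induction K)
    case 0
    have "bdiag 0 = 0\<^sub>m d0 d0" by simp
    then show ?case by (simp only: block_off_one) (auto simp del: diag_block_mat.simps)
  next
    case (Suc K)
    let ?B = "kron (X (Suc K)) (W (Suc K))" and ?n = "dk (Suc K) * mk (Suc K)"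
    have XW: "X (Suc K) \<in> carrier_mat (dk (Suc K)) (dk (Suc K))"
      "W (Suc K) \<in> carrier_mat (mk (Suc K)) (mk (Suc K))"
      using Suc.prems(1)[of "Suc K"] Suc.prems(2)[of "Suc K"] by auto
    then have B: "?B \<in> carrier_mat ?n ?n" by (auto simp: kron_def)
    have A: "bdiag K \<in> carrier_mat (?o (Suc K)) (?o (Suc K))"
      using Suc.prems by (intro bdiag_carrier) auto
    have oS: "?o (Suc (Suc K)) = ?o (Suc K) + ?n" by (simp add: block_off_Suc)
    have ent: "bdiag (Suc K) $$ (p, q) =
        (if p < ?o (Suc K) then if q < ?o (Suc K) then bdiag K $$ (p, q) else 0
         else if q < ?o (Suc K) then 0 else ?B $$ (p - ?o (Suc K), q - ?o (Suc K)))"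
      if "p < ?o (Suc (Suc K))" "q < ?o (Suc (Suc K))" for p q
      unfolding bdiag_Suc using that A B oS by (subst index_mat_four_block) auto
    have IH: "\<And>k k' a a' b b'. k \<in> {1..K} \<Longrightarrow> k' \<in> {1..K} \<Longrightarrow> a < dk k \<Longrightarrow> a' < dk k' \<Longrightarrow> b < mk k \<Longrightarrow> b' < mk k' \<Longrightarrow>
        bdiag K $$ (?pos k a b, ?pos k' a' b') = (if k = k' then X k $$ (a, a') * W k $$ (b, b') else 0)"
      "\<And>p q. p < ?o (Suc K) \<Longrightarrow> q < ?o (Suc K) \<Longrightarrow> p < d0 \<or> q < d0 \<Longrightarrow> bdiag K $$ (p, q) = 0"
      using Suc by auto
    show ?case
    proof (intro conjI ballI allI impI)
      fix k k' a a' b b'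
      assume h: "k \<in> {1..Suc K}" "k' \<in> {1..Suc K}" "a < dk k" "a' < dk k'" "b < mk k" "b' < mk k'"
      have l: "?pos k a b < ?o (Suc (Suc K))" "?pos k' a' b' < ?o (Suc (Suc K))"
        using h by (auto intro!: block_pos_less)
      have small: "?pos k a b < ?o (Suc K)" if "k \<noteq> Suc K" using that h by (intro block_pos_less) auto
      have small': "?pos k' a' b' < ?o (Suc K)" if "k' \<noteq> Suc K" using that h by (intro block_pos_less) auto
      have big: "\<not> ?pos (Suc K) a b < ?o (Suc K)" "\<not> ?pos (Suc K) a' b' < ?o (Suc K)"
        by (auto simp: not_less block_pos_ge)
      consider "k = Suc K" "k' = Suc K" | "k = Suc K" "k' \<noteq> Suc K" | "k \<noteq> Suc K" "k' = Suc K"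
        | "k \<noteq> Suc K" "k' \<noteq> Suc K" by blast
      then show "bdiag (Suc K) $$ (?pos k a b, ?pos k' a' b')
          = (if k = k' then X k $$ (a, a') * W k $$ (b, b') else 0)"
      proof cases
        case 1
        have "?B $$ (a * mk (Suc K) + b, a' * mk (Suc K) + b') = X (Suc K) $$ (a, a') * W (Suc K) $$ (b, b')"
          using XW h 1 by (simp add: kron_def block_index_less)
        then show ?thesis using ent[OF l] 1 big by (simp add: block_pos_def)
      next
        case 2
        then show ?thesis using ent[OF l] big small' by simp
      next
        case 3
        then show ?thesis using ent[OF l] big small by simp
      next
        case 4
        then show ?thesis using ent[OF l] small small' IH(1)[of k k' a a' b b'] h by simp
      qed
    next
      fix p q assume pq: "p < ?o (Suc (Suc K))" "q < ?o (Suc (Suc K))" "p < d0 \<or> q < d0"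
      have "d0 \<le> ?o (Suc K)" by (simp add: block_off_def)
      then show "bdiag (Suc K) $$ (p, q) = 0" using ent[OF pq(1,2)] IH(2)[of p q] pq(3) by auto
    qed
  qed
  then show "\<And>k k' a a' b b'. k \<in> {1..K} \<Longrightarrow> k' \<in> {1..K} \<Longrightarrow> a < dk k \<Longrightarrow> a' < dk k' \<Longrightarrow> b < mk k \<Longrightarrow> b' < mk k' \<Longrightarrow>
      bdiag K $$ (?pos k a b, ?pos k' a' b')
        = (if k = k' then X k $$ (a, a') * W k $$ (b, b') else 0)"
    and "\<And>p q. p < ?o (Suc K) \<Longrightarrow> q < ?o (Suc K) \<Longrightarrow> p < d0 \<or> q < d0 \<Longrightarrow> bdiag K $$ (p, q) = 0"
    by blast+
qed

end

section \<open>The algebra of block matrices, direct sums of x_k \<otimes> \<omega>_k\<close>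

locale block_decomposition =
  fixes d d0 K :: nat and dk mk :: "nat \<Rightarrow> nat" and \<omega> :: "nat \<Rightarrow> complex mat" and U :: "complex mat"
  assumes U: "unitary_mat d U"
    and d: "d = d0 + (\<Sum>k\<in>{1..K}. dk k * mk k)"
    and \<omega>: "\<And>k. k \<in> {1..K} \<Longrightarrow> density_op (mk k) (\<omega> k)"
begin

abbreviation pos where "pos \<equiv> block_pos d0 dk mk"

text \<open>Blocks are given as functions rather than matrices, so that no carrier conditions have
  to be passed along and linear combinations are pointwise. Nothing is lost by this, see
  \<open>blockmat_set\<close>.\<close>

definition core :: "(nat \<Rightarrow> nat \<Rightarrow> nat \<Rightarrow> complex) \<Rightarrow> complex mat" where
  "core x = diag_block_mat (0\<^sub>m d0 d0 #
     map (\<lambda>k. kron (mat (dk k) (dk k) (\<lambda>(a, b). x k a b)) (\<omega> k)) [1..<K+1])"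

definition blockmat :: "(nat \<Rightarrow> nat \<Rightarrow> nat \<Rightarrow> complex) \<Rightarrow> complex mat" where
  "blockmat x = U * core x * madj U"

lemma block_off_d: "block_off d0 dk mk (Suc K) = d"
  by (simp add: block_off_def d atLeastLessThanSuc_atLeastAtMost)

lemma less_d: "p < d0 \<Longrightarrow> p < d"
  by (simp add: d)

lemma pos_less: "k \<in> {1..K} \<Longrightarrow> a < dk k \<Longrightarrow> b < mk k \<Longrightarrow> pos k a b < d"
  using block_pos_less[of k "Suc K" a dk b mk d0] unfolding block_off_d by simp

lemma pos_eq_iff:
  "k \<in> {1..K} \<Longrightarrow> a < dk k \<Longrightarrow> b < mk k \<Longrightarrow> k' \<in> {1..K} \<Longrightarrow> a' < dk k' \<Longrightarrow> b' < mk k' \<Longrightarrow>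
    pos k a b = pos k' a' b' \<longleftrightarrow> k = k' \<and> a = a' \<and> b = b'"
  using block_pos_inj[of k a dk b mk k' a' b' d0] by auto

lemma U_carrier: "U \<in> carrier_mat d d" "madj U \<in> carrier_mat d d"
  using U by (auto simp: unitary_mat_def madj_def)

lemma U_rows: "p < d \<Longrightarrow> q < d \<Longrightarrow> (\<Sum>i<d. U $$ (p, i) * cnj (U $$ (q, i))) = (if p = q then 1 else 0)"
proof -
  assume pq: "p < d" "q < d"
  have "(U * madj U) $$ (p, q) = (1\<^sub>m d) $$ (p, q)" using U by (simp add: unitary_mat_def)
  moreover have "(U * madj U) $$ (p, q) = (\<Sum>i<d. U $$ (p, i) * cnj (U $$ (q, i)))"
    using U_carrier pq by (simp add: scalar_prod_def madj_def atLeast0LessThan)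
  ultimately show ?thesis using pq by simp
qed

lemma \<omega>_carrier: "k \<in> {1..K} \<Longrightarrow> \<omega> k \<in> carrier_mat (mk k) (mk k)"
  using \<omega>[of k] by (simp add: density_op_def psd_def)

lemma \<omega>_trace: "k \<in> {1..K} \<Longrightarrow> (\<Sum>b<mk k. \<omega> k $$ (b, b)) = 1"
  using \<omega>[of k] \<omega>_carrier[of k] by (simp add: density_op_def mtrace_def)

lemma \<omega>_psd: "k \<in> {1..K} \<Longrightarrow> psd_on {..<mk k} (\<lambda>b b'. \<omega> k $$ (b, b'))"
  using \<omega>[of k] by (simp add: density_op_def psd_iff_psd_on)

lemma blockmat_set:
  "{U * diag_block_mat (0\<^sub>m d0 d0 # map (\<lambda>k. kron (X k) (\<omega> k)) [1..<K+1]) * madj U | X.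
      \<forall>k\<in>{1..K}. X k \<in> carrier_mat (dk k) (dk k)} = range blockmat"
proof (intro equalityI subsetI)
  fix Y assume "Y \<in> {U * diag_block_mat (0\<^sub>m d0 d0 # map (\<lambda>k. kron (X k) (\<omega> k)) [1..<K+1]) * madj U | X.
      \<forall>k\<in>{1..K}. X k \<in> carrier_mat (dk k) (dk k)}"
  then obtain X where X: "\<forall>k\<in>{1..K}. X k \<in> carrier_mat (dk k) (dk k)"
    and Y: "Y = U * diag_block_mat (0\<^sub>m d0 d0 # map (\<lambda>k. kron (X k) (\<omega> k)) [1..<K+1]) * madj U" by blast
  have "map (\<lambda>k. kron (X k) (\<omega> k)) [1..<K+1]
      = map (\<lambda>k. kron (mat (dk k) (dk k) (\<lambda>(a, b). X k $$ (a, b))) (\<omega> k)) [1..<K+1]"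
  proof (rule map_cong[OF refl])
    fix k assume "k \<in> set [1..<K+1]"
    then have "X k \<in> carrier_mat (dk k) (dk k)" using X by auto
    then have "mat (dk k) (dk k) (\<lambda>(a, b). X k $$ (a, b)) = X k" by (intro eq_matI) auto
    then show "kron (X k) (\<omega> k) = kron (mat (dk k) (dk k) (\<lambda>(a, b). X k $$ (a, b))) (\<omega> k)" by simp
  qed
  then have "Y = blockmat (\<lambda>k a b. X k $$ (a, b))" unfolding Y blockmat_def core_def by (simp only:)
  then show "Y \<in> range blockmat" by simp
next
  fix Y assume "Y \<in> range blockmat"
  then obtain x where "Y = blockmat x" by blast
  then show "Y \<in> {U * diag_block_mat (0\<^sub>m d0 d0 # map (\<lambda>k. kron (X k) (\<omega> k)) [1..<K+1]) * madj U | X.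
      \<forall>k\<in>{1..K}. X k \<in> carrier_mat (dk k) (dk k)}"
    unfolding blockmat_def core_def by (auto simp del: diag_block_mat.simps upt_Suc intro!: exI[of _ "\<lambda>k. mat (dk k) (dk k) (\<lambda>(a, b). x k a b)"])
qed

lemma core_carrier: "core x \<in> carrier_mat d d"
  using bdiag_carrier[of K "\<lambda>k. mat (dk k) (dk k) (\<lambda>(a, b). x k a b)" dk \<omega> mk d0] \<omega>_carrier
  unfolding core_def block_off_d by simp

lemma blockmat_carrier: "blockmat x \<in> carrier_mat d d"
  unfolding blockmat_def using U_carrier core_carrier by (intro mult_carrier_mat[of _ d d]) auto

lemma core_entry:
  assumes "k \<in> {1..K}" "k' \<in> {1..K}" "a < dk k" "a' < dk k'" "b < mk k" "b' < mk k'"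
  shows "core x $$ (pos k a b, pos k' a' b') = (if k = k' then x k a a' * \<omega> k $$ (b, b') else 0)"
  using bdiag_entry(1)[of K "\<lambda>k. mat (dk k) (dk k) (\<lambda>(a, b). x k a b)" dk \<omega> mk k k' a a' b b' d0] \<omega>_carrier assms
  unfolding core_def by auto

lemma core_entry_0: "p < d \<Longrightarrow> q < d \<Longrightarrow> p < d0 \<or> q < d0 \<Longrightarrow> core x $$ (p, q) = 0"
  using bdiag_entry(2)[of K "\<lambda>k. mat (dk k) (dk k) (\<lambda>(a, b). x k a b)" dk \<omega> mk p d0 q] \<omega>_carrier
  unfolding core_def block_off_d by auto

lemma sum_pos:
  "(\<Sum>p<d. f p) = (\<Sum>p<d0. f p) + (\<Sum>k\<in>{1..K}. \<Sum>a<dk k. \<Sum>b<mk k. f (pos k a b))"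
  using sum_block_pos[where f = f and ?d0.0 = d0 and dk = dk and mk = mk and K = K] unfolding block_off_d .

text \<open>The change of basis is undone by unitarity. This reads block coordinates off a matrix in
  the standard basis and lets decoders act on \<open>core\<close> directly.\<close>

lemma blockmat_coeff:
  assumes "p < d" "q < d"
  shows "(\<Sum>i<d. \<Sum>j<d. cnj (U $$ (i, p)) * blockmat x $$ (i, j) * U $$ (j, q)) = core x $$ (p, q)"
proof -
  have bm: "blockmat x = U * core x * madj U" by (simp add: blockmat_def)
  note c = core_carrier[of x] U_carrier
  have "madj U * blockmat x * U = core x"
  proof -
    have "U * core x \<in> carrier_mat d d" "core x * madj U \<in> carrier_mat d d" using c by auto
    then have "madj U * blockmat x * U = (madj U * U) * core x * (madj U * U)"
      unfolding bm using c by (simp only: assoc_mult_mat[of _ d d _ d _ d] mult_carrier_mat[of _ d d _ d])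
    also have "\<dots> = core x" using U c by (simp only: unitary_mat_def) simp
    finally show ?thesis .
  qed
  moreover have "(madj U * blockmat x * U) $$ (p, q)
      = (\<Sum>j<d. (\<Sum>i<d. cnj (U $$ (i, p)) * blockmat x $$ (i, j)) * U $$ (j, q))"
    using assms c blockmat_carrier[of x] by (simp add: scalar_prod_def madj_def atLeast0LessThan)
  moreover have "(\<Sum>j<d. (\<Sum>i<d. cnj (U $$ (i, p)) * blockmat x $$ (i, j)) * U $$ (j, q))
      = (\<Sum>i<d. \<Sum>j<d. cnj (U $$ (i, p)) * blockmat x $$ (i, j) * U $$ (j, q))"
    unfolding sum_distrib_right by (rule sum.swap)
  ultimately show ?thesis by simp
qed

text \<open>The weight \<open>h\<close> is arbitrary so that one rearrangement serves both matrix
  entries and decoder outputs.\<close>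

lemma core_sum:
  "(\<Sum>p<d. \<Sum>q<d. core x $$ (p, q) * h p q) = (\<Sum>k\<in>{1..K}. \<Sum>a<dk k. \<Sum>a'<dk k. \<Sum>b<mk k. \<Sum>b'<mk k.
     x k a a' * \<omega> k $$ (b, b') * h (pos k a b) (pos k a' b'))"
proof -
  have "(\<Sum>p<d. \<Sum>q<d. core x $$ (p, q) * h p q)
      = (\<Sum>k\<in>{1..K}. \<Sum>a<dk k. \<Sum>b<mk k. \<Sum>q<d. core x $$ (pos k a b, q) * h (pos k a b) q)"
    unfolding sum_pos[of "\<lambda>p. \<Sum>q<d. core x $$ (p, q) * h p q"] by (simp add: core_entry_0 less_d)
  also have "\<dots> = (\<Sum>k\<in>{1..K}. \<Sum>a<dk k. \<Sum>b<mk k. \<Sum>a'<dk k. \<Sum>b'<mk k.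
      x k a a' * \<omega> k $$ (b, b') * h (pos k a b) (pos k a' b'))"
  proof (rule sum.cong[OF refl], rule sum.cong[OF refl], rule sum.cong[OF refl])
    fix k a b assume k: "k \<in> {1..K}" and ab: "a \<in> {..<dk k}" "b \<in> {..<mk k}"
    let ?f = "\<lambda>q. core x $$ (pos k a b, q) * h (pos k a b) q"
    have "(\<Sum>q<d. ?f q) = (\<Sum>k'\<in>{1..K}. \<Sum>a'<dk k'. \<Sum>b'<mk k'. ?f (pos k' a' b'))"
      unfolding sum_pos[of ?f] using pos_less[OF k] ab by (simp add: core_entry_0 less_d)
    also have "\<dots> = (\<Sum>k'\<in>{1..K}. if k' = k then \<Sum>a'<dk k. \<Sum>b'<mk k.
        x k a a' * \<omega> k $$ (b, b') * h (pos k a b) (pos k a' b') else 0)"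
      using k ab by (intro sum.cong refl) (auto simp: core_entry)
    also have "\<dots> = (\<Sum>a'<dk k. \<Sum>b'<mk k. x k a a' * \<omega> k $$ (b, b') * h (pos k a b) (pos k a' b'))"
      using k by simp
    finally show "(\<Sum>q<d. ?f q) = (\<Sum>a'<dk k. \<Sum>b'<mk k. x k a a' * \<omega> k $$ (b, b') * h (pos k a b) (pos k a' b'))" .
  qed
  also have "\<dots> = (\<Sum>k\<in>{1..K}. \<Sum>a<dk k. \<Sum>a'<dk k. \<Sum>b<mk k. \<Sum>b'<mk k.
      x k a a' * \<omega> k $$ (b, b') * h (pos k a b) (pos k a' b'))"
    by (intro sum.cong refl sum.swap)
  finally show ?thesis .
qed

text \<open>Its \<open>blockmat\<close> is |a0><a0'| \<otimes> \<omega>_k0, placed in block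
  \<open>k0\<close> and rotated by \<open>U\<close>; these matrices span the block algebra.\<close>

definition unit_kernel :: "nat \<Rightarrow> nat \<Rightarrow> nat \<Rightarrow> nat \<Rightarrow> nat \<Rightarrow> nat \<Rightarrow> complex" where
  "unit_kernel k0 a0 a0' = (\<lambda>k a a'. if k = k0 \<and> a = a0 \<and> a' = a0' then 1 else 0)"

lemma core_sum_unit:
  assumes "k0 \<in> {1..K}" "a0 < dk k0" "a0' < dk k0"
  shows "(\<Sum>p<d. \<Sum>q<d. core (unit_kernel k0 a0 a0') $$ (p, q) * h p q)
    = (\<Sum>b<mk k0. \<Sum>b'<mk k0. \<omega> k0 $$ (b, b') * h (pos k0 a0 b) (pos k0 a0' b'))"
proof -
  let ?S = "\<lambda>k a a'. \<Sum>b<mk k. \<Sum>b'<mk k. \<omega> k $$ (b, b') * h (pos k a b) (pos k a' b')"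
  have "(\<Sum>p<d. \<Sum>q<d. core (unit_kernel k0 a0 a0') $$ (p, q) * h p q)
     = (\<Sum>k\<in>{1..K}. \<Sum>a<dk k. \<Sum>a'<dk k. if a' = a0' then if k = k0 \<and> a = a0 then ?S k a a' else 0 else 0)"
    unfolding core_sum unit_kernel_def by (intro sum.cong refl) (auto simp: mult.assoc)
  also have "\<dots> = (\<Sum>k\<in>{1..K}. if k = k0 then \<Sum>a<dk k. if a = a0 then ?S k a a0' else 0 else 0)"
    using assms(3) by (intro sum.cong refl) (auto intro!: sum.cong)
  also have "\<dots> = ?S k0 a0 a0'" using assms by simp
  finally show ?thesis .
qed

lemma blockmat_entry_core:
  assumes "i < d" "j < d"
  shows "blockmat x $$ (i, j) = (\<Sum>p<d. \<Sum>q<d. core x $$ (p, q) * (U $$ (i, p) * cnj (U $$ (j, q))))"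
proof -
  note c = core_carrier[of x] U_carrier
  have "blockmat x $$ (i, j) = (\<Sum>q<d. (\<Sum>p<d. U $$ (i, p) * core x $$ (p, q)) * cnj (U $$ (j, q)))"
    using assms c by (simp add: blockmat_def scalar_prod_def madj_def atLeast0LessThan)
  also have "\<dots> = (\<Sum>q<d. \<Sum>p<d. core x $$ (p, q) * (U $$ (i, p) * cnj (U $$ (j, q))))"
    by (simp add: sum_distrib_left sum_distrib_right algebra_simps)
  also have "\<dots> = (\<Sum>p<d. \<Sum>q<d. core x $$ (p, q) * (U $$ (i, p) * cnj (U $$ (j, q))))"
    by (rule sum.swap)
  finally show ?thesis .
qed

lemmas blockmat_entry = blockmat_entry_core[unfolded core_sum]

lemmas blockmat_unit_entry = trans[OF blockmat_entry_core core_sum_unit]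

lemma blockmat_trace: "mtrace (blockmat x) = (\<Sum>k\<in>{1..K}. \<Sum>a<dk k. x k a a)"
proof -
  have "mtrace (blockmat x) = (\<Sum>i<d. blockmat x $$ (i, i))"
    using blockmat_carrier[of x] by (simp add: mtrace_def)
  also have "\<dots> = (\<Sum>p<d. core x $$ (p, p))"
  proof -
    have "(\<Sum>p<d. core x $$ (p, p)) = (\<Sum>p<d. \<Sum>i<d. \<Sum>j<d. blockmat x $$ (i, j) * (U $$ (j, p) * cnj (U $$ (i, p))))"
      by (intro sum.cong refl) (simp add: blockmat_coeff[symmetric] algebra_simps)
    also have "\<dots> = (\<Sum>i<d. \<Sum>j<d. \<Sum>p<d. blockmat x $$ (i, j) * (U $$ (j, p) * cnj (U $$ (i, p))))"
      by (rule sum_rotate3[symmetric])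
    also have "\<dots> = (\<Sum>i<d. \<Sum>j<d. blockmat x $$ (i, j) * (if j = i then 1 else 0))"
      by (intro sum.cong refl) (simp add: U_rows flip: sum_distrib_left)
    also have "\<dots> = (\<Sum>i<d. blockmat x $$ (i, i))" by (simp add: if_distrib sum.delta cong: if_cong)
    finally show ?thesis by simp
  qed
  also have "\<dots> = (\<Sum>k\<in>{1..K}. \<Sum>a<dk k. \<Sum>b<mk k. x k a a * \<omega> k $$ (b, b))"
    unfolding sum_pos by (simp add: core_entry core_entry_0 less_d)
  also have "\<dots> = (\<Sum>k\<in>{1..K}. \<Sum>a<dk k. x k a a)"
    by (intro sum.cong refl) (simp add: \<omega>_trace flip: sum_distrib_left)
  finally show ?thesis .
qed

end

section \<open>Encoders and decoders\<close>

lemma sum_bilinear: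
  fixes u v :: "_ \<Rightarrow> _ \<Rightarrow> complex"
  shows "(\<Sum>a\<in>A. \<Sum>b\<in>B. (\<Sum>q\<in>Q. u a q) * X a b * (\<Sum>r\<in>R. v b r))
    = (\<Sum>q\<in>Q. \<Sum>r\<in>R. \<Sum>a\<in>A. \<Sum>b\<in>B. u a q * X a b * v b r)"
proof -
  have "(\<Sum>a\<in>A. \<Sum>b\<in>B. (\<Sum>q\<in>Q. u a q) * X a b * (\<Sum>r\<in>R. v b r))
     = (\<Sum>a\<in>A. \<Sum>b\<in>B. \<Sum>q\<in>Q. \<Sum>r\<in>R. u a q * X a b * v b r)"
    by (simp add: sum_distrib_left sum_distrib_right, intro sum.cong refl sum.swap)
  also have "\<dots> = (\<Sum>q\<in>Q. \<Sum>a\<in>A. \<Sum>b\<in>B. \<Sum>r\<in>R. u a q * X a b * v b r)"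
    by (rule sum_rotate3)
  also have "\<dots> = (\<Sum>q\<in>Q. \<Sum>r\<in>R. \<Sum>a\<in>A. \<Sum>b\<in>B. u a q * X a b * v b r)"
    by (intro sum.cong refl sum_rotate3)
  finally show ?thesis .
qed

lemma sum_if_const: "(\<Sum>l\<in>S. if P then f l else 0) = (if P then \<Sum>l\<in>S. f l else 0)"
  by simp

text \<open>Injectivity leaves at most one index in each fibre of \<open>F\<close>, so the fibre
  sums have no cross terms. This is the completeness relation of the decoder in abstract
  form.\<close>

lemma sum_fibre_product:
  fixes s t :: "_ \<Rightarrow> complex"
  assumes "finite Z" "finite Q" "F ` Q \<subseteq> Z" "inj_on F Q"
  shows "(\<Sum>z\<in>Z. (\<Sum>q\<in>Q. if F q = z then s q else 0) * (\<Sum>q\<in>Q. if F q = z then t q else 0)) = (\<Sum>q\<in>Q. s q * t q)"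
proof -
  have "(\<Sum>z\<in>Z. (\<Sum>q\<in>Q. if F q = z then s q else 0) * (\<Sum>q\<in>Q. if F q = z then t q else 0))
     = (\<Sum>z\<in>Z. \<Sum>q\<in>Q. \<Sum>r\<in>Q. if F q = z then if F r = z then s q * t r else 0 else 0)"
    unfolding sum_product by (intro sum.cong refl) auto
  also have "\<dots> = (\<Sum>q\<in>Q. \<Sum>r\<in>Q. \<Sum>z\<in>Z. if F q = z then if F r = z then s q * t r else 0 else 0)"
    by (rule sum_rotate3[symmetric])
  also have "\<dots> = (\<Sum>q\<in>Q. \<Sum>r\<in>Q. if q = r then s q * t r else 0)"
  proof (intro sum.cong refl)
    fix q r assume qr: "q \<in> Q" "r \<in> Q"
    have "(\<Sum>z\<in>Z. if F q = z then if F r = z then s q * t r else 0 else 0) = (if F r = F q then s q * t r else 0)"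
      using assms(1,3) qr by (simp add: sum.delta image_subset_iff)
    then show "(\<Sum>z\<in>Z. if F q = z then if F r = z then s q * t r else 0 else 0) = (if q = r then s q * t r else 0)"
      using assms(4) qr by (auto simp: inj_on_def)
  qed
  also have "\<dots> = (\<Sum>q\<in>Q. s q * t q)" using assms(2) by simp
  finally show ?thesis .
qed

definition kraus_map :: "'l set \<Rightarrow> ('l \<Rightarrow> nat \<Rightarrow> nat \<Rightarrow> complex) \<Rightarrow> nat \<Rightarrow> nat \<Rightarrow> complex mat \<Rightarrow> complex mat" where
  "kraus_map I A n m X = mat m m (\<lambda>(i, j). \<Sum>l\<in>I. \<Sum>a<n. \<Sum>b<n. A l i a * X $$ (a, b) * cnj (A l j b))"

lemma kraus_map_munit:
  assumes "a < n" "b < n" "i < m" "j < m"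
  shows "kraus_map I A n m (munit n a b) $$ (i, j) = (\<Sum>l\<in>I. A l i a * cnj (A l j b))"
proof -
  have "kraus_map I A n m (munit n a b) $$ (i, j)
     = (\<Sum>l\<in>I. \<Sum>a'<n. \<Sum>b'<n. A l i a' * munit n a b $$ (a', b') * cnj (A l j b'))"
    using assms(3,4) by (simp add: kraus_map_def)
  also have "\<dots> = (\<Sum>l\<in>I. \<Sum>a'<n. \<Sum>b'<n. if b' = b then if a' = a then A l i a * cnj (A l j b) else 0 else 0)"
    by (intro sum.cong refl) (auto simp: munit_def)
  also have "\<dots> = (\<Sum>l\<in>I. A l i a * cnj (A l j b))" using assms by simp
  finally show ?thesis .
qed

context block_decomposition
begin

text \<open>Rotate by the adjoint of \<open>U\<close>, relabel coordinate \<open>q\<close> as the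
  pair (f q, g q), discard the first component and output the second. The Kraus operator for
  \<open>l\<close> is the sum of |g q><u_q| over f q = l, where u_q is column \<open>q\<close> of
  \<open>U\<close>.\<close>

definition decoder :: "nat \<Rightarrow> (nat \<Rightarrow> nat) \<Rightarrow> (nat \<Rightarrow> nat) \<Rightarrow> complex mat \<Rightarrow> complex mat" where
  "decoder D f g = kraus_map (f ` {..<d}) (\<lambda>l i a. \<Sum>q<d. if (f q, g q) = (l, i) then cnj (U $$ (a, q)) else 0) d D"

lemma decoder_channel:
  assumes g: "\<And>q. q < d \<Longrightarrow> g q < D" and inj: "inj_on (\<lambda>q. (f q, g q)) {..<d}"
  shows "channel d D (decoder D f g)"
proof (rule kraus_channel)
  show "finite (f ` {..<d})" by simp
  show "decoder D f g X = mat D D (\<lambda>(i, j). \<Sum>l\<in>f ` {..<d}. \<Sum>a<d. \<Sum>b<d.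
     (\<Sum>q<d. if (f q, g q) = (l, i) then cnj (U $$ (a, q)) else 0) * X $$ (a, b) *
     cnj (\<Sum>q<d. if (f q, g q) = (l, j) then cnj (U $$ (b, q)) else 0))" for X
    unfolding decoder_def kraus_map_def ..
  fix a b assume ab: "a < d" "b < d"
  let ?F = "\<lambda>q. (f q, g q)"
  have "(\<Sum>l\<in>f ` {..<d}. \<Sum>i<D. (\<Sum>q<d. if ?F q = (l, i) then cnj (U $$ (a, q)) else 0) *
       cnj (\<Sum>q<d. if ?F q = (l, i) then cnj (U $$ (b, q)) else 0))
     = (\<Sum>z\<in>f ` {..<d} \<times> {..<D}. (\<Sum>q<d. if ?F q = z then cnj (U $$ (a, q)) else 0) *
       (\<Sum>q<d. if ?F q = z then U $$ (b, q) else 0))"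
    unfolding sum.cartesian_product
    by (intro sum.cong refl) (auto simp: case_prod_beta if_distrib[of cnj] cong: if_cong)
  also have "\<dots> = (\<Sum>q<d. cnj (U $$ (a, q)) * U $$ (b, q))"
    by (rule sum_fibre_product) (use g inj in auto)
  also have "\<dots> = (if a = b then 1 else 0)"
    using U_rows[OF ab(2,1)] by (auto simp: mult.commute)
  finally show "(\<Sum>l\<in>f ` {..<d}. \<Sum>i<D. (\<Sum>q<d. if ?F q = (l, i) then cnj (U $$ (a, q)) else 0) *
       cnj (\<Sum>q<d. if ?F q = (l, i) then cnj (U $$ (b, q)) else 0)) = (if a = b then 1 else 0)" .
qed

text \<open>Discarding the label \<open>f\<close> keeps the coherence between two coordinates
  exactly when their labels agree.\<close>

lemma decoder_blockmat:
  assumes ij: "i < D" "j < D"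
  shows "decoder D f g (blockmat x) $$ (i, j)
    = (\<Sum>q<d. \<Sum>q'<d. core x $$ (q, q') * (if f q = f q' \<and> g q = i \<and> g q' = j then 1 else 0))"
proof -
  let ?u = "\<lambda>l i a q. if (f q, g q) = (l, i) then cnj (U $$ (a, q)) else 0"
  have "decoder D f g (blockmat x) $$ (i, j) = (\<Sum>l\<in>f ` {..<d}. \<Sum>a<d. \<Sum>b<d.
      (\<Sum>q<d. ?u l i a q) * blockmat x $$ (a, b) * (\<Sum>q<d. cnj (?u l j b q)))"
    using ij unfolding decoder_def kraus_map_def by simp
  also have "\<dots> = (\<Sum>l\<in>f ` {..<d}. \<Sum>q<d. \<Sum>q'<d. \<Sum>a<d. \<Sum>b<d.
      ?u l i a q * blockmat x $$ (a, b) * cnj (?u l j b q'))"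
    unfolding sum_bilinear ..
  also have "\<dots> = (\<Sum>l\<in>f ` {..<d}. \<Sum>q<d. \<Sum>q'<d.
      if f q = l then core x $$ (q, q') * (if f q = f q' \<and> g q = i \<and> g q' = j then 1 else 0) else 0)"
  proof (intro sum.cong refl)
    fix l q q' assume "q \<in> {..<d}" "q' \<in> {..<d}"
    then have "(\<Sum>a<d. \<Sum>b<d. cnj (U $$ (a, q)) * blockmat x $$ (a, b) * U $$ (b, q')) = core x $$ (q, q')"
      by (intro blockmat_coeff) auto
    then show "(\<Sum>a<d. \<Sum>b<d. ?u l i a q * blockmat x $$ (a, b) * cnj (?u l j b q'))
      = (if f q = l then core x $$ (q, q') * (if f q = f q' \<and> g q = i \<and> g q' = j then 1 else 0) else 0)"
      by auto
  qed
  also have "\<dots> = (\<Sum>q<d. \<Sum>q'<d. \<Sum>l\<in>f ` {..<d}.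
      if f q = l then core x $$ (q, q') * (if f q = f q' \<and> g q = i \<and> g q' = j then 1 else 0) else 0)"
    by (rule sum_rotate3[symmetric])
  also have "\<dots> = (\<Sum>q<d. \<Sum>q'<d. core x $$ (q, q') * (if f q = f q' \<and> g q = i \<and> g q' = j then 1 else 0))"
    by (intro sum.cong refl) (simp add: sum.delta)
  finally show ?thesis .
qed

lemma omega_gram_exists:
  "\<exists>W. \<forall>k\<in>{1..K}. \<forall>b<mk k. \<forall>b'<mk k. \<omega> k $$ (b, b') = (\<Sum>l<mk k. W k b l * cnj (W k b' l))"
proof -
  have "\<exists>W. \<forall>b<mk k. \<forall>b'<mk k. \<omega> k $$ (b, b') = (\<Sum>l<mk k. W b l * cnj (W b' l))" if "k \<in> {1..K}" for k
    using psd_on_gram_exists[OF _ \<omega>_psd[OF that]] by auto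
  then show ?thesis by metis
qed

text \<open>\<open>\<kappa>\<close> and \<open>\<alpha>\<close> give the block and the level at
  which a basis vector is stored; \<open>\<gamma>\<close> is a label leaked to the environment, so
  that coherence survives only between equal labels. Equal labels must mean the same block and, for
  trace preservation, distinct levels; different labels may reuse a level. An injective
  \<open>\<gamma>\<close> gives a classical encoder, one that is constant on the first d_k vectors a
  quantum encoder.\<close>

lemma encoder_exists:
  assumes \<kappa>: "\<And>c. c < D \<Longrightarrow> \<kappa> c \<in> {1..K}" and \<alpha>: "\<And>c. c < D \<Longrightarrow> \<alpha> c < dk (\<kappa> c)"
    and \<gamma>\<kappa>: "\<And>c c'. c < D \<Longrightarrow> c' < D \<Longrightarrow> \<gamma> c = \<gamma> c' \<Longrightarrow> \<kappa> c = \<kappa> c'"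
    and \<gamma>\<alpha>: "\<And>c c'. c < D \<Longrightarrow> c' < D \<Longrightarrow> \<gamma> c = \<gamma> c' \<Longrightarrow> \<alpha> c = \<alpha> c' \<Longrightarrow> c = c'"
  shows "\<exists>E. channel D d E \<and> (\<forall>c<D. \<forall>c'<D. E (munit D c c') =
     blockmat (if \<gamma> c = \<gamma> c' then unit_kernel (\<kappa> c) (\<alpha> c) (\<alpha> c') else (\<lambda>_ _ _. 0)))"
proof -
  obtain W where W: "\<And>k b b'. k \<in> {1..K} \<Longrightarrow> b < mk k \<Longrightarrow> b' < mk k \<Longrightarrow>
      \<omega> k $$ (b, b') = (\<Sum>l<mk k. W k b l * cnj (W k b' l))"
    using omega_gram_exists by blast
  define I where "I = \<gamma> ` {..<D} \<times> (SIGMA k:{1..K}. {..<mk k})"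
  \<comment> \<open>Kraus operator (g, k, l) sends |c> to level \<open>\<alpha> c\<close> of block
    \<open>k\<close>, tensored with column \<open>l\<close> of a Gram factor of \<omega>_k, if
    \<open>c\<close> has label \<open>g\<close> and block \<open>k\<close>. Summing over
    \<open>l\<close> creates \<omega>_k.\<close>
  define A where "A = (\<lambda>(g, k, l) p c. if \<gamma> c = g \<and> \<kappa> c = k
      then \<Sum>b<mk k. W k b l * U $$ (p, pos k (\<alpha> c) b) else 0)"
  define x where "x = (\<lambda>c c'. if \<gamma> c = \<gamma> c' then unit_kernel (\<kappa> c) (\<alpha> c) (\<alpha> c') else (\<lambda>_ _ _. 0))"
  have fin: "finite I" by (simp add: I_def)
  have key: "(\<Sum>z\<in>I. A z p c * cnj (A z p' c')) = blockmat (x c c') $$ (p, p')"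
    if c: "c < D" "c' < D" and p: "p < d" "p' < d" for c c' p p'
  proof -
    let ?k = "\<kappa> c"
    let ?B = "\<lambda>k l p c. \<Sum>b<mk k. W k b l * U $$ (p, pos k (\<alpha> c) b)"
    have "(\<Sum>z\<in>I. A z p c * cnj (A z p' c'))
        = (\<Sum>g\<in>\<gamma> ` {..<D}. \<Sum>w\<in>(SIGMA k:{1..K}. {..<mk k}). A (g, w) p c * cnj (A (g, w) p' c'))"
      unfolding I_def by (simp add: sum.cartesian_product)
    also have "\<dots> = (\<Sum>g\<in>\<gamma> ` {..<D}. \<Sum>k\<in>{1..K}. \<Sum>l<mk k. A (g, k, l) p c * cnj (A (g, k, l) p' c'))"
      by (intro sum.cong[OF refl], subst sum.Sigma) (auto intro!: sum.cong)
    also have "\<dots> = (\<Sum>g\<in>\<gamma> ` {..<D}. \<Sum>k\<in>{1..K}. \<Sum>l<mk k.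
        if g = \<gamma> c then if k = ?k then if \<gamma> c = \<gamma> c' then ?B k l p c * cnj (?B k l p' c') else 0 else 0 else 0)"
      using \<gamma>\<kappa>[OF c] by (intro sum.cong refl) (auto simp: A_def)
    also have "\<dots> = (\<Sum>g\<in>\<gamma> ` {..<D}. if g = \<gamma> c then \<Sum>k\<in>{1..K}. if k = ?k then
        (\<Sum>l<mk k. if \<gamma> c = \<gamma> c' then ?B k l p c * cnj (?B k l p' c') else 0) else 0 else 0)"
      by (simp only: sum_if_const)
    also have "\<dots> = (\<Sum>l<mk ?k. if \<gamma> c = \<gamma> c' then ?B ?k l p c * cnj (?B ?k l p' c') else 0)"
      using c \<kappa>[OF c(1)] by simp
    also have "\<dots> = blockmat (x c c') $$ (p, p')"
    proof (cases "\<gamma> c = \<gamma> c'")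
      case False
      then show ?thesis using p by (simp add: x_def blockmat_entry)
    next
      case True
      then have a': "\<alpha> c' < dk ?k" using \<alpha>[OF c(2)] \<gamma>\<kappa>[OF c] by simp
      have "(\<Sum>l<mk ?k. ?B ?k l p c * cnj (?B ?k l p' c'))
         = (\<Sum>l<mk ?k. \<Sum>b<mk ?k. \<Sum>b'<mk ?k. (W ?k b l * cnj (W ?k b' l)) *
             (U $$ (p, pos ?k (\<alpha> c) b) * cnj (U $$ (p', pos ?k (\<alpha> c') b'))))"
        by (simp add: sum_product algebra_simps)
      also have "\<dots> = (\<Sum>b<mk ?k. \<Sum>b'<mk ?k. \<Sum>l<mk ?k. (W ?k b l * cnj (W ?k b' l)) *
             (U $$ (p, pos ?k (\<alpha> c) b) * cnj (U $$ (p', pos ?k (\<alpha> c') b'))))"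
        by (rule sum_rotate3[symmetric])
      also have "\<dots> = (\<Sum>b<mk ?k. \<Sum>b'<mk ?k. \<omega> ?k $$ (b, b') *
             (U $$ (p, pos ?k (\<alpha> c) b) * cnj (U $$ (p', pos ?k (\<alpha> c') b'))))"
        using \<kappa>[OF c(1)] by (intro sum.cong refl) (simp add: W sum_distrib_right)
      also have "\<dots> = blockmat (unit_kernel ?k (\<alpha> c) (\<alpha> c')) $$ (p, p')"
        by (rule blockmat_unit_entry[OF p \<kappa>[OF c(1)] \<alpha>[OF c(1)] a', symmetric])
      finally show ?thesis using True by (simp add: x_def)
    qed
    finally show ?thesis .
  qed
  \<comment> \<open>These traces are the completeness sums of the Kraus operators, so this is trace
    preservation.\<close>
  have tr: "mtrace (blockmat (x c c')) = (if c = c' then 1 else 0)" if c: "c < D" "c' < D" for c c'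
  proof (cases "\<gamma> c = \<gamma> c'")
    case False
    then show ?thesis by (auto simp: blockmat_trace x_def)
  next
    case True
    have "mtrace (blockmat (x c c')) = (\<Sum>k\<in>{1..K}. \<Sum>a<dk k. if a = \<alpha> c then if k = \<kappa> c \<and> a = \<alpha> c' then 1 else 0 else 0)"
      using True unfolding blockmat_trace x_def unit_kernel_def by (intro sum.cong refl) auto
    also have "\<dots> = (\<Sum>k\<in>{1..K}. if k = \<kappa> c then if \<alpha> c = \<alpha> c' then 1 else 0 else 0)"
      using \<alpha>[OF c(1)] by (intro sum.cong refl) (auto simp: sum.delta)
    also have "\<dots> = (if \<alpha> c = \<alpha> c' then 1 else 0)" using \<kappa>[OF c(1)] by simp
    finally show ?thesis using \<gamma>\<alpha>[OF c True] by auto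
  qed
  let ?E = "kraus_map I A D d"
  have "channel D d ?E"
  proof (rule kraus_channel[OF fin])
    show "?E X = mat d d (\<lambda>(i, j). \<Sum>l\<in>I. \<Sum>a<D. \<Sum>b<D. A l i a * X $$ (a, b) * cnj (A l j b))" for X
      unfolding kraus_map_def ..
    fix a b assume ab: "a < D" "b < D"
    have "(\<Sum>l\<in>I. \<Sum>i<d. A l i a * cnj (A l i b)) = (\<Sum>i<d. blockmat (x a b) $$ (i, i))"
      by (subst sum.swap) (simp add: key ab)
    also have "\<dots> = mtrace (blockmat (x a b))" using blockmat_carrier[of "x a b"] by (simp add: mtrace_def)
    finally show "(\<Sum>l\<in>I. \<Sum>i<d. A l i a * cnj (A l i b)) = (if a = b then 1 else 0)" using tr[OF ab] by simp
  qed
  moreover have "?E (munit D c c') = blockmat (x c c')" if "c < D" "c' < D" for c c'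
  proof (rule eq_matI)
    show "dim_row (?E (munit D c c')) = dim_row (blockmat (x c c'))" "dim_col (?E (munit D c c')) = dim_col (blockmat (x c c'))"
      using blockmat_carrier[of "x c c'"] by (auto simp: kraus_map_def)
    fix i j assume "i < dim_row (blockmat (x c c'))" "j < dim_col (blockmat (x c c'))"
    then have "i < d" "j < d" using blockmat_carrier[of "x c c'"] by auto
    then show "?E (munit D c c') $$ (i, j) = blockmat (x c c') $$ (i, j)"
      using that by (simp add: kraus_map_munit key)
  qed
  ultimately show ?thesis unfolding x_def by blast
qed

text \<open>When the discarded label records exactly the second tensor coordinate \<open>b\<close>,
  what remains is the trace of \<omega>_k, so the coherence between levels \<open>a\<close> and
  \<open>a'\<close> is returned without loss.\<close>

lemma decoder_unit:
  assumes "k \<in> {1..K}" "a < dk k" "a' < dk k" "i < D" "j < D"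
    and f: "\<And>b b'. b < mk k \<Longrightarrow> b' < mk k \<Longrightarrow> f (pos k a b) = f (pos k a' b') \<longleftrightarrow> b = b'"
    and g: "\<And>b. b < mk k \<Longrightarrow> g (pos k a b) = i" "\<And>b. b < mk k \<Longrightarrow> g (pos k a' b) = j"
  shows "decoder D f g (blockmat (unit_kernel k a a')) $$ (i, j) = 1"
proof -
  have "decoder D f g (blockmat (unit_kernel k a a')) $$ (i, j)
     = (\<Sum>b<mk k. \<Sum>b'<mk k. if b = b' then \<omega> k $$ (b, b') else 0)"
    unfolding decoder_blockmat[OF assms(4,5)] core_sum_unit[OF assms(1-3)]
    using f g by (intro sum.cong refl) auto
  also have "\<dots> = 1" using \<omega>_trace[OF assms(1)] by simp
  finally show ?thesis .
qed

end

section \<open>Entanglement fidelity in matrix units, and stability under perturbation\<close>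

lemma max_ent_index:
  fixes i a D :: nat
  assumes "i < D" "a < D"
  shows "(i * D + a) mod (D + 1) = 0 \<longleftrightarrow> a = i"
proof (cases "i \<le> a")
  case True
  \<comment> \<open>The diagonal positions i * D + i are multiples of D + 1, and
    \<open>a - i\<close> is the distance from such a multiple.\<close>
  then have "i * D + a = i * (D + 1) + (a - i)" by simp
  then have "(i * D + a) mod (D + 1) = (a - i) mod (D + 1)" by (metis mod_mult_self3)
  also have "\<dots> = a - i" using assms by simp
  finally show ?thesis using True by simp
next
  case False
  then obtain i' where i: "i = Suc i'" by (cases i) auto
  \<comment> \<open>For a < i the difference would be truncated, so one multiple less is taken; the
    remainder then lies strictly between 0 and D + 1.\<close>
  have "i * D + a = i' * (D + 1) + (D + a - i')" using False i assms by (simp add: algebra_simps)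
  then have "(i * D + a) mod (D + 1) = (D + a - i') mod (D + 1)" by (metis mod_mult_self3)
  also have "\<dots> = D + a - i'" using False i assms by (intro mod_less) simp
  finally show ?thesis using False i assms by simp
qed

text \<open>One factor 1/D comes from the state itself, the other from evaluating against
  |Phi+>.\<close>

lemma max_ent_fidelity:
  assumes ch: "channel D D \<Phi>"
  shows "(let Y = ampl D D D \<Phi> (max_ent D) in
      Re ((1 / of_nat D) * (\<Sum>i<D. \<Sum>j<D. Y $$ (i * D + i, j * D + j))))
    = (1 / (real D)\<^sup>2) * (\<Sum>i<D. \<Sum>j<D. Re (\<Phi> (munit D i j) $$ (i, j)))"
proof -
  have e: "ampl D D D \<Phi> (max_ent D) $$ (i * D + i, j * D + j) = (1 / of_nat D) * \<Phi> (munit D i j) $$ (i, j)"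
    if ij: "i < D" "j < D" for i j
  proof -
    have "mat D D (\<lambda>(a, b). max_ent D $$ (i * D + a, j * D + b)) = (1 / of_nat D) \<cdot>\<^sub>m munit D i j"
    proof (rule eq_matI)
      fix a b assume "a < dim_row ((1 / of_nat D :: complex) \<cdot>\<^sub>m munit D i j)" "b < dim_col ((1 / of_nat D :: complex) \<cdot>\<^sub>m munit D i j)"
      then have ab: "a < D" "b < D" by (auto simp: munit_def)
      then show "mat D D (\<lambda>(a, b). max_ent D $$ (i * D + a, j * D + b)) $$ (a, b) = ((1 / of_nat D) \<cdot>\<^sub>m munit D i j) $$ (a, b)"
        using ij max_ent_index[OF ij(1) ab(1)] max_ent_index[OF ij(2) ab(2)]
        by (simp add: max_ent_def munit_def block_index_less del: One_nat_def)
    qed (auto simp: munit_def)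
    then show ?thesis
      using ij channel_carrier[OF ch, of "munit D i j"]
      by (simp add: ampl_def block_index_less channel_smult[OF ch])
  qed
  have "(\<Sum>i<D. \<Sum>j<D. ampl D D D \<Phi> (max_ent D) $$ (i * D + i, j * D + j))
      = (1 / of_nat D) * (\<Sum>i<D. \<Sum>j<D. \<Phi> (munit D i j) $$ (i, j))"
    by (simp add: e sum_distrib_left)
  moreover have "Re ((1 / of_nat D) * ((1 / of_nat D) * z)) = (1 / (real D)\<^sup>2) * Re z" for z
    by (simp add: power2_eq_square)
  ultimately show ?thesis unfolding Let_def by (simp only: Re_sum)
qed

lemma munit_psd: "psd n (munit n a a)"
proof -
  have "psd_on {..<n} (\<lambda>p q. munit n a a $$ (p, q))"
    by (rule psd_on_gram[where I = "{()}" and W = "\<lambda>p _. if p = a then 1 else 0"]) (auto simp: munit_def)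
  then show ?thesis by (simp add: psd_iff_psd_on)
qed

lemma channel_diag_nonneg:
  assumes ch: "channel n m \<Phi>" and "a < n" "i < m"
  shows "0 \<le> Re (\<Phi> (munit n a a) $$ (i, i))"
proof -
  have "psd_on {..<m} (\<lambda>p q. \<Phi> (munit n a a) $$ (p, q))"
    using channel_psd[OF ch munit_psd[of n a]] by (simp add: psd_iff_psd_on)
  from psd_on_diag(2)[OF this, of i] show ?thesis using assms(3) by simp
qed

text \<open>Two expansions in matrix units, of the encoder's output and of the decoder's argument,
  with d^2 terms each and factors bounded by 1; hence d^4 and no trace of \<open>D\<close>.\<close>

lemma channel_perturb:
  assumes E: "channel D d E" and R: "channel d D R" and A: "channel d d A" and B: "channel d d B"
    and eps: "\<And>a b p q. a < d \<Longrightarrow> b < d \<Longrightarrow> p < d \<Longrightarrow> q < d \<Longrightarrow>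
      cmod (A (munit d a b) $$ (p, q) - B (munit d a b) $$ (p, q)) \<le> \<epsilon>"
    and c: "c < D" "c' < D" and ij: "i < D" "j < D"
  shows "Re (R (A (E (munit D c c'))) $$ (i, j)) \<le> Re (R (B (E (munit D c c'))) $$ (i, j)) + real d ^ 4 * \<epsilon>"
proof -
  define Y where "Y = E (munit D c c')"
  have Yc: "Y \<in> carrier_mat d d" unfolding Y_def by (rule channel_carrier[OF E]) simp
  note AY = channel_carrier[OF A Yc] and BY = channel_carrier[OF B Yc]
  have diff: "cmod (A Y $$ (p, q) - B Y $$ (p, q)) \<le> (real d)\<^sup>2 * \<epsilon>" if pq: "p < d" "q < d" for p q
  proof -
    have "A Y $$ (p, q) - B Y $$ (p, q)
       = (\<Sum>a<d. \<Sum>b<d. Y $$ (a, b) * (A (munit d a b) $$ (p, q) - B (munit d a b) $$ (p, q)))"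
      unfolding channel_expand[OF A Yc pq] channel_expand[OF B Yc pq]
      by (simp add: sum_subtractf right_diff_distrib)
    also have "cmod \<dots> \<le> (\<Sum>a<d. \<Sum>b<d. \<epsilon>)"
    proof (intro sum_norm_le)
      fix a b assume ab: "a \<in> {..<d}" "b \<in> {..<d}"
      then have "cmod (Y $$ (a, b)) \<le> 1" unfolding Y_def using channel_unit_bound[OF E c] by simp
      then have "cmod (Y $$ (a, b)) * cmod (A (munit d a b) $$ (p, q) - B (munit d a b) $$ (p, q)) \<le> 1 * \<epsilon>"
        using eps[of a b p q] ab pq by (intro mult_mono) auto
      then show "cmod (Y $$ (a, b) * (A (munit d a b) $$ (p, q) - B (munit d a b) $$ (p, q))) \<le> \<epsilon>"
        by (simp add: norm_mult)
    qed
    finally show ?thesis by (simp add: power2_eq_square algebra_simps)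
  qed
  have "R (A Y) $$ (i, j) - R (B Y) $$ (i, j)
     = (\<Sum>p<d. \<Sum>q<d. (A Y $$ (p, q) - B Y $$ (p, q)) * R (munit d p q) $$ (i, j))"
    unfolding channel_expand[OF R AY ij] channel_expand[OF R BY ij]
    by (simp add: sum_subtractf left_diff_distrib)
  also have "cmod \<dots> \<le> (\<Sum>p<d. \<Sum>q<d. (real d)\<^sup>2 * \<epsilon>)"
  proof (intro sum_norm_le)
    fix p q assume pq: "p \<in> {..<d}" "q \<in> {..<d}"
    then have "cmod (R (munit d p q) $$ (i, j)) \<le> 1" using channel_unit_bound[OF R _ _ ij] by simp
    then have "cmod (A Y $$ (p, q) - B Y $$ (p, q)) * cmod (R (munit d p q) $$ (i, j)) \<le> (real d)\<^sup>2 * \<epsilon> * 1"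
      using diff[of p q] pq by (intro mult_mono) (auto intro: order_trans[OF norm_ge_zero])
    then show "cmod ((A Y $$ (p, q) - B Y $$ (p, q)) * R (munit d p q) $$ (i, j)) \<le> (real d)\<^sup>2 * \<epsilon>"
      by (simp add: norm_mult)
  qed
  also have "\<dots> = real d ^ 4 * \<epsilon>" by (simp add: power2_eq_square power4_eq_xxxx algebra_simps)
  finally have "cmod (R (A Y) $$ (i, j) - R (B Y) $$ (i, j)) \<le> real d ^ 4 * \<epsilon>" .
  then show ?thesis
    using complex_Re_le_cmod[of "R (A Y) $$ (i, j) - R (B Y) $$ (i, j)"] unfolding Y_def by simp
qed

section \<open>Explicit codes for maps that can be undone on the block algebra\<close>

context block_decomposition
begin

text \<open>The basis levels of all blocks carry \<Sum>d_k messages without error. The surplus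
  messages of a larger code reuse one of these states and are not counted on, which leaves a success
  of at least \<Sum>d_k / D.\<close>

lemma classical_code_exists:
  assumes A: "channel d d A" and S: "channel d d S" and SA: "\<And>x. S (A (blockmat x)) = blockmat x"
    and N: "1 \<le> (\<Sum>k\<in>{1..K}. dk k)" "(\<Sum>k\<in>{1..K}. dk k) \<le> D"
    and \<delta>: "(1 - \<delta>) * real D \<le> real (\<Sum>k\<in>{1..K}. dk k)"
  shows "\<exists>E. classical_code d A D \<delta> E"
proof -
  let ?N = "\<Sum>k\<in>{1..K}. dk k"
  let ?\<Sigma> = "SIGMA k:{1..K}. {..<dk k}"
  have card: "card ?\<Sigma> = ?N" by simp
  obtain h where h: "bij_betw h {0..<?N} ?\<Sigma>"
    using ex_bij_betw_nat_finite[of ?\<Sigma>] unfolding card by auto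
  \<comment> \<open>A message beyond \<open>?N\<close> is stored like message 0.\<close>
  define \<kappa> where "\<kappa> = (\<lambda>c. fst (h (if c < ?N then c else 0)))"
  define \<alpha> where "\<alpha> = (\<lambda>c. snd (h (if c < ?N then c else 0)))"
  have mem: "h (if c < ?N then c else 0) \<in> ?\<Sigma>" for c
    using bij_betwE[OF h] N(1) by (auto simp: Suc_le_eq)
  have \<kappa>: "\<kappa> c \<in> {1..K}" and \<alpha>: "\<alpha> c < dk (\<kappa> c)" for c
    using mem[of c] unfolding \<kappa>_def \<alpha>_def by (auto simp only: mem_Sigma_iff split_pairs lessThan_iff fst_conv snd_conv)
  have inj: "c = c'" if "c < ?N" "c' < ?N" "\<kappa> c = \<kappa> c'" "\<alpha> c = \<alpha> c'" for c c'
  proof -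
    have "h c = h c'" using that by (simp add: \<kappa>_def \<alpha>_def prod_eq_iff)
    then show ?thesis using inj_onD[OF bij_betw_imp_inj_on[OF h]] that by simp
  qed
  obtain E where E: "channel D d E"
    and Eu: "\<And>c c'. c < D \<Longrightarrow> c' < D \<Longrightarrow> E (munit D c c') =
      blockmat (if c = c' then unit_kernel (\<kappa> c) (\<alpha> c) (\<alpha> c') else (\<lambda>_ _ _. 0))"
  proof -
    have "\<exists>E. channel D d E \<and> (\<forall>c<D. \<forall>c'<D. E (munit D c c') =
        blockmat (if c = c' then unit_kernel (\<kappa> c) (\<alpha> c) (\<alpha> c') else (\<lambda>_ _ _. 0)))"
      by (rule encoder_exists[of D \<kappa> \<alpha> "\<lambda>c. c", OF \<kappa> \<alpha>]) simp_all
    then show ?thesis using that by blast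
  qed
  \<comment> \<open>\<open>P q c\<close> says that coordinate \<open>q\<close> belongs to the level
    used by message \<open>c\<close>. Coordinates that belong to no message are decoded as
    0.\<close>
  define P where "P = (\<lambda>q c. c < ?N \<and> (\<exists>b<mk (\<kappa> c). q = pos (\<kappa> c) (\<alpha> c) b))"
  define g where "g = (\<lambda>q. if \<exists>c. P q c then THE c. P q c else 0)"
  have uniq: "c = c'" if "P q c" "P q c'" for q c c'
  proof -
    obtain b b' where b: "b < mk (\<kappa> c)" "q = pos (\<kappa> c) (\<alpha> c) b" "b' < mk (\<kappa> c')" "q = pos (\<kappa> c') (\<alpha> c') b'"
      using \<open>P q c\<close> \<open>P q c'\<close> unfolding P_def by blast
    then have "\<kappa> c = \<kappa> c'" "\<alpha> c = \<alpha> c'"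
      using pos_eq_iff[OF \<kappa>[of c] \<alpha>[of c] b(1) \<kappa>[of c'] \<alpha>[of c'] b(3)] by auto
    moreover have "c < ?N" using that(1) unfolding P_def by (rule conjunct1)
    moreover have "c' < ?N" using that(2) unfolding P_def by (rule conjunct1)
    ultimately show ?thesis using inj by blast
  qed
  have gP: "g q = c" if "P q c" for q c
  proof -
    have "(THE c. P q c) = c" using that uniq by (intro the_equality) blast+
    then show ?thesis using that unfolding g_def by auto
  qed
  have gD: "g q < D" for q
  proof (cases "\<exists>c. P q c")
    case True
    then obtain c where "P q c" by blast
    then show ?thesis using gP[of q c] N(2) by (auto simp: P_def)
  next
    case False
    then have "g q = 0" unfolding g_def by (rule if_not_P)
    then show ?thesis using N by simp
  qed
  \<comment> \<open>With the identity as discarded label the decoder measures every coordinate,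
    which costs nothing for classical messages.\<close>
  define R0 where "R0 = decoder D (\<lambda>q. q) g"
  have R0: "channel d D R0" unfolding R0_def by (rule decoder_channel) (auto simp: gD inj_on_def)
  have R: "channel d D (R0 \<circ> S)" by (rule channel_comp[OF S R0])
  have \<Phi>: "channel D D ((R0 \<circ> S) \<circ> (A \<circ> E))" by (rule channel_comp[OF channel_comp[OF E A] R])
  have val: "(R0 \<circ> S) (A (E (munit D c c))) $$ (c, c) = 1" if c: "c < ?N" for c
  proof -
    have cD: "c < D" using c N(2) by simp
    have "(R0 \<circ> S) (A (E (munit D c c))) = R0 (blockmat (unit_kernel (\<kappa> c) (\<alpha> c) (\<alpha> c)))"
      by (simp add: Eu[OF cD cD] SA)
    moreover have "R0 (blockmat (unit_kernel (\<kappa> c) (\<alpha> c) (\<alpha> c))) $$ (c, c) = 1"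
      unfolding R0_def
    proof (rule decoder_unit[OF \<kappa> \<alpha> \<alpha> cD cD])
      show "(pos (\<kappa> c) (\<alpha> c) b = pos (\<kappa> c) (\<alpha> c) b') = (b = b')" if "b < mk (\<kappa> c)" "b' < mk (\<kappa> c)" for b b'
        using pos_eq_iff[OF \<kappa> \<alpha> that(1) \<kappa> \<alpha> that(2)] by simp
      show "g (pos (\<kappa> c) (\<alpha> c) b) = c" if "b < mk (\<kappa> c)" for b
        using that c by (intro gP) (auto simp: P_def)
      then show "g (pos (\<kappa> c) (\<alpha> c) b) = c" if "b < mk (\<kappa> c)" for b using that .
    qed
    ultimately show ?thesis by simp
  qed
  have "(\<Sum>c<?N. Re ((R0 \<circ> S) (A (E (munit D c c))) $$ (c, c))) = (\<Sum>c<?N. 1)"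
  proof (intro sum.cong refl)
    fix c assume "c \<in> {..<?N}"
    then have "c < ?N" by auto
    from val[OF this] show "Re ((R0 \<circ> S) (A (E (munit D c c))) $$ (c, c)) = 1" by (simp only: one_complex.sel)
  qed
  then have "real ?N = (\<Sum>c<?N. Re ((R0 \<circ> S) (A (E (munit D c c))) $$ (c, c)))" by simp
  also have "\<dots> \<le> (\<Sum>c<D. Re ((R0 \<circ> S) (A (E (munit D c c))) $$ (c, c)))"
    using N(2) channel_diag_nonneg[OF \<Phi>] by (intro sum_mono2) auto
  finally have "(1 - \<delta>) * real D \<le> (\<Sum>c<D. Re ((R0 \<circ> S) (A (E (munit D c c))) $$ (c, c)))" using \<delta> by simp
  then have "1 - \<delta> \<le> (1 / real D) * (\<Sum>c<D. Re ((R0 \<circ> S) (A (E (munit D c c))) $$ (c, c)))"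
    using N by (simp add: field_simps)
  then have "classical_code d A D \<delta> E"
    unfolding classical_code_def basis_proj_eq_munit by (intro conjI exI[of _ "R0 \<circ> S"] E R)
  then show ?thesis by (intro exI[of _ E])
qed

text \<open>All matrix units on the first M = d_k basis vectors are transmitted exactly and the
  other terms of the fidelity sum are nonnegative. This gives fidelity at least (M / D)^2, the
  source of the square root in the lower bound.\<close>

lemma quantum_code_exists:
  assumes A: "channel d d A" and S: "channel d d S" and SA: "\<And>x. S (A (blockmat x)) = blockmat x"
    and k: "k \<in> {1..K}" and M: "1 \<le> dk k" "dk k \<le> D"
    and \<delta>: "(1 - \<delta>) * (real D)\<^sup>2 \<le> (real (dk k))\<^sup>2"
  shows "\<exists>E. quantum_code d A D \<delta> E"
proof -
  let ?M = "dk k" and ?m = "mk k" and ?o = "block_off d0 dk mk k"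
  \<comment> \<open>The first \<open>?M\<close> vectors share label 0 and stay coherent; each later
    one has a nonzero label of its own and is stored at level 0.\<close>
  define \<gamma> where "\<gamma> = (\<lambda>c. if c < ?M then 0 else c)"
  define \<alpha> where "\<alpha> = (\<lambda>c. if c < ?M then c else 0)"
  obtain E where E: "channel D d E"
    and Eu: "\<And>c c'. c < D \<Longrightarrow> c' < D \<Longrightarrow> E (munit D c c') =
      blockmat (if \<gamma> c = \<gamma> c' then unit_kernel k (\<alpha> c) (\<alpha> c') else (\<lambda>_ _ _. 0))"
  proof -
    have "\<alpha> c < ?M" for c using M by (simp add: \<alpha>_def)
    moreover have "c = c'" if "\<gamma> c = \<gamma> c'" "\<alpha> c = \<alpha> c'" for c c'
      using that M by (auto simp: \<alpha>_def \<gamma>_def split: if_splits)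
    ultimately show ?thesis using encoder_exists[of D "\<lambda>_. k" \<alpha> \<gamma>] k that by blast
  qed
  \<comment> \<open>Inside block \<open>k\<close> the coordinate \<open>?o + (a * ?m + b)\<close> is
    split into \<open>b\<close>, discarded, and \<open>a\<close>, kept. Adding \<open>?o\<close>
    keeps these labels within the range of the block, away from those of all other
    coordinates.\<close>
  define f where "f = (\<lambda>q. if ?o \<le> q \<and> q < ?o + ?M * ?m then ?o + (q - ?o) mod ?m else q)"
  define g where "g = (\<lambda>q. if ?o \<le> q \<and> q < ?o + ?M * ?m then (q - ?o) div ?m else 0)"
  have fpos: "f (pos k a b) = ?o + b" "g (pos k a b) = a" if "a < ?M" "b < ?m" for a b
    using block_index_less[OF that] that by (auto simp: f_def g_def block_pos_def)
  have gD: "g q < D" for q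
    using M by (auto simp: g_def less_mult_imp_div_less intro!: less_le_trans[OF _ M(2)])
  have range: "?o \<le> f q \<and> f q < ?o + ?M * ?m" if "?o \<le> q" "q < ?o + ?M * ?m" for q
  proof -
    have "0 < ?m" using that by (cases "?m = 0") auto
    then have "(q - ?o) mod ?m < ?m" by simp
    also have "?m \<le> ?M * ?m" using M(1) by simp
    finally show ?thesis using that by (simp add: f_def)
  qed
  have inj: "inj_on (\<lambda>q. (f q, g q)) {..<d}"
  proof (rule inj_onI)
    fix q q' assume e: "(f q, g q) = (f q', g q')"
    let ?in = "\<lambda>q. ?o \<le> q \<and> q < ?o + ?M * ?m"
    have iff: "?in (f q) \<longleftrightarrow> ?in q" for q using range[of q] by (auto simp: f_def)
    show "q = q'"
    proof (cases "?in q")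
      case False
      then have "\<not> ?in q'" using iff[of q] iff[of q'] e by simp
      then show ?thesis using False e by (auto simp: f_def split: if_splits)
    next
      case True
      then have "?in q'" using iff[of q] iff[of q'] e by simp
      then have "(q - ?o) mod ?m = (q' - ?o) mod ?m" "(q - ?o) div ?m = (q' - ?o) div ?m"
        using True e by (auto simp: f_def g_def)
      then have "q - ?o = q' - ?o" by (metis div_mult_mod_eq)
      then show ?thesis using True \<open>?in q'\<close> by linarith
    qed
  qed
  define R0 where "R0 = decoder D f g"
  have R0: "channel d D R0" unfolding R0_def by (rule decoder_channel[OF gD inj])
  have R: "channel d D (R0 \<circ> S)" by (rule channel_comp[OF S R0])
  let ?\<Phi> = "(R0 \<circ> S) \<circ> A \<circ> E"
  have \<Phi>: "channel D D ?\<Phi>" using channel_comp[OF channel_comp[OF E A] R] by (simp add: o_assoc)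
  have val: "?\<Phi> (munit D i j) $$ (i, j) = 1" if ij: "i < ?M" "j < ?M" for i j
  proof -
    have D: "i < D" "j < D" using ij M(2) by auto
    have "?\<Phi> (munit D i j) = R0 (blockmat (unit_kernel k i j))"
      using ij by (simp add: Eu[OF D] SA \<gamma>_def \<alpha>_def)
    moreover have "R0 (blockmat (unit_kernel k i j)) $$ (i, j) = 1"
      unfolding R0_def by (rule decoder_unit[OF k ij D]) (use ij in \<open>auto simp: fpos\<close>)
    ultimately show ?thesis by simp
  qed
  have nonneg: "0 \<le> Re (?\<Phi> (munit D i j) $$ (i, j))" if D: "i < D" "j < D" for i j
  proof -
    \<comment> \<open>Distinct \<open>i\<close> and \<open>j\<close> not both below
      \<open>?M\<close> carry different labels, so their coherence was destroyed and the entry is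
      0.\<close>
    consider "i = j" | "i < ?M" "j < ?M" | "\<gamma> i \<noteq> \<gamma> j" using M(1) unfolding \<gamma>_def by (cases "i < ?M"; cases "j < ?M") auto
    then show ?thesis
    proof cases
      case 1
      then show ?thesis using channel_diag_nonneg[OF \<Phi> D] by simp
    next
      case 2
      then show ?thesis by (simp only: val) simp
    next
      case 3
      then have "?\<Phi> (munit D i j) = R0 (blockmat (\<lambda>_ _ _. 0))" by (simp add: Eu[OF D] SA)
      then show ?thesis unfolding R0_def by (simp add: decoder_blockmat[OF D] core_sum)
    qed
  qed
  have "(\<Sum>i<?M. \<Sum>j<?M. Re (?\<Phi> (munit D i j) $$ (i, j))) = (\<Sum>i<?M. \<Sum>j<?M. 1)"
  proof (intro sum.cong refl)
    fix i j assume "i \<in> {..<?M}" "j \<in> {..<?M}"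
    then have "i < ?M" "j < ?M" by auto
    from val[OF this] show "Re (?\<Phi> (munit D i j) $$ (i, j)) = 1" by (simp only: one_complex.sel)
  qed
  then have "(real ?M)\<^sup>2 = (\<Sum>i<?M. \<Sum>j<?M. Re (?\<Phi> (munit D i j) $$ (i, j)))"
    by (simp add: power2_eq_square)
  also have "\<dots> \<le> (\<Sum>i<?M. \<Sum>j<D. Re (?\<Phi> (munit D i j) $$ (i, j)))"
    using M(2) nonneg by (intro sum_mono sum_mono2) auto
  also have "\<dots> \<le> (\<Sum>i<D. \<Sum>j<D. Re (?\<Phi> (munit D i j) $$ (i, j)))"
    using M(2) nonneg by (intro sum_mono2 sum_nonneg) auto
  finally have "(1 - \<delta>) * (real D)\<^sup>2 \<le> (\<Sum>i<D. \<Sum>j<D. Re (?\<Phi> (munit D i j) $$ (i, j)))" using \<delta> by simp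
  then have "1 - \<delta> \<le> (1 / (real D)\<^sup>2) * (\<Sum>i<D. \<Sum>j<D. Re (?\<Phi> (munit D i j) $$ (i, j)))"
    using M by (simp add: field_simps)
  then have "quantum_code d A D \<delta> E"
    unfolding quantum_code_def
    by (intro conjI exI[of _ "R0 \<circ> S"] E R) (simp only: max_ent_fidelity[OF \<Phi>])
  then show ?thesis by (intro exI[of _ E])
qed

end

section \<open>Bounds for maps with range in the block algebra\<close>

lemma sum_pair: "(\<Sum>u\<in>A \<times> B. h (fst u) (snd u)) = (\<Sum>a\<in>A. \<Sum>b\<in>B. h a b)"
  by (simp add: sum.cartesian_product case_prod_beta)

lemma sum_pair2:
  "(\<Sum>a\<in>A. \<Sum>b\<in>B. \<Sum>c\<in>C. \<Sum>e\<in>E. F a b c e) = (\<Sum>u\<in>A \<times> B. \<Sum>v\<in>C \<times> E. F (fst u) (snd u) (fst v) (snd v))"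
  unfolding sum_pair[of "\<lambda>a b. \<Sum>v\<in>C \<times> E. F a b (fst v) (snd v)"]
  by (intro sum.cong[OF refl] sum_pair[symmetric])

lemma psd_on_compose:
  assumes "psd_on T A" "finite T" "f ` S \<subseteq> T"
  shows "psd_on S (\<lambda>i j. A (f i) (f j))"
proof -
  obtain W where W: "\<And>i j. i \<in> T \<Longrightarrow> j \<in> T \<Longrightarrow> A i j = (\<Sum>l\<in>T. W i l * cnj (W j l))"
    using psd_on_gram_exists[OF assms(2,1)] by blast
  show ?thesis by (rule psd_on_gram[where I = T and W = "\<lambda>i. W (f i)"]) (use W assms(3) in blast)
qed

lemma psd_on_tensor:
  assumes "finite S" "psd_on S A" "finite T" "psd_on T B"
  shows "psd_on (S \<times> T) (\<lambda>u v. A (fst u) (fst v) * B (snd u) (snd v))"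
proof -
  obtain W where W: "\<And>i j. i \<in> S \<Longrightarrow> j \<in> S \<Longrightarrow> A i j = (\<Sum>l\<in>S. W i l * cnj (W j l))"
    using psd_on_gram_exists[OF assms(1,2)] by blast
  obtain V where V: "\<And>i j. i \<in> T \<Longrightarrow> j \<in> T \<Longrightarrow> B i j = (\<Sum>l\<in>T. V i l * cnj (V j l))"
    using psd_on_gram_exists[OF assms(3,4)] by blast
  show ?thesis
  proof (rule psd_on_gram[where I = "S \<times> T" and W = "\<lambda>u l. W (fst u) (fst l) * V (snd u) (snd l)"])
    fix u v assume "u \<in> S \<times> T" "v \<in> S \<times> T"
    then have "A (fst u) (fst v) * B (snd u) (snd v) = (\<Sum>l\<in>S. W (fst u) l * cnj (W (fst v) l)) * (\<Sum>m\<in>T. V (snd u) m * cnj (V (snd v) m))"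
      using W V by auto
    also have "\<dots> = (\<Sum>l\<in>S. \<Sum>m\<in>T. (W (fst u) l * V (snd u) m) * cnj (W (fst v) l * V (snd v) m))"
      unfolding sum_product by (intro sum.cong refl) (simp add: algebra_simps)
    finally show "A (fst u) (fst v) * B (snd u) (snd v)
       = (\<Sum>l\<in>S \<times> T. (W (fst u) (fst l) * V (snd u) (snd l)) * cnj (W (fst v) (fst l) * V (snd v) (snd l)))"
      unfolding sum.cartesian_product by (simp add: case_prod_beta)
  qed
qed

lemma choi_pair_psd:
  assumes ch: "channel n m \<Phi>"
  shows "psd_on ({..<n} \<times> {..<m}) (\<lambda>u v. \<Phi> (munit n (fst u) (fst v)) $$ (snd u, snd v))"
proof -
  have "psd_on ({..<n} \<times> {..<m}) (\<lambda>u v. \<Phi> (munit n ((fst u * m + snd u) div m) ((fst v * m + snd v) div m))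
      $$ ((fst u * m + snd u) mod m, (fst v * m + snd v) mod m))"
    by (rule psd_on_compose[OF choi_psd[OF ch]]) (auto simp: block_index_less)
  then show ?thesis by (subst (asm) psd_on_cong) auto
qed

context block_decomposition
begin

lemma blockmat_add: "blockmat (\<lambda>k a b. x k a b + y k a b) = blockmat x + blockmat y"
proof (rule eq_matI)
  note c = blockmat_carrier[of x] blockmat_carrier[of y] blockmat_carrier[of "\<lambda>k a b. x k a b + y k a b"]
  fix i j assume "i < dim_row (blockmat x + blockmat y)" "j < dim_col (blockmat x + blockmat y)"
  then have ij: "i < d" "j < d" using c by auto
  show "blockmat (\<lambda>k a b. x k a b + y k a b) $$ (i, j) = (blockmat x + blockmat y) $$ (i, j)"
    using ij c by (simp add: blockmat_entry sum.distrib distrib_right)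
qed (use blockmat_carrier[of x] blockmat_carrier[of y] blockmat_carrier[of "\<lambda>k a b. x k a b + y k a b"] in auto)

text \<open>x_k \<otimes> \<omega>_k has a Gram factor, and rotating its vectors by \<open>U\<close>
  gives Gram vectors of the whole matrix.\<close>

lemma blockmat_psd:
  assumes x: "\<And>k. k \<in> {1..K} \<Longrightarrow> psd_on {..<dk k} (x k)"
  shows "psd d (blockmat x)"
proof -
  let ?P = "\<lambda>k. {..<dk k} \<times> {..<mk k}"
  have "\<exists>Z. \<forall>u\<in>?P k. \<forall>v\<in>?P k. x k (fst u) (fst v) * \<omega> k $$ (snd u, snd v) = (\<Sum>s\<in>?P k. Z u s * cnj (Z v s))"
    if k: "k \<in> {1..K}" for k
    by (rule psd_on_gram_exists[OF _ psd_on_tensor[OF _ x[OF k] _ \<omega>_psd[OF k]]]) auto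
  then have "\<exists>Z. \<forall>k\<in>{1..K}. \<forall>u\<in>?P k. \<forall>v\<in>?P k.
      x k (fst u) (fst v) * \<omega> k $$ (snd u, snd v) = (\<Sum>s\<in>?P k. Z k u s * cnj (Z k v s))"
    by (intro bchoice ballI)
  then obtain Z where Z: "\<And>k u v. k \<in> {1..K} \<Longrightarrow> u \<in> ?P k \<Longrightarrow> v \<in> ?P k \<Longrightarrow>
      x k (fst u) (fst v) * \<omega> k $$ (snd u, snd v) = (\<Sum>s\<in>?P k. Z k u s * cnj (Z k v s))" by blast
  define V where "V = (\<lambda>i (k, s). \<Sum>u\<in>?P k. Z k u s * U $$ (i, pos k (fst u) (snd u)))"
  have "psd_on {..<d} (\<lambda>i j. blockmat x $$ (i, j))"
  proof (rule psd_on_gram[where I = "SIGMA k:{1..K}. ?P k" and W = V])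
    fix i j assume "i \<in> {..<d}" "j \<in> {..<d}"
    then have ij: "i < d" "j < d" by auto
    have "blockmat x $$ (i, j) = (\<Sum>k\<in>{1..K}. \<Sum>a<dk k. \<Sum>b<mk k. \<Sum>a'<dk k. \<Sum>b'<mk k.
       x k a a' * \<omega> k $$ (b, b') * (U $$ (i, pos k a b) * cnj (U $$ (j, pos k a' b'))))"
      unfolding blockmat_entry[OF ij] by (intro sum.cong refl sum.swap)
    also have "\<dots> = (\<Sum>k\<in>{1..K}. \<Sum>u\<in>?P k. \<Sum>v\<in>?P k. x k (fst u) (fst v) * \<omega> k $$ (snd u, snd v) *
       (U $$ (i, pos k (fst u) (snd u)) * cnj (U $$ (j, pos k (fst v) (snd v)))))"
      by (rule sum.cong[OF refl], rule sum_pair2)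
    also have "\<dots> = (\<Sum>k\<in>{1..K}. \<Sum>s\<in>?P k. V i (k, s) * cnj (V j (k, s)))"
    proof (rule sum.cong[OF refl])
      fix k assume k: "k \<in> {1..K}"
      have "(\<Sum>u\<in>?P k. \<Sum>v\<in>?P k. x k (fst u) (fst v) * \<omega> k $$ (snd u, snd v) *
          (U $$ (i, pos k (fst u) (snd u)) * cnj (U $$ (j, pos k (fst v) (snd v)))))
        = (\<Sum>u\<in>?P k. \<Sum>v\<in>?P k. \<Sum>s\<in>?P k. (Z k u s * U $$ (i, pos k (fst u) (snd u))) *
            cnj (Z k v s * U $$ (j, pos k (fst v) (snd v))))"
      proof (intro sum.cong[OF refl])
        fix u v assume uv: "u \<in> ?P k" "v \<in> ?P k"
        show "x k (fst u) (fst v) * \<omega> k $$ (snd u, snd v) *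
          (U $$ (i, pos k (fst u) (snd u)) * cnj (U $$ (j, pos k (fst v) (snd v))))
          = (\<Sum>s\<in>?P k. (Z k u s * U $$ (i, pos k (fst u) (snd u))) * cnj (Z k v s * U $$ (j, pos k (fst v) (snd v))))"
          unfolding Z[OF k uv] sum_distrib_right by (intro sum.cong refl) (simp add: algebra_simps)
      qed
      also have "\<dots> = (\<Sum>s\<in>?P k. \<Sum>u\<in>?P k. \<Sum>v\<in>?P k. (Z k u s * U $$ (i, pos k (fst u) (snd u))) *
            cnj (Z k v s * U $$ (j, pos k (fst v) (snd v))))"
        by (rule sum_rotate3)
      also have "\<dots> = (\<Sum>s\<in>?P k. V i (k, s) * cnj (V j (k, s)))"
        unfolding V_def prod.case cnj_sum sum_product ..
      finally show "(\<Sum>u\<in>?P k. \<Sum>v\<in>?P k. x k (fst u) (fst v) * \<omega> k $$ (snd u, snd v) *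
          (U $$ (i, pos k (fst u) (snd u)) * cnj (U $$ (j, pos k (fst v) (snd v)))))
        = (\<Sum>s\<in>?P k. V i (k, s) * cnj (V j (k, s)))" .
    qed
    also have "\<dots> = (\<Sum>z\<in>(SIGMA k:{1..K}. ?P k). V i z * cnj (V j z))"
      by (subst sum.Sigma) (auto simp: case_prod_beta)
    finally show "blockmat x $$ (i, j) = (\<Sum>z\<in>(SIGMA k:{1..K}. ?P k). V i z * cnj (V j z))" .
  qed
  then show ?thesis by (simp add: psd_iff_psd_on blockmat_carrier)
qed

text \<open>Compression to block \<open>k\<close> followed by the partial trace over its second
  factor recovers \<open>x\<close>, because \<omega>_k has trace 1. The spectator index set
  \<open>S\<close> makes this apply to Choi matrices as well as to single states.\<close>

lemma blockmat_kernel_psd: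
  assumes fin: "finite S"
    and psd: "psd_on (S \<times> {..<d}) (\<lambda>u v. blockmat (x (fst u) (fst v)) $$ (snd u, snd v))"
    and k: "k \<in> {1..K}"
  shows "psd_on (S \<times> {..<dk k}) (\<lambda>u v. x (fst u) (fst v) k (snd u) (snd v))"
proof -
  let ?Q = "S \<times> {..<d}"
  have "finite ?Q" using fin by simp
  then obtain W where W: "\<And>u v. u \<in> ?Q \<Longrightarrow> v \<in> ?Q \<Longrightarrow>
      blockmat (x (fst u) (fst v)) $$ (snd u, snd v) = (\<Sum>s\<in>?Q. W u s * cnj (W v s))"
    using psd_on_gram_exists[OF _ psd] by blast
  define V where "V = (\<lambda>u (b, s). \<Sum>p<d. cnj (U $$ (p, pos k (snd u) b)) * W (fst u, p) s)"
  show ?thesis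
  proof (rule psd_on_gram[where I = "{..<mk k} \<times> ?Q" and W = V])
    fix u v assume uv: "u \<in> S \<times> {..<dk k}" "v \<in> S \<times> {..<dk k}"
    obtain i a where u: "u = (i, a)" "i \<in> S" "a < dk k" using uv by auto
    obtain j a' where v: "v = (j, a')" "j \<in> S" "a' < dk k" using uv by auto
    have "x i j k a a' = (\<Sum>b<mk k. x i j k a a' * \<omega> k $$ (b, b))"
      using \<omega>_trace[OF k] by (simp flip: sum_distrib_left)
    also have "\<dots> = (\<Sum>b<mk k. core (x i j) $$ (pos k a b, pos k a' b))"
      using k u(3) v(3) by (intro sum.cong refl) (simp add: core_entry)
    also have "\<dots> = (\<Sum>b<mk k. \<Sum>p<d. \<Sum>q<d. cnj (U $$ (p, pos k a b)) * blockmat (x i j) $$ (p, q) * U $$ (q, pos k a' b))"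
      using k u(3) v(3) by (intro sum.cong[OF refl] blockmat_coeff[symmetric] pos_less) auto
    also have "\<dots> = (\<Sum>b<mk k. \<Sum>p<d. \<Sum>q<d. \<Sum>s\<in>?Q. (cnj (U $$ (p, pos k a b)) * W (i, p) s) *
        cnj (cnj (U $$ (q, pos k a' b)) * W (j, q) s))"
    proof (intro sum.cong[OF refl])
      fix b p q assume "p \<in> {..<d}" "q \<in> {..<d}"
      then have B: "blockmat (x i j) $$ (p, q) = (\<Sum>s\<in>?Q. W (i, p) s * cnj (W (j, q) s))"
        using W[of "(i, p)" "(j, q)"] u(2) v(2) by simp
      show "cnj (U $$ (p, pos k a b)) * blockmat (x i j) $$ (p, q) * U $$ (q, pos k a' b)
        = (\<Sum>s\<in>?Q. (cnj (U $$ (p, pos k a b)) * W (i, p) s) * cnj (cnj (U $$ (q, pos k a' b)) * W (j, q) s))"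
        unfolding B sum_distrib_left sum_distrib_right by (intro sum.cong refl) (simp add: algebra_simps)
    qed
    also have "\<dots> = (\<Sum>b<mk k. \<Sum>s\<in>?Q. \<Sum>p<d. \<Sum>q<d. (cnj (U $$ (p, pos k a b)) * W (i, p) s) *
        cnj (cnj (U $$ (q, pos k a' b)) * W (j, q) s))"
      by (rule sum.cong[OF refl], rule sum_rotate3)
    also have "\<dots> = (\<Sum>b<mk k. \<Sum>s\<in>?Q. V u (b, s) * cnj (V v (b, s)))"
      unfolding V_def u(1) v(1) prod.case cnj_sum sum_product fst_conv snd_conv ..
    also have "\<dots> = (\<Sum>z\<in>{..<mk k} \<times> ?Q. V u z * cnj (V v z))"
      unfolding sum.cartesian_product[of _ ?Q] by (simp add: case_prod_beta)
    finally show "x (fst u) (fst v) k (snd u) (snd v) = (\<Sum>z\<in>{..<mk k} \<times> ?Q. V u z * cnj (V v z))"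
      using u(1) v(1) by simp
  qed
qed

text \<open>The same operator \<open>G\<close> dominates the states of all messages, so the
  successes are bounded by the diagonal of \<open>R G\<close>, which adds up to the trace of
  \<open>G\<close> once and not \<open>D\<close> times.\<close>

lemma classical_success_le:
  assumes L: "channel d d L" and Lx: "\<And>X. X \<in> carrier_mat d d \<Longrightarrow> L X \<in> range blockmat"
    and E: "channel D d E" and R: "channel d D R"
  shows "(\<Sum>i<D. Re (R (L (E (munit D i i))) $$ (i, i))) \<le> real (\<Sum>k\<in>{1..K}. dk k)"
proof -
  define G where "G = blockmat (\<lambda>k a b. if a = b then 1 else 0)"
  have Gc: "G \<in> carrier_mat d d" unfolding G_def by (rule blockmat_carrier)
  have le: "Re (R (L (E (munit D i i))) $$ (i, i)) \<le> Re (R G $$ (i, i))" if i: "i < D" for i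
  proof -
    have Ec: "E (munit D i i) \<in> carrier_mat d d" by (rule channel_carrier[OF E]) simp
    obtain x where x: "L (E (munit D i i)) = blockmat x" using Lx[OF Ec] by blast
    have "psd d (blockmat x)"
      unfolding x[symmetric] by (intro channel_psd[OF L] channel_psd[OF E] munit_psd)
    then have p: "psd_on {..<d} (\<lambda>p q. blockmat x $$ (p, q))" by (simp add: psd_iff_psd_on)
    have xp: "psd_on {..<dk k} (x k)" if k: "k \<in> {1..K}" for k
    proof -
      have "psd_on ({()} \<times> {..<d}) (\<lambda>u v. blockmat x $$ (snd u, snd v))"
        by (rule psd_on_compose[OF p]) auto
      then have "psd_on ({()} \<times> {..<dk k}) (\<lambda>u v. x k (snd u) (snd v))"
        using blockmat_kernel_psd[of "{()}" "\<lambda>_ _. x", OF _ _ k] by simp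
      from psd_on_compose[OF this, of "\<lambda>a. ((), a)" "{..<dk k}"] show ?thesis by auto
    qed
    have tr1: "(\<Sum>k\<in>{1..K}. \<Sum>a<dk k. x k a a) = 1"
      using blockmat_trace[of x] channel_trace[OF L Ec] channel_trace[OF E munit_carrier, of i i] mtrace_munit[OF i, of i] x
      by simp
    have nn: "0 \<le> Re (\<Sum>a<dk k. x k a a)" if "k \<in> {1..K}" for k
      using psd_on_diag(2)[OF xp[OF that]] by (auto intro!: sum_nonneg)
    have t1: "Re (\<Sum>a<dk k. x k a a) \<le> 1" if k: "k \<in> {1..K}" for k
    proof -
      have "Re (\<Sum>a<dk k. x k a a) \<le> (\<Sum>k\<in>{1..K}. Re (\<Sum>a<dk k. x k a a))"
        using k nn by (intro member_le_sum[of k _ "\<lambda>k. Re (\<Sum>a<dk k. x k a a)"]) auto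
      also have "\<dots> = Re (\<Sum>k\<in>{1..K}. \<Sum>a<dk k. x k a a)" by (simp only: Re_sum)
      also have "\<dots> = 1" unfolding tr1 by simp
      finally show ?thesis .
    qed
    \<comment> \<open>The deficit from \<open>G\<close>: each x_k is positive with trace at most 1,
      hence below the identity, and \<open>R\<close> preserves this order.\<close>
    define y where "y = (\<lambda>k a b. (if a = b then complex_of_real 1 else 0) - x k a b)"
    have "psd d (blockmat y)"
      by (rule blockmat_psd) (use psd_on_scalar_minus[OF finite_lessThan xp t1] in \<open>simp add: y_def\<close>)
    then have "psd_on {..<D} (\<lambda>p q. R (blockmat y) $$ (p, q))"
      using channel_psd[OF R] by (simp add: psd_iff_psd_on)
    then have "0 \<le> Re (R (blockmat y) $$ (i, i))" using psd_on_diag(2)[of "{..<D}" _ i] i by simp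
    moreover have "G = blockmat x + blockmat y"
      unfolding G_def blockmat_add[symmetric] y_def by (intro arg_cong[of _ _ blockmat] ext) simp
    then have "R G $$ (i, i) = R (blockmat x) $$ (i, i) + R (blockmat y) $$ (i, i)"
      using channel_add[OF R blockmat_carrier blockmat_carrier, of x y] i
        channel_carrier[OF R blockmat_carrier, of x] channel_carrier[OF R blockmat_carrier, of y] by simp
    ultimately show ?thesis unfolding x by simp
  qed
  have "(\<Sum>i<D. Re (R (L (E (munit D i i))) $$ (i, i))) \<le> (\<Sum>i<D. Re (R G $$ (i, i)))"
    using le by (intro sum_mono) simp
  also have "\<dots> = Re (mtrace (R G))" using channel_carrier[OF R Gc] by (simp add: mtrace_def)
  also have "\<dots> = Re (mtrace G)" by (simp add: channel_trace[OF R Gc])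
  also have "\<dots> = real (\<Sum>k\<in>{1..K}. dk k)" unfolding G_def blockmat_trace by simp
  finally show ?thesis .
qed

lemma channel_blockmat_expand:
  assumes R: "channel d D R" and ij: "i < D" "j < D"
  shows "R (blockmat x) $$ (i, j)
    = (\<Sum>k\<in>{1..K}. \<Sum>a<dk k. \<Sum>a'<dk k. x k a a' * R (blockmat (unit_kernel k a a')) $$ (i, j))"
proof -
  have e: "blockmat x $$ (p, q) = (\<Sum>k\<in>{1..K}. \<Sum>a<dk k. \<Sum>a'<dk k. x k a a' * blockmat (unit_kernel k a a') $$ (p, q))"
    if "p < d" "q < d" for p q
    by (rule trans[OF blockmat_entry[OF that]], intro sum.cong[OF refl])
      (simp add: blockmat_unit_entry[OF that] sum_distrib_left mult.assoc)
  have "R (blockmat x) $$ (i, j) = (\<Sum>p<d. \<Sum>q<d. \<Sum>k\<in>{1..K}. \<Sum>a<dk k. \<Sum>a'<dk k.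
      x k a a' * (blockmat (unit_kernel k a a') $$ (p, q) * R (munit d p q) $$ (i, j)))"
    unfolding channel_expand[OF R blockmat_carrier ij]
    by (intro sum.cong[OF refl]) (simp add: e sum_distrib_right mult.assoc)
  also have "\<dots> = (\<Sum>k\<in>{1..K}. \<Sum>p<d. \<Sum>q<d. \<Sum>a<dk k. \<Sum>a'<dk k.
      x k a a' * (blockmat (unit_kernel k a a') $$ (p, q) * R (munit d p q) $$ (i, j)))"
    by (rule sum_rotate3)
  also have "\<dots> = (\<Sum>k\<in>{1..K}. \<Sum>a<dk k. \<Sum>p<d. \<Sum>q<d. \<Sum>a'<dk k.
      x k a a' * (blockmat (unit_kernel k a a') $$ (p, q) * R (munit d p q) $$ (i, j)))"
    by (rule sum.cong[OF refl], rule sum_rotate3)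
  also have "\<dots> = (\<Sum>k\<in>{1..K}. \<Sum>a<dk k. \<Sum>a'<dk k. \<Sum>p<d. \<Sum>q<d.
      x k a a' * (blockmat (unit_kernel k a a') $$ (p, q) * R (munit d p q) $$ (i, j)))"
    by (rule sum.cong[OF refl], rule sum.cong[OF refl], rule sum_rotate3)
  also have "\<dots> = (\<Sum>k\<in>{1..K}. \<Sum>a<dk k. \<Sum>a'<dk k. x k a a' * R (blockmat (unit_kernel k a a')) $$ (i, j))"
    by (simp only: channel_expand[OF R blockmat_carrier ij] sum_distrib_left)
  finally show ?thesis .
qed

text \<open>This is the Choi matrix, with the output index first, of the channel that embeds block
  \<open>k\<close> by X \<mapsto> X \<otimes> \<omega>_k and then applies \<open>R\<close>.\<close>

lemma blockmat_unit_psd: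
  assumes R: "channel d D R" and k: "k \<in> {1..K}"
  shows "psd_on ({..<D} \<times> {..<dk k}) (\<lambda>u v. R (blockmat (unit_kernel k (snd u) (snd v))) $$ (fst u, fst v))"
proof -
  obtain W where W: "\<And>b b'. b < mk k \<Longrightarrow> b' < mk k \<Longrightarrow> \<omega> k $$ (b, b') = (\<Sum>l<mk k. W b l * cnj (W b' l))"
    using psd_on_gram_exists[OF _ \<omega>_psd[OF k]] by auto
  let ?Q = "{..<d} \<times> {..<D}"
  obtain A where A: "\<And>u v. u \<in> ?Q \<Longrightarrow> v \<in> ?Q \<Longrightarrow>
      R (munit d (fst u) (fst v)) $$ (snd u, snd v) = (\<Sum>l\<in>?Q. A u l * cnj (A v l))"
    using psd_on_gram_exists[OF _ choi_pair_psd[OF R]] by auto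
  define g where "g = (\<lambda>a m p. \<Sum>b<mk k. W b m * U $$ (p, pos k a b))"
  define V where "V = (\<lambda>u (l, m). \<Sum>p<d. A (p, fst u) l * g (snd u) m p)"
  have gg: "blockmat (unit_kernel k a a') $$ (p, q) = (\<Sum>m<mk k. g a m p * cnj (g a' m q))"
    if "a < dk k" "a' < dk k" "p < d" "q < d" for a a' p q
  proof -
    have "blockmat (unit_kernel k a a') $$ (p, q) = (\<Sum>b<mk k. \<Sum>b'<mk k. \<Sum>m<mk k.
        (W b m * U $$ (p, pos k a b)) * cnj (W b' m * U $$ (q, pos k a' b')))"
      unfolding blockmat_unit_entry[OF that(3,4) k that(1,2)]
      by (intro sum.cong[OF refl]) (simp add: W sum_distrib_left sum_distrib_right algebra_simps)
    also have "\<dots> = (\<Sum>m<mk k. \<Sum>b<mk k. \<Sum>b'<mk k.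
        (W b m * U $$ (p, pos k a b)) * cnj (W b' m * U $$ (q, pos k a' b')))"
      by (rule sum_rotate3)
    finally show ?thesis unfolding g_def cnj_sum sum_product .
  qed
  show ?thesis
  proof (rule psd_on_gram[where I = "?Q \<times> {..<mk k}" and W = V])
    fix u v assume uv: "u \<in> {..<D} \<times> {..<dk k}" "v \<in> {..<D} \<times> {..<dk k}"
    obtain i a where u: "u = (i, a)" "i < D" "a < dk k" using uv by auto
    obtain j a' where v: "v = (j, a')" "j < D" "a' < dk k" using uv by auto
    have "R (blockmat (unit_kernel k a a')) $$ (i, j) = (\<Sum>p<d. \<Sum>q<d. \<Sum>m<mk k. \<Sum>l\<in>?Q.
        (A (p, i) l * g a m p) * cnj (A (q, j) l * g a' m q))"
      unfolding channel_expand[OF R blockmat_carrier u(2) v(2)]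
      proof (intro sum.cong[OF refl])
      fix p q assume "p \<in> {..<d}" "q \<in> {..<d}"
      then have "blockmat (unit_kernel k a a') $$ (p, q) * R (munit d p q) $$ (i, j)
        = (\<Sum>m<mk k. g a m p * cnj (g a' m q)) * (\<Sum>l\<in>?Q. A (p, i) l * cnj (A (q, j) l))"
        using A[of "(p, i)" "(q, j)"] gg[of a a' p q] u v by simp
      also have "\<dots> = (\<Sum>m<mk k. \<Sum>l\<in>?Q. (A (p, i) l * g a m p) * cnj (A (q, j) l * g a' m q))"
        unfolding sum_product by (intro sum.cong[OF refl]) (simp add: algebra_simps)
      finally show "blockmat (unit_kernel k a a') $$ (p, q) * R (munit d p q) $$ (i, j)
        = (\<Sum>m<mk k. \<Sum>l\<in>?Q. (A (p, i) l * g a m p) * cnj (A (q, j) l * g a' m q))" .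
    qed
    also have "\<dots> = (\<Sum>m<mk k. \<Sum>p<d. \<Sum>q<d. \<Sum>l\<in>?Q. (A (p, i) l * g a m p) * cnj (A (q, j) l * g a' m q))"
      by (rule sum_rotate3)
    also have "\<dots> = (\<Sum>m<mk k. \<Sum>l\<in>?Q. \<Sum>p<d. \<Sum>q<d. (A (p, i) l * g a m p) * cnj (A (q, j) l * g a' m q))"
      by (rule sum.cong[OF refl], rule sum_rotate3)
    also have "\<dots> = (\<Sum>l\<in>?Q. \<Sum>m<mk k. \<Sum>p<d. \<Sum>q<d. (A (p, i) l * g a m p) * cnj (A (q, j) l * g a' m q))"
      by (rule sum.swap)
    also have "\<dots> = (\<Sum>l\<in>?Q. \<Sum>m<mk k. V u (l, m) * cnj (V v (l, m)))"
      unfolding V_def u(1) v(1) prod.case cnj_sum sum_product fst_conv snd_conv ..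
    also have "\<dots> = (\<Sum>z\<in>?Q \<times> {..<mk k}. V u z * cnj (V v z))"
      unfolding sum.cartesian_product[of _ "{..<mk k}"] by (simp add: case_prod_beta)
    finally show "R (blockmat (unit_kernel k (snd u) (snd v))) $$ (fst u, fst v)
        = (\<Sum>z\<in>?Q \<times> {..<mk k}. V u z * cnj (V v z))" using u(1) v(1) by simp
  qed
qed

lemma blockmat_unit_trace:
  assumes "k \<in> {1..K}" "a < dk k"
  shows "mtrace (blockmat (unit_kernel k a a)) = 1"
proof -
  have "mtrace (blockmat (unit_kernel k a a)) = (\<Sum>k'\<in>{1..K}. \<Sum>a'<dk k'. if a' = a then if k' = k then 1 else 0 else 0)"
    unfolding blockmat_trace unit_kernel_def by (intro sum.cong refl) auto
  also have "\<dots> = (\<Sum>k'\<in>{1..K}. if k' = k then 1 else 0)"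
    using assms(2) by (intro sum.cong refl) (auto simp: sum.delta)
  also have "\<dots> = 1" using assms(1) by simp
  finally show ?thesis .
qed

lemma quantum_success_le:
  assumes L: "channel d d L" and Lx: "\<And>X. X \<in> carrier_mat d d \<Longrightarrow> L X \<in> range blockmat"
    and E: "channel D d E" and R: "channel d D R" and M: "\<And>k. k \<in> {1..K} \<Longrightarrow> dk k \<le> M"
  shows "(\<Sum>i<D. \<Sum>j<D. Re (R (L (E (munit D i j))) $$ (i, j))) \<le> real M * real D"
proof -
  have LE: "channel D d (L \<circ> E)" by (rule channel_comp[OF E L])
  have "\<exists>x. (L \<circ> E) (munit D i j) = blockmat x" for i j
    using Lx[OF channel_carrier[OF E munit_carrier, of i j]] by auto
  then obtain x where x: "\<And>i j. (L \<circ> E) (munit D i j) = blockmat (x i j)" by metis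
  \<comment> \<open>The fidelity pairs input \<open>i\<close> with output \<open>i\<close>. Hence
    the Choi matrix of the encoding half, indexed by input and level, and that of the decoding half,
    indexed by output and level, share one index set \<open>?S k\<close>.\<close>
  define X where "X = (\<lambda>k u v. x (fst u) (fst v) k (snd u) (snd v))"
  define J where "J = (\<lambda>k u v. R (blockmat (unit_kernel k (snd u) (snd v))) $$ (fst u, fst v))"
  let ?S = "\<lambda>k. {..<D} \<times> {..<dk k}"
  have Xp: "psd_on (?S k) (X k)" if k: "k \<in> {1..K}" for k
    unfolding X_def by (rule blockmat_kernel_psd[OF finite_lessThan _ k]) (use choi_pair_psd[OF LE] x in simp)
  have Jp: "psd_on (?S k) (J k)" if k: "k \<in> {1..K}" for k
    unfolding J_def by (rule blockmat_unit_psd[OF R k])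
  have Jt: "Re (\<Sum>u\<in>?S k. J k u u) = real (dk k)" if k: "k \<in> {1..K}" for k
  proof -
    have "(\<Sum>u\<in>?S k. J k u u) = (\<Sum>i<D. \<Sum>a<dk k. R (blockmat (unit_kernel k a a)) $$ (i, i))"
      unfolding sum.cartesian_product by (simp add: J_def case_prod_beta)
    also have "\<dots> = (\<Sum>a<dk k. \<Sum>i<D. R (blockmat (unit_kernel k a a)) $$ (i, i))" by (rule sum.swap)
    also have "\<dots> = (\<Sum>a<dk k. mtrace (R (blockmat (unit_kernel k a a))))"
      by (simp add: mtrace_def carrier_matD(1)[OF channel_carrier[OF R blockmat_carrier]])
    also have "\<dots> = (\<Sum>a<dk k. 1)"
      by (intro sum.cong refl) (simp add: channel_trace[OF R blockmat_carrier] blockmat_unit_trace[OF k])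
    finally show ?thesis by simp
  qed
  have Xt: "(\<Sum>k\<in>{1..K}. Re (\<Sum>u\<in>?S k. X k u u)) = real D"
  proof -
    have "(\<Sum>k\<in>{1..K}. \<Sum>u\<in>?S k. X k u u) = (\<Sum>k\<in>{1..K}. \<Sum>i<D. \<Sum>a<dk k. x i i k a a)"
      unfolding sum.cartesian_product by (simp add: X_def case_prod_beta)
    also have "\<dots> = (\<Sum>i<D. \<Sum>k\<in>{1..K}. \<Sum>a<dk k. x i i k a a)" by (rule sum.swap)
    also have "\<dots> = (\<Sum>i<D. mtrace ((L \<circ> E) (munit D i i)))" unfolding x blockmat_trace ..
    also have "\<dots> = (\<Sum>i<D. 1)"
      by (intro sum.cong refl) (simp add: channel_trace[OF LE munit_carrier] mtrace_munit del: o_apply)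
    finally have "Re (\<Sum>k\<in>{1..K}. \<Sum>u\<in>?S k. X k u u) = real D" by simp
    then show ?thesis by (simp only: Re_sum)
  qed
  have "(\<Sum>i<D. \<Sum>j<D. R (L (E (munit D i j))) $$ (i, j))
     = (\<Sum>i<D. \<Sum>j<D. \<Sum>k\<in>{1..K}. \<Sum>a<dk k. \<Sum>a'<dk k. x i j k a a' * R (blockmat (unit_kernel k a a')) $$ (i, j))"
  proof (rule sum.cong[OF refl], rule sum.cong[OF refl])
    fix i j assume "i \<in> {..<D}" "j \<in> {..<D}"
    then have "i < D" "j < D" by auto
    from channel_blockmat_expand[OF R this, of "x i j"] x[of i j]
    show "R (L (E (munit D i j))) $$ (i, j)
      = (\<Sum>k\<in>{1..K}. \<Sum>a<dk k. \<Sum>a'<dk k. x i j k a a' * R (blockmat (unit_kernel k a a')) $$ (i, j))"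
      by (simp only: o_apply)
  qed
  also have "\<dots> = (\<Sum>k\<in>{1..K}. \<Sum>i<D. \<Sum>j<D. \<Sum>a<dk k. \<Sum>a'<dk k. x i j k a a' * R (blockmat (unit_kernel k a a')) $$ (i, j))"
    by (rule sum_rotate3)
  also have "\<dots> = (\<Sum>k\<in>{1..K}. \<Sum>i<D. \<Sum>a<dk k. \<Sum>j<D. \<Sum>a'<dk k. x i j k a a' * R (blockmat (unit_kernel k a a')) $$ (i, j))"
    by (rule sum.cong[OF refl], rule sum.cong[OF refl], rule sum.swap)
  also have "\<dots> = (\<Sum>k\<in>{1..K}. \<Sum>u\<in>?S k. \<Sum>v\<in>?S k. X k u v * J k u v)"
    unfolding X_def J_def by (rule sum.cong[OF refl], rule sum_pair2)
  finally have "(\<Sum>i<D. \<Sum>j<D. Re (R (L (E (munit D i j))) $$ (i, j)))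
      = (\<Sum>k\<in>{1..K}. Re (\<Sum>u\<in>?S k. \<Sum>v\<in>?S k. X k u v * J k u v))"
    by (simp only: Re_sum[symmetric])
  \<comment> \<open>The trace of \<open>J k\<close> is d_k in every block, whereas the traces of the
    \<open>X k\<close> only add up to \<open>D\<close>; so the largest block decides.\<close>
  also have "\<dots> \<le> (\<Sum>k\<in>{1..K}. Re (\<Sum>u\<in>?S k. X k u u) * real M)"
  proof (intro sum_mono)
    fix k assume k: "k \<in> {1..K}"
    have "Re (\<Sum>u\<in>?S k. \<Sum>v\<in>?S k. X k u v * J k u v) \<le> Re (\<Sum>u\<in>?S k. X k u u) * Re (\<Sum>u\<in>?S k. J k u u)"
      by (rule psd_on_pairing_le[OF _ Xp[OF k] Jp[OF k]]) simp
    also have "\<dots> \<le> Re (\<Sum>u\<in>?S k. X k u u) * real M"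
      unfolding Jt[OF k] using M[OF k] psd_on_diag(2)[OF Xp[OF k]]
      by (intro mult_left_mono) (auto intro!: sum_nonneg)
    finally show "Re (\<Sum>u\<in>?S k. \<Sum>v\<in>?S k. X k u v * J k u v) \<le> Re (\<Sum>u\<in>?S k. X k u u) * real M" .
  qed
  also have "\<dots> = real M * real D" unfolding sum_distrib_right[symmetric] Xt by simp
  finally show ?thesis .
qed

end

section \<open>Infinite-time capacities\<close>

text \<open>The last application of \<open>T\<close> is moved into the decoder. This monotonicity in
  \<open>t\<close> makes the capacities converge and lets an upper bound be checked at a single
  exponent.\<close>

lemma classical_code_funpow_Suc:
  assumes "channel d d T" "classical_code d (T ^^ Suc t) D \<delta> E"
  shows "classical_code d (T ^^ t) D \<delta> E"
proof -
  obtain R where E: "channel D d E" and R: "channel d D R"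
    and v: "1 - \<delta> \<le> (1 / real D) * (\<Sum>i<D. Re ((R ((T ^^ Suc t) (E (basis_proj D i)))) $$ (i, i)))"
    using assms(2) unfolding classical_code_def by blast
  show ?thesis
    unfolding classical_code_def
    by (intro conjI exI[of _ "R \<circ> T"] E channel_comp[OF assms(1) R]) (use v in simp)
qed

lemma quantum_code_funpow_Suc:
  assumes "channel d d T" "quantum_code d (T ^^ Suc t) D \<delta> E"
  shows "quantum_code d (T ^^ t) D \<delta> E"
proof -
  obtain R where E: "channel D d E" and R: "channel d D R"
    and v: "(let Y = ampl D D D (R \<circ> (T ^^ Suc t) \<circ> E) (max_ent D) in
      Re ((1 / of_nat D) * (\<Sum>i<D. \<Sum>j<D. Y $$ (i * D + i, j * D + j)))) \<ge> 1 - \<delta>"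
    using assms(2) unfolding quantum_code_def by blast
  have "R \<circ> (T ^^ Suc t) \<circ> E = (R \<circ> T) \<circ> (T ^^ t) \<circ> E" by (simp add: o_assoc)
  then show ?thesis
    unfolding quantum_code_def
    by (intro conjI exI[of _ "R \<circ> T"] E channel_comp[OF assms(1) R]) (use v in simp)
qed

lemma C_cap_decseq: "channel d d T \<Longrightarrow> decseq (\<lambda>t. C_cap d \<delta> (T ^^ t))"
  unfolding decseq_Suc_iff C_cap_def
  by (intro allI Sup_subset_mono) (use classical_code_funpow_Suc in blast)

lemma Q_cap_decseq: "channel d d T \<Longrightarrow> decseq (\<lambda>t. Q_cap d \<delta> (T ^^ t))"
  unfolding decseq_Suc_iff Q_cap_def
  by (intro allI Sup_subset_mono) (use quantum_code_funpow_Suc in blast)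

text \<open>An integer that violates \<open>D * s \<le> N\<close> does so by a margin, and the least
  violator \<open>m\<close> sets a slack that works for all. This turns an approximate bound into an
  exact one, and so produces the floor.\<close>

lemma nat_le_quotient_gap:
  fixes N s :: real
  assumes "0 \<le> N" "0 < s"
  shows "\<exists>\<eta>>0. \<forall>D::nat. real D * (s - \<eta>) \<le> N \<longrightarrow> real D * s \<le> N"
proof -
  define m where "m = nat \<lfloor>N / s\<rfloor> + 1"
  have fl: "0 \<le> \<lfloor>N / s\<rfloor>" using assms by simp
  have "N / s < real m" using fl unfolding m_def by linarith
  then have m: "N < real m * s" using assms by (simp add: field_simps)
  have mpos: "0 < real m" by (simp add: m_def)
  \<comment> \<open>Puts m * (s - \<eta>) halfway between N and m * s, so that every D \<ge> m still
    exceeds the bound after the slack is granted.\<close>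
  define \<eta> where "\<eta> = (real m * s - N) / (2 * real m)"
  have me: "real m * (s - \<eta>) = (real m * s + N) / 2" using mpos by (simp add: \<eta>_def field_simps)
  then have "0 \<le> real m * (s - \<eta>)" using m assms by simp
  then have nn: "0 \<le> s - \<eta>" using mpos by (simp add: zero_le_mult_iff)
  have "real D * s \<le> N" if D: "real D * (s - \<eta>) \<le> N" for D :: nat
  proof (cases "D < m")
    case True
    then have "real D \<le> of_int \<lfloor>N / s\<rfloor>" using fl unfolding m_def by linarith
    also have "\<dots> \<le> N / s" by simp
    finally show ?thesis using assms by (simp add: field_simps)
  next
    case False
    then have "real m * (s - \<eta>) \<le> real D * (s - \<eta>)" using nn by (intro mult_right_mono) auto
    then show ?thesis using D me m by simp
  qed
  moreover have "0 < \<eta>" using m mpos by (simp add: \<eta>_def)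
  ultimately show ?thesis by blast
qed

lemma pow_lim_uniform:
  assumes L: "pow_lim d T r L" and \<epsilon>: "0 < \<epsilon>"
  shows "\<exists>t. \<forall>a<d. \<forall>b<d. \<forall>p<d. \<forall>q<d. cmod ((T ^^ t) (munit d a b) $$ (p, q) - L (munit d a b) $$ (p, q)) \<le> \<epsilon>"
proof -
  have "\<forall>\<^sub>F k in sequentially. \<forall>z\<in>{..<d} \<times> {..<d} \<times> {..<d} \<times> {..<d}. case z of (a, b, p, q) \<Rightarrow>
      dist ((T ^^ r k) (munit d a b) $$ (p, q)) (L (munit d a b) $$ (p, q)) < \<epsilon>"
  proof (intro eventually_ball_finite ballI)
    fix z assume "z \<in> {..<d} \<times> {..<d} \<times> {..<d} \<times> {..<d}"
    then obtain a b p q where z: "z = (a, b, p, q)" "p < d" "q < d" by auto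
    show "\<forall>\<^sub>F k in sequentially. case z of (a, b, p, q) \<Rightarrow>
        dist ((T ^^ r k) (munit d a b) $$ (p, q)) (L (munit d a b) $$ (p, q)) < \<epsilon>"
      unfolding z(1) prod.case by (rule tendstoD[OF pow_limD(2)[OF L munit_carrier z(2,3)] \<epsilon>])
  qed simp
  then obtain k where k: "\<forall>z\<in>{..<d} \<times> {..<d} \<times> {..<d} \<times> {..<d}. case z of (a, b, p, q) \<Rightarrow>
      dist ((T ^^ r k) (munit d a b) $$ (p, q)) (L (munit d a b) $$ (p, q)) < \<epsilon>"
    using eventually_happens'[OF sequentially_bot] by blast
  have "cmod ((T ^^ r k) (munit d a b) $$ (p, q) - L (munit d a b) $$ (p, q)) \<le> \<epsilon>"
    if "a < d" "b < d" "p < d" "q < d" for a b p q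
    using bspec[OF k, of "(a, b, p, q)"] that by (simp add: dist_norm)
  then show ?thesis by blast
qed

theorem theorem1:
  fixes d d0 K :: nat
    and T :: "complex mat \<Rightarrow> complex mat"
    and U :: "complex mat"
    and dk mk :: "nat \<Rightarrow> nat"
    and \<omega> :: "nat \<Rightarrow> complex mat"
    and \<delta> :: real
  assumes "d \<ge> 1"
    and "channel d d T"
    and "unitary_mat d U"
    and "d = d0 + (\<Sum>k\<in>{1..K}. dk k * mk k)"
    and "\<forall>k\<in>{1..K}. density_op (mk k) (\<omega> k)"
    and "peripheral_space d T =
      {U * diag_block_mat (0\<^sub>m d0 d0 # map (\<lambda>k. kron (X k) (\<omega> k)) [1..<K+1]) * madj U | X.
         \<forall>k\<in>{1..K}. X k \<in> carrier_mat (dk k) (dk k)}"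
    and "0 \<le> \<delta>" and "\<delta> < 1"
  shows "(\<lambda>t. C_cap d \<delta> (T ^^ t)) \<longlonglongrightarrow> C_inf d \<delta> T
    \<and> C_inf d \<delta> T = ereal (log 2 (real_of_int \<lfloor>real (\<Sum>k\<in>{1..K}. dk k) / (1 - \<delta>)\<rfloor>))
    \<and> (\<lambda>t. Q_cap d \<delta> (T ^^ t)) \<longlonglongrightarrow> Q_inf d \<delta> T
    \<and> ereal (log 2 (real_of_int \<lfloor>real (Max (dk ` {1..K})) / sqrt (1 - \<delta>)\<rfloor>)) \<le> Q_inf d \<delta> T
    \<and> Q_inf d \<delta> T \<le> ereal (log 2 (real (Max (dk ` {1..K})) / (1 - \<delta>)))"
proof -
  note ch = \<open>channel d d T\<close> and d1 = \<open>d \<ge> 1\<close> and \<delta>0 = \<open>0 \<le> \<delta>\<close> and \<delta>1 = \<open>\<delta> < 1\<close>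
  interpret block_decomposition d d0 K dk mk \<omega> U
    using assms(3-5) by unfold_locales auto
  have per: "peripheral_space d T = range blockmat" using assms(6) blockmat_set by simp
  obtain r L where L: "pow_lim d T r L" and Lper: "\<And>X. X \<in> carrier_mat d d \<Longrightarrow> L X \<in> range blockmat"
    using peripheral_limit[OF ch] unfolding per by blast
  note Lch = pow_limD(1)[OF L]
  define N where "N = (\<Sum>k\<in>{1..K}. dk k)"
  define M where "M = Max (dk ` {1..K})"
  \<comment> \<open>Some block is nonempty: a state in the range of \<open>L\<close> has trace 1,
    which empty blocks cannot supply. This also makes \<open>Max\<close> meaningful.\<close>
  obtain k1 where k1: "k1 \<in> {1..K}" "1 \<le> dk k1"
  proof -
    obtain x where x: "L (munit d 0 0) = blockmat x" using Lper[of "munit d 0 0"] by auto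
    have "(\<Sum>k\<in>{1..K}. \<Sum>a<dk k. x k a a) = 1"
      using blockmat_trace[of x] channel_trace[OF Lch munit_carrier, of 0 0] mtrace_munit[of 0 d 0] d1 x by simp
    then have "\<exists>k\<in>{1..K}. (\<Sum>a<dk k. x k a a) \<noteq> 0" by (metis (no_types, lifting) sum.neutral zero_neq_one)
    then obtain k where "k \<in> {1..K}" "(\<Sum>a<dk k. x k a a) \<noteq> 0" by blast
    then show ?thesis using that[of k] by (cases "dk k") auto
  qed
  have "dk k1 \<le> N" unfolding N_def using k1(1) by (intro member_le_sum) auto
  then have N1: "1 \<le> N" using k1(2) by simp
  have Mle: "dk k \<le> M" if "k \<in> {1..K}" for k unfolding M_def using that by (intro Max_ge) auto
  have M1: "1 \<le> M" using Mle[OF k1(1)] k1(2) by simp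
  have "M \<in> dk ` {1..K}" unfolding M_def using k1(1) by (intro Max_in) auto
  then obtain k0 where k0: "k0 \<in> {1..K}" "dk k0 = M" by auto
  have rec: "\<exists>S. channel d d S \<and> (\<forall>x. S ((T ^^ t) (blockmat x)) = blockmat x)" for t
    using peripheral_recovery[OF ch, of t] unfolding per by blast
  have s: "0 < 1 - \<delta>" using \<delta>1 by simp

  have C_lower: "ereal (log 2 (real_of_int \<lfloor>real N / (1 - \<delta>)\<rfloor>)) \<le> C_cap d \<delta> (T ^^ t)" for t
  proof -
    obtain S where S: "channel d d S" "\<And>x. S ((T ^^ t) (blockmat x)) = blockmat x" using rec by blast
    \<comment> \<open>The largest size with N / D \<ge> 1 - \<delta>; it is at least
      \<open>N\<close> because \<delta> \<ge> 0.\<close>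
    define D where "D = nat \<lfloor>real N / (1 - \<delta>)\<rfloor>"
    have ge: "real N \<le> real N / (1 - \<delta>)" using s \<delta>0 by (simp add: field_simps)
    then have "int N \<le> \<lfloor>real N / (1 - \<delta>)\<rfloor>" by (simp add: le_floor_iff)
    then have ND: "N \<le> D" and fl: "\<lfloor>real N / (1 - \<delta>)\<rfloor> = int D" unfolding D_def by linarith+
    have "real D \<le> real N / (1 - \<delta>)" using of_int_floor_le[of "real N / (1 - \<delta>)"] unfolding fl by simp
    then have "(1 - \<delta>) * real D \<le> real N" using s by (simp add: field_simps)
    then have "\<exists>E. classical_code d (T ^^ t) D \<delta> E"
      using classical_code_exists[OF channel_funpow[OF ch] S] N1 ND unfolding N_def by blast
    then have "ereal (log 2 (real D)) \<le> C_cap d \<delta> (T ^^ t)"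
      unfolding C_cap_def using ND N1 by (intro Sup_upper CollectI exI[of _ D]) simp
    then show ?thesis unfolding fl by simp
  qed

  have Q_lower: "ereal (log 2 (real_of_int \<lfloor>real M / sqrt (1 - \<delta>)\<rfloor>)) \<le> Q_cap d \<delta> (T ^^ t)" for t
  proof -
    obtain S where S: "channel d d S" "\<And>x. S ((T ^^ t) (blockmat x)) = blockmat x" using rec by blast
    \<comment> \<open>The largest size with (M / D)^2 \<ge> 1 - \<delta>.\<close>
    define D where "D = nat \<lfloor>real M / sqrt (1 - \<delta>)\<rfloor>"
    have sq: "0 < sqrt (1 - \<delta>)" "sqrt (1 - \<delta>) \<le> 1" using s \<delta>0 by auto
    then have ge: "real M \<le> real M / sqrt (1 - \<delta>)" by (simp add: le_divide_eq mult_left_le)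
    then have "int M \<le> \<lfloor>real M / sqrt (1 - \<delta>)\<rfloor>" by (simp add: le_floor_iff)
    then have MD: "M \<le> D" and fl: "\<lfloor>real M / sqrt (1 - \<delta>)\<rfloor> = int D" unfolding D_def by linarith+
    have "real D \<le> real M / sqrt (1 - \<delta>)" using of_int_floor_le[of "real M / sqrt (1 - \<delta>)"] unfolding fl by simp
    then have "sqrt (1 - \<delta>) * real D \<le> real M" using sq by (simp add: field_simps)
    then have "(sqrt (1 - \<delta>) * real D)\<^sup>2 \<le> (real M)\<^sup>2" using sq by (intro power_mono) auto
    then have "(1 - \<delta>) * (real D)\<^sup>2 \<le> (real M)\<^sup>2" using s by (simp add: power_mult_distrib)
    then have "\<exists>E. quantum_code d (T ^^ t) D \<delta> E"
      using quantum_code_exists[OF channel_funpow[OF ch] S k0(1)] M1 MD unfolding k0(2) by blast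
    then have "ereal (log 2 (real D)) \<le> Q_cap d \<delta> (T ^^ t)"
      unfolding Q_cap_def using MD M1 by (intro Sup_upper CollectI exI[of _ D]) simp
    then show ?thesis unfolding fl by simp
  qed

  have C_upper: "\<exists>t. C_cap d \<delta> (T ^^ t) \<le> ereal (log 2 (real_of_int \<lfloor>real N / (1 - \<delta>)\<rfloor>))"
  proof -
    obtain \<eta> where \<eta>: "0 < \<eta>" and gap: "\<And>D::nat. real D * (1 - \<delta> - \<eta>) \<le> real N \<Longrightarrow> real D * (1 - \<delta>) \<le> real N"
      using nat_le_quotient_gap[of "real N" "1 - \<delta>"] s by auto
    \<comment> \<open>The power of \<open>d\<close> is that of \<open>channel_perturb\<close>, so
      each term of the success sum changes by at most \<eta>.\<close>
    define \<epsilon> where "\<epsilon> = \<eta> / real d ^ 4"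
    have \<epsilon>: "0 < \<epsilon>" "real d ^ 4 * \<epsilon> = \<eta>" using \<eta> d1 by (auto simp: \<epsilon>_def)
    obtain t where t: "\<And>a b p q. a < d \<Longrightarrow> b < d \<Longrightarrow> p < d \<Longrightarrow> q < d \<Longrightarrow>
        cmod ((T ^^ t) (munit d a b) $$ (p, q) - L (munit d a b) $$ (p, q)) \<le> \<epsilon>"
      using pow_lim_uniform[OF L \<epsilon>(1)] by blast
    have "C_cap d \<delta> (T ^^ t) \<le> ereal (log 2 (real_of_int \<lfloor>real N / (1 - \<delta>)\<rfloor>))"
      unfolding C_cap_def
    proof (rule Sup_least)
      fix y assume "y \<in> {ereal (log 2 (real D)) | D. D \<ge> 1 \<and> (\<exists>E. classical_code d (T ^^ t) D \<delta> E)}"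
      then obtain D E where y: "y = ereal (log 2 (real D))" and D: "1 \<le> D" and "classical_code d (T ^^ t) D \<delta> E" by blast
      then obtain R where E: "channel D d E" and R: "channel d D R"
        and v: "1 - \<delta> \<le> (1 / real D) * (\<Sum>i<D. Re (R ((T ^^ t) (E (munit D i i))) $$ (i, i)))"
        unfolding classical_code_def basis_proj_eq_munit by blast
      have "(\<Sum>i<D. Re (R ((T ^^ t) (E (munit D i i))) $$ (i, i))) \<le> (\<Sum>i<D. Re (R (L (E (munit D i i))) $$ (i, i)) + \<eta>)"
        using channel_perturb[OF E R channel_funpow[OF ch] Lch t] unfolding \<epsilon>(2) by (intro sum_mono) simp
      also have "\<dots> \<le> real N + real D * \<eta>"
        using classical_success_le[OF Lch Lper E R] by (simp add: sum.distrib N_def)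
      finally have "(\<Sum>i<D. Re (R ((T ^^ t) (E (munit D i i))) $$ (i, i))) \<le> real N + real D * \<eta>" .
      moreover have "real D * (1 - \<delta>) \<le> (\<Sum>i<D. Re (R ((T ^^ t) (E (munit D i i))) $$ (i, i)))"
        using v D by (simp add: field_simps)
      ultimately have "real D * (1 - \<delta> - \<eta>) \<le> real N" by (simp add: algebra_simps)
      then have "real D \<le> real N / (1 - \<delta>)" using gap s by (simp add: field_simps)
      then have "int D \<le> \<lfloor>real N / (1 - \<delta>)\<rfloor>" by (simp add: le_floor_iff)
      then have "real D \<le> real_of_int \<lfloor>real N / (1 - \<delta>)\<rfloor>" by linarith
      then show "y \<le> ereal (log 2 (real_of_int \<lfloor>real N / (1 - \<delta>)\<rfloor>))"
        unfolding y using D by (simp add: log_mono)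
    qed
    then show ?thesis ..
  qed

  have Q_upper: "\<exists>t. Q_cap d \<delta> (T ^^ t) \<le> ereal (log 2 (real M / (1 - \<delta>)))"
  proof -
    obtain \<eta> where \<eta>: "0 < \<eta>" and gap: "\<And>D::nat. real D * (1 - \<delta> - \<eta>) \<le> real M \<Longrightarrow> real D * (1 - \<delta>) \<le> real M"
      using nat_le_quotient_gap[of "real M" "1 - \<delta>"] s by auto
    define \<epsilon> where "\<epsilon> = \<eta> / real d ^ 4"
    have \<epsilon>: "0 < \<epsilon>" "real d ^ 4 * \<epsilon> = \<eta>" using \<eta> d1 by (auto simp: \<epsilon>_def)
    obtain t where t: "\<And>a b p q. a < d \<Longrightarrow> b < d \<Longrightarrow> p < d \<Longrightarrow> q < d \<Longrightarrow>
        cmod ((T ^^ t) (munit d a b) $$ (p, q) - L (munit d a b) $$ (p, q)) \<le> \<epsilon>"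
      using pow_lim_uniform[OF L \<epsilon>(1)] by blast
    have "Q_cap d \<delta> (T ^^ t) \<le> ereal (log 2 (real M / (1 - \<delta>)))"
      unfolding Q_cap_def
    proof (rule Sup_least)
      fix y assume "y \<in> {ereal (log 2 (real D)) | D. D \<ge> 1 \<and> (\<exists>E. quantum_code d (T ^^ t) D \<delta> E)}"
      then obtain D E where y: "y = ereal (log 2 (real D))" and D: "1 \<le> D" and "quantum_code d (T ^^ t) D \<delta> E" by blast
      then obtain R where E: "channel D d E" and R: "channel d D R"
        and v: "1 - \<delta> \<le> (let Y = ampl D D D (R \<circ> (T ^^ t) \<circ> E) (max_ent D) in
          Re ((1 / of_nat D) * (\<Sum>i<D. \<Sum>j<D. Y $$ (i * D + i, j * D + j))))"
        unfolding quantum_code_def by blast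
      have "channel D D (R \<circ> (T ^^ t) \<circ> E)"
        using channel_comp[OF channel_comp[OF E channel_funpow[OF ch]] R] by (simp add: o_assoc)
      note v = v[unfolded max_ent_fidelity[OF this]]
      let ?F = "\<Sum>i<D. \<Sum>j<D. Re (R ((T ^^ t) (E (munit D i j))) $$ (i, j))"
      have "?F \<le> (\<Sum>i<D. \<Sum>j<D. Re (R (L (E (munit D i j))) $$ (i, j)) + \<eta>)"
        using channel_perturb[OF E R channel_funpow[OF ch] Lch t] unfolding \<epsilon>(2) by (intro sum_mono) simp
      also have "\<dots> \<le> real M * real D + (real D)\<^sup>2 * \<eta>"
        using quantum_success_le[OF Lch Lper E R Mle] by (simp add: sum.distrib power2_eq_square)
      finally have "?F \<le> real M * real D + (real D)\<^sup>2 * \<eta>" .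
      moreover have "(real D)\<^sup>2 * (1 - \<delta>) \<le> ?F"
        using v D by (simp add: field_simps)
      \<comment> \<open>The fidelity sum has D^2 terms, each with error \<eta>, against the
        normalisation D^2; cancelling one factor \<open>D\<close> leaves the gap inequality of the
        classical case with \<open>M\<close> in place of \<open>N\<close>.\<close>
      ultimately have "real D * (real D * (1 - \<delta> - \<eta>)) \<le> real D * real M"
        by (simp add: algebra_simps power2_eq_square)
      then have "real D * (1 - \<delta> - \<eta>) \<le> real M" using D by simp
      then have "real D \<le> real M / (1 - \<delta>)" using gap s by (simp add: field_simps)
      then show "y \<le> ereal (log 2 (real M / (1 - \<delta>)))" unfolding y using D by simp
    qed
    then show ?thesis ..
  qed

  \<comment> \<open>A decreasing sequence of extended reals tends to its infimum, so lower bounds at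
    all \<open>t\<close> and an upper bound at one \<open>t\<close> settle the limit.\<close>
  have C_lim: "(\<lambda>t. C_cap d \<delta> (T ^^ t)) \<longlonglongrightarrow> (INF t. C_cap d \<delta> (T ^^ t))"
    by (rule LIMSEQ_INF[OF C_cap_decseq[OF ch]])
  have Q_lim: "(\<lambda>t. Q_cap d \<delta> (T ^^ t)) \<longlonglongrightarrow> (INF t. Q_cap d \<delta> (T ^^ t))"
    by (rule LIMSEQ_INF[OF Q_cap_decseq[OF ch]])
  have C_inf: "C_inf d \<delta> T = (INF t. C_cap d \<delta> (T ^^ t))" unfolding C_inf_def by (rule limI[OF C_lim])
  have Q_inf: "Q_inf d \<delta> T = (INF t. Q_cap d \<delta> (T ^^ t))" unfolding Q_inf_def by (rule limI[OF Q_lim])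
  have "(INF t. C_cap d \<delta> (T ^^ t)) = ereal (log 2 (real_of_int \<lfloor>real N / (1 - \<delta>)\<rfloor>))"
    using C_upper C_lower by (intro antisym INF_greatest) (auto intro: INF_lower2)
  moreover have "ereal (log 2 (real_of_int \<lfloor>real M / sqrt (1 - \<delta>)\<rfloor>)) \<le> (INF t. Q_cap d \<delta> (T ^^ t))"
    using Q_lower by (intro INF_greatest)
  moreover have "(INF t. Q_cap d \<delta> (T ^^ t)) \<le> ereal (log 2 (real M / (1 - \<delta>)))"
    using Q_upper by (auto intro: INF_lower2)
  ultimately show ?thesis using C_lim Q_lim unfolding C_inf Q_inf N_def M_def by blast
qed

end
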